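(* Let $k\ge1$ be a fixed integer and let $\mathbf{A}_n(1),\mathbf{A}_n(2),\dots,\mathbf{A}_n(\lfloor k/2\rfloor+1)$ be independent $\mathbf{Wigner}(n,1)$ matrices for every $n$. Then, almost surely, the spectral measures of the symmetric circulant block-matrices satisfy $$\mu_{\mathbb{C}_k(\mathbf{A}_n(1),\mathbf{A}_n(2),\dots,\mathbf{A}_n(\lfloor k/2\rfloor+1))}\longrightarrow \nu_k\quad\text{weakly as } n\to\infty,$$ where $$\nu_k=\begin{cases}\frac{k-1}{k}\,\gamma_{0,\frac{k-1}{k}}+\frac1k\,\gamma_{0,\frac{2k-1}{k}}, & k\text{ odd},\\[4pt] \frac{k-2}{k}\,\gamma_{0,\frac{k-2}{k}}+\frac2k\,\gamma_{0,\frac{2k-2}{k}}, & k\text{ even}.\end{cases}$$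
   Context: Spectral measure: for a Hermitian $N\times N$ matrix $\mathbf{A}$ with eigenvalues $\lambda_1\le\dots\le\lambda_N$ (with multiplicity), $\mu_{\mathbf{A}}=\frac1N\sum_{j=1}^N\delta_{\lambda_j}$. Wigner matrices: an $n\times n$ Hermitian random matrix $\mathbf{A}_n=\frac1{\sqrt n}(X_{ij})_{i,j=1}^n$ is a $\mathbf{Wigner}(n,\sigma^2)$ matrix if $\{X_{ij}:1\le i<j\}$ are i.i.d. complex random variables with $E(X_{12})=0$, $E(|X_{12}|^2)=\sigma^2$, and $\{X_{ii}:i\ge1\}$ are i.i.d. real random variables independent of the family $\{X_{ij}:1\le i<j\}$ ($X_{ji}=\overline{X_{ij}}$). In a sequence $\{\mathbf{A}_n\}_{n\ge1}$, all the matrices are built from the same infinite array $(X_{ij})_{i,j\ge1}$; here the arrays defining $\mathbf{A}_n(1),\mathbf{A}_n(2),\dots$ are independent. Symmetric circulant: $\mathbb{C}_k(a_1,\dots,a_k)$ is $\frac1{\sqrt k}$ times the $k\times k$ circulant matrix with first row $(a_1,a_2,\dots,a_k)$, each subsequent row being the cyclic shift of the previous one by one place to the right (second row $(a_k,a_1,\dots,a_{k-1})$, etc.), where $a_j=a_{k-j+2}$ for $j=2,\dots,k$. Hence it is determined by $a_1,\dots,a_{\lfloor k/2\rfloor+1}$ and is written $\mathbb{C}_k(a_1,\dots,a_{\lfloor k/2\rfloor+1})$. Substituting $n\times n$ matrices for the letters gives an $nk\times nk$ block-matrix (including the factor $\frac1{\sqrt k}$). Semicircle law: $\gamma_{\alpha,\sigma^2}(dx)=\frac{1}{2\pi\sigma^2}\sqrt{4\sigma^2-(x-\alpha)^2}\,\mathbf{1}_{[\alpha-2\sigma,\alpha+2\sigma]}(x)\,dx$.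 For $k=1,2$ the first term of $\nu_k$ has weight zero and is omitted. *)

theory Defs
  imports "HOL-Probability.Probability" "Jordan_Normal_Form.Char_Poly"
begin

definition weighted_measure_sum :: "(real \<times> real measure) list \<Rightarrow> real measure" where
  "weighted_measure_sum ws =
     measure_of UNIV (sets borel) (\<lambda>B. \<Sum>(w, \<mu>)\<leftarrow>ws. ennreal w * emeasure \<mu> B)"

lemma sets_weighted_measure_sum [simp]: "sets (weighted_measure_sum ws) = sets borel"
  using sets.sigma_sets_eq[of "borel :: real measure"] by (simp add: weighted_measure_sum_def)

text \<open>\<^const>\<open>measure_of\<close> silently yields the null measure when its argument is not countably
  additive; the following fact excludes this.\<close>

lemma emeasure_weighted_measure_sum:
  assumes "\<And>w \<mu>. (w, \<mu>) \<in> set ws \<Longrightarrow> sets \<mu> = sets borel" and "B \<in> sets borel"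
  shows "emeasure (weighted_measure_sum ws) B = (\<Sum>(w, \<mu>)\<leftarrow>ws. ennreal w * emeasure \<mu> B)"
proof -
  let ?f = "\<lambda>ws B. \<Sum>(w, \<mu>)\<leftarrow>ws. ennreal w * emeasure \<mu> B"
  have "(\<Sum>i. ?f ws (F i)) = ?f ws (\<Union>i. F i)"
    if "range F \<subseteq> sets borel" "disjoint_family F" for F :: "nat \<Rightarrow> real set"
    using assms(1)
  proof (induction ws)
    case Nil
    show ?case by simp
  next
    case (Cons p ws)
    obtain w \<mu> where p: "p = (w, \<mu>)" by (cases p)
    have "sets \<mu> = sets borel" using Cons.prems[of w \<mu>] p by simp
    then have "(\<Sum>i. emeasure \<mu> (F i)) = emeasure \<mu> (\<Union>i. F i)"
      using that by (intro suminf_emeasure) auto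
    moreover have "(\<Sum>i. ?f ws (F i)) = ?f ws (\<Union>i. F i)"
      using Cons by (meson list.set_intros(2))
    ultimately show ?case
      by (simp add: p suminf_add[symmetric])
  qed
  then have "countably_additive (sets borel) (?f ws)"
    by (auto simp: countably_additive_def)
  moreover have "positive (sets borel) (?f ws)"
    by (auto simp: positive_def case_prod_beta)
  ultimately show ?thesis
    using assms(2) sets.sigma_algebra_axioms[of "borel :: real measure"]
    unfolding weighted_measure_sum_def
    by (intro emeasure_measure_of_sigma) auto
qed

text \<open>For Hermitian \<open>A\<close> the roots of the characteristic polynomial are real, so that \<^const>\<open>Re\<close>
  is only a type conversion.\<close>

definition hermitian_eigenvalues :: "complex mat \<Rightarrow> real list" where
  "hermitian_eigenvalues A = sorted_list_of_multiset (image_mset Re (proots (char_poly A)))"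

definition spectral_measure :: "complex mat \<Rightarrow> real measure" where
  "spectral_measure A =
     weighted_measure_sum
       (map (\<lambda>l. (1 / real (dim_row A), return borel l)) (hermitian_eigenvalues A))"

text \<open>The second argument is the variance \<open>\<sigma>\<^sup>2\<close>. For variance \<open>0\<close> this is the null measure; below
  that case only occurs with weight \<open>0\<close>.\<close>

definition semicircle :: "real \<Rightarrow> real \<Rightarrow> real measure" where
  "semicircle \<alpha> v =
     density lborel (\<lambda>x. ennreal (1 / (2 * pi * v) * sqrt (4 * v - (x - \<alpha>)\<^sup>2)
       * indicator {\<alpha> - 2 * sqrt v .. \<alpha> + 2 * sqrt v} x))"

definition nu :: "nat \<Rightarrow> real measure" where
  "nu k =
    (if odd k
     then weighted_measure_sum
       [((real k - 1) / real k, semicircle 0 ((real k - 1) / real k)),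
        (1 / real k, semicircle 0 ((2 * real k - 1) / real k))]
     else weighted_measure_sum
       [((real k - 2) / real k, semicircle 0 ((real k - 2) / real k)),
        (2 / real k, semicircle 0 ((2 * real k - 2) / real k))])"

text \<open>Infinite arrays defining Wigner matrices; rows and columns are indexed from \<open>0\<close>, so
  \<open>X 0 1\<close> is the entry \<open>X\<^sub>1\<^sub>2\<close>. The diagonal entries are real by the Hermitian symmetry.\<close>

definition (in prob_space) wigner_array :: "real \<Rightarrow> (nat \<Rightarrow> nat \<Rightarrow> 'a \<Rightarrow> complex) \<Rightarrow> bool" where
  "wigner_array v X \<longleftrightarrow>
     (\<forall>i j. random_variable borel (X i j)) \<and>
     (\<forall>i j. \<forall>\<omega>\<in>space M. X j i \<omega> = cnj (X i j \<omega>)) \<and>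
     indep_vars (\<lambda>_. borel) (\<lambda>(i, j). X i j) {(i, j). i < j} \<and>
     (\<forall>i j. i < j \<longrightarrow> distr M borel (X i j) = distr M borel (X 0 1)) \<and>
     integrable M (X 0 1) \<and> expectation (X 0 1) = 0 \<and>
     integrable M (\<lambda>\<omega>. (cmod (X 0 1 \<omega>))\<^sup>2) \<and> expectation (\<lambda>\<omega>. (cmod (X 0 1 \<omega>))\<^sup>2) = v \<and>
     indep_vars (\<lambda>_. borel) (\<lambda>i. X i i) UNIV \<and>
     (\<forall>i. distr M borel (X i i) = distr M borel (X 0 0)) \<and>
     indep_var
       (Pi\<^sub>M {(i, j). i < j} (\<lambda>_. borel)) (\<lambda>\<omega>. \<lambda>(i, j)\<in>{(i, j). i < j}. X i j \<omega>)
       (Pi\<^sub>M {(i, j). i = j} (\<lambda>_. borel)) (\<lambda>\<omega>. \<lambda>(i, j)\<in>{(i, j). i = j}. X i j \<omega>)"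

definition wigner_matrix :: "nat \<Rightarrow> (nat \<Rightarrow> nat \<Rightarrow> 'a \<Rightarrow> complex) \<Rightarrow> 'a \<Rightarrow> complex mat" where
  "wigner_matrix n X \<omega> = Matrix.mat n n (\<lambda>(i, j). X i j \<omega> / complex_of_real (sqrt (real n)))"

text \<open>The letters \<open>a 1, \<dots>, a k\<close> are indexed from \<open>1\<close>, whereas matrix positions start at \<open>0\<close>: the
  block in block-row \<open>p\<close> and block-column \<open>q\<close> is the letter with number \<open>((q - p) mod k) + 1\<close>.\<close>

definition circulant_block :: "nat \<Rightarrow> nat \<Rightarrow> (nat \<Rightarrow> complex mat) \<Rightarrow> complex mat" where
  "circulant_block k n a =
     Matrix.mat (n * k) (n * k) (\<lambda>(i, j).
       a (nat ((int (j div n) - int (i div n)) mod int k) + 1) $$ (i mod n, j mod n)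
         / complex_of_real (sqrt (real k)))"

definition sym_circulant_block :: "nat \<Rightarrow> nat \<Rightarrow> (nat \<Rightarrow> complex mat) \<Rightarrow> complex mat" where
  "sym_circulant_block k n a =
     circulant_block k n (\<lambda>j. if j \<le> k div 2 + 1 then a j else a (k - j + 2))"

end

theory Submission
  imports Defs "HOL-Real_Asymp.Real_Asymp"
begin

text \<open>
  The discrete Fourier transform in the block index turns the symmetric circulant block matrix into
  \<open>k\<close> blocks, each a real linear combination of the independent Wigner matrices whose squared
  coefficients sum to \<open>(k - m) / k\<close> or \<open>(2 k - m) / k\<close>, where \<open>m = 1\<close> for odd and \<open>m = 2\<close> for even \<open>k\<close>.
  So the Stieltjes transform of the block matrix is the average of those of the blocks, and it
  suffices to prove the semicircle law for such a combination, of variance \<open>v\<close>.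

  Let \<open>s\<close> be the normalised trace of its resolvent at a point \<open>z\<close> of the upper half plane. Changing one row
  and column is a perturbation of rank two and moves \<open>s\<close> by \<open>O(1/n)\<close>, so \<open>s - E s \<rightarrow> 0\<close> almost surely by the
  bounded difference inequality. Removing the diagonal changes \<open>E s\<close> by \<open>o(1)\<close>. Expanding the resolvent to
  second order in each off-diagonal entry gives \<open>1 + z E s + v E s\<^sup>2 \<rightarrow> 0\<close>, so \<open>s\<close> converges to the
  root with positive imaginary part of \<open>v m\<^sup>2 + z m + 1 = 0\<close>. The imaginary part of this root tends to
  \<open>\<pi>\<close> times the semicircle density at the real axis, and integrating over intervals (Stieltjes
  inversion) yields the weak convergence.
\<close>

unbundle no vec_syntax

section \<open>Resolvents of Hermitian matrices\<close>

text \<open>Off-diagonal entries have only a second moment, \<open>E X^2\<close> is arbitrary, and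
  the diagonal has no assumed moments. Therefore perturbation errors carry a factor
  \<open>min 1\<close>, which tends to zero in mean by dominated convergence. The terms with
  \<open>E X^2\<close> multiply \<open>(G a b)^2\<close> rather than \<open>G a a * G b b\<close>;
  by the Ward identity such squares sum to \<open>O(1)\<close> along a row, hence to
  \<open>O(n)\<close> over about \<open>n^2\<close> pairs. Concentration works with whole rows:
  \<open>n\<close> independent groups, each moving \<open>s\<close> by \<open>O(1/n)\<close>, give
  \<open>exp (- c n)\<close>, whereas about \<open>n^2\<close> single entries with the same bound
  would only give a constant. Concentration also turns \<open>E s^2\<close> into
  \<open>(E s)^2\<close>. The Fourier coefficients are real because offsets \<open>q\<close> and
  \<open>k - q\<close> carry the same letter, so that characters combine to cosines. The number
  \<open>m\<close> counts the offsets without a partner: \<open>0\<close>, and \<open>k / 2\<close>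
  for even \<open>k\<close>. The frequencies of larger variance are the same residues, which
  explains the weight \<open>m / k\<close>. To have one null set for all \<open>z\<close>, almost
  sure convergence is first taken at rational points.\<close>

definition hermitian_on :: "nat \<Rightarrow> (nat \<Rightarrow> nat \<Rightarrow> complex) \<Rightarrow> bool" where
  "hermitian_on n A \<longleftrightarrow> (\<forall>i<n. \<forall>j<n. A j i = cnj (A i j))"

lemma hermitian_onD: "hermitian_on n A \<Longrightarrow> i < n \<Longrightarrow> j < n \<Longrightarrow> A j i = cnj (A i j)"
  unfolding hermitian_on_def by blast

text \<open>Pair the equation \<open>(A - z) g = u\<close> with \<open>g\<close>: the form of
  \<open>A\<close> at \<open>g\<close> is real, so the imaginary part isolates \<open>Im z\<close>
  times the squared norm. Invertibility, uniqueness and the Ward identity are instances with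
  different \<open>u\<close>.\<close>

lemma hermitian_shifted_solution:
  assumes A: "hermitian_on n A"
    and g: "\<And>i. i < n \<Longrightarrow> (\<Sum>j<n. A i j * g j) = z * g i + u i"
  shows "Im z * (\<Sum>i<n. (cmod (g i))\<^sup>2) = Im (\<Sum>i<n. cnj (u i) * g i)"
proof -
  let ?N = "\<Sum>i<n. cnj (g i) * g i"
  let ?S = "\<Sum>i<n. cnj (u i) * g i"
  have "(\<Sum>i<n. cnj (g i) * (\<Sum>j<n. A i j * g j)) = (\<Sum>i<n. cnj (g i) * (z * g i + u i))"
    by (intro sum.cong refl) (simp only: g lessThan_iff)
  also have "\<dots> = z * ?N + cnj ?S"
    by (simp add: distrib_left sum.distrib sum_distrib_left mult_ac)
  finally have 1: "(\<Sum>i<n. cnj (g i) * (\<Sum>j<n. A i j * g j)) = z * ?N + cnj ?S" .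
  have 2: "(\<Sum>i<n. cnj (g i) * (\<Sum>j<n. A i j * g j))
      = (\<Sum>j<n. cnj (\<Sum>i<n. A j i * g i) * g j)"
    unfolding sum_distrib_left sum_distrib_right cnj_sum
    by (subst sum.swap) (intro sum.cong refl, subst hermitian_onD[OF A], auto)
  have "(\<Sum>j<n. cnj (\<Sum>i<n. A j i * g i) * g j) = (\<Sum>j<n. cnj (z * g j + u j) * g j)"
    by (intro sum.cong refl) (simp only: g lessThan_iff)
  also have "\<dots> = cnj z * ?N + ?S"
    by (simp add: algebra_simps sum.distrib sum_distrib_left)
  finally have "(z - cnj z) * ?N = ?S - cnj ?S"
    using 1 2 by (simp add: algebra_simps)
  moreover have "?N = of_real (\<Sum>i<n. (cmod (g i))\<^sup>2)"
    unfolding of_real_sum by (intro sum.cong refl) (metis complex_norm_square mult.commute)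
  ultimately have "Im ((z - cnj z) * of_real (\<Sum>i<n. (cmod (g i))\<^sup>2)) = Im (?S - cnj ?S)"
    by simp
  then show ?thesis by (simp del: Im_sum cnj_sum)
qed

section \<open>The resolvent \<open>(A - z)^(-1)\<close> and its algebra\<close>

definition shifted_mat :: "nat \<Rightarrow> (nat \<Rightarrow> nat \<Rightarrow> complex) \<Rightarrow> complex \<Rightarrow> complex mat" where
  "shifted_mat n A z = Matrix.mat n n (\<lambda>(i, j). A i j - (if i = j then z else 0))"

text \<open>Adjugate over determinant is a total function whose entries are rational in those of
  \<open>A\<close>; measurability is read off from this form. With the sign of \<open>A - z\<close>
  the diagonal has positive imaginary part in the upper half plane.\<close>

definition resolvent :: "nat \<Rightarrow> (nat \<Rightarrow> nat \<Rightarrow> complex) \<Rightarrow> complex \<Rightarrow> nat \<Rightarrow> nat \<Rightarrow> complex" where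
  "resolvent n A z i j =
     adj_mat (shifted_mat n A z) $$ (i, j) / Determinant.det (shifted_mat n A z)"

lemma shifted_mat_carrier [simp]: "shifted_mat n A z \<in> carrier_mat n n"
  by (simp add: shifted_mat_def)

text \<open>A kernel vector solves the shifted equation with \<open>u = 0\<close>, so
  \<open>Im z\<close> times its squared norm vanishes.\<close>

lemma det_shifted_mat_nonzero:
  assumes A: "hermitian_on n A" and z: "Im z \<noteq> 0"
  shows "Determinant.det (shifted_mat n A z) \<noteq> 0"
proof
  assume "Determinant.det (shifted_mat n A z) = 0"
  then obtain v where v: "v \<in> carrier_vec n" "v \<noteq> 0\<^sub>v n" "shifted_mat n A z *\<^sub>v v = 0\<^sub>v n"
    using det_0_iff_vec_prod_zero[OF shifted_mat_carrier] by blast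
  have "(\<Sum>j<n. A i j * v $ j) = z * v $ i + 0" if i: "i < n" for i
  proof -
    have "0 = (shifted_mat n A z *\<^sub>v v) $ i" using v i by simp
    also have "\<dots> = (\<Sum>j<n. (A i j - (if i = j then z else 0)) * v $ j)"
      using v(1) i unfolding shifted_mat_def
      by (simp add: scalar_prod_def atLeast0LessThan carrier_vecD)
    also have "\<dots> = (\<Sum>j<n. A i j * v $ j) - (\<Sum>j<n. (if i = j then z * v $ j else 0))"
      unfolding sum_subtractf[symmetric] by (intro sum.cong) (auto simp: algebra_simps)
    also have "\<dots> = (\<Sum>j<n. A i j * v $ j) - z * v $ i"
      using i by (subst sum.delta') auto
    finally show ?thesis by simp
  qed
  from hermitian_shifted_solution[OF A, of "\<lambda>j. v $ j" z "\<lambda>_. 0", OF this] z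
  have "(\<Sum>i<n. (cmod (v $ i))\<^sup>2) = 0" by simp
  then have "\<forall>i<n. v $ i = 0" by (subst (asm) sum_nonneg_eq_0_iff) auto
  with v show False by (auto intro!: eq_vecI)
qed

lemma index_mult_mat_sum:
  assumes "A \<in> carrier_mat n n" "B \<in> carrier_mat n n" "i < n" "j < n"
  shows "(A * B) $$ (i, j) = (\<Sum>k<n. A $$ (i, k) * B $$ (k, j))"
proof -
  have "(A * B) $$ (i, j) = row A i \<bullet> col B j"
    using assms by (intro index_mult_mat) auto
  also have "\<dots> = (\<Sum>k<n. row A i $ k * col B j $ k)"
    using assms by (simp add: scalar_prod_def atLeast0LessThan)
  also have "\<dots> = (\<Sum>k<n. A $$ (i, k) * B $$ (k, j))"
    using assms by (intro sum.cong refl) auto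
  finally show ?thesis .
qed

lemma resolvent_cong:
  assumes "\<And>i j. i < n \<Longrightarrow> j < n \<Longrightarrow> A i j = B i j"
  shows "resolvent n A z = resolvent n B z"
proof -
  have "shifted_mat n A z = shifted_mat n B z"
    using assms by (intro eq_matI) (auto simp: shifted_mat_def)
  then show ?thesis by (simp add: resolvent_def[abs_def])
qed

text \<open>Entrywise form of \<open>(A - z) G = 1 = G (A - z)\<close>, read off from the adjugate.
  Most later arguments use the resolvent only through these two equations.\<close>

lemma resolvent_eqs:
  assumes A: "hermitian_on n A" and z: "Im z \<noteq> 0" and ij: "i < n" "j < n"
  shows resolvent_right: "(\<Sum>k<n. A i k * resolvent n A z k j) =
      z * resolvent n A z i j + (if i = j then 1 else 0)"
    and resolvent_left: "(\<Sum>k<n. resolvent n A z i k * A k j) =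
      z * resolvent n A z i j + (if i = j then 1 else 0)"
proof -
  let ?M = "shifted_mat n A z"
  let ?G = "resolvent n A z"
  let ?d = "Determinant.det ?M"
  have d: "?d \<noteq> 0" by (rule det_shifted_mat_nonzero[OF A z])
  have adj: "adj_mat ?M \<in> carrier_mat n n" using adj_mat(1)[OF shifted_mat_carrier] .
  have cancel: "x = y + (if b then 1 else 0)" if "(if b then ?d else 0) = ?d * (x - y)" for x y b
  proof -
    have "?d * (x - y) = ?d * (if b then 1 else 0)" using that by (cases b) auto
    then have "x - y = (if b then 1 else 0)" by (simp only: mult_left_cancel[OF d])
    then show ?thesis by (simp only: diff_eq_eq add.commute)
  qed
  have dG: "adj_mat ?M $$ (i, j) = ?d * ?G i j" for i j
    using d by (simp add: resolvent_def)
  have M: "?M $$ (i, j) = A i j - (if i = j then z else 0)" if "i < n" "j < n" for i j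
    using that by (simp add: shifted_mat_def)
  have "(if i = j then ?d else 0) = (?M * adj_mat ?M) $$ (i, j)"
    unfolding adj_mat(2)[OF shifted_mat_carrier] using ij by simp
  also have "\<dots> = (\<Sum>k<n. ?M $$ (i, k) * adj_mat ?M $$ (k, j))"
    using ij by (intro index_mult_mat_sum adj shifted_mat_carrier)
  also have "\<dots> = (\<Sum>k<n. (A i k - (if i = k then z else 0)) * (?d * ?G k j))"
    using ij by (intro sum.cong refl) (simp add: M dG)
  also have "\<dots> = ?d * ((\<Sum>k<n. A i k * ?G k j) - (\<Sum>k<n. if i = k then z * ?G k j else 0))"
    unfolding sum_subtractf[symmetric] sum_distrib_left
    by (intro sum.cong) (auto simp: algebra_simps)
  also have "(\<Sum>k<n. if i = k then z * ?G k j else 0) = z * ?G i j"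
    using ij by (subst sum.delta') auto
  finally show "(\<Sum>k<n. A i k * ?G k j) = z * ?G i j + (if i = j then 1 else 0)"
    by (rule cancel)
  have "(if i = j then ?d else 0) = (adj_mat ?M * ?M) $$ (i, j)"
    unfolding adj_mat(3)[OF shifted_mat_carrier] using ij by simp
  also have "\<dots> = (\<Sum>k<n. adj_mat ?M $$ (i, k) * ?M $$ (k, j))"
    using ij by (intro index_mult_mat_sum adj shifted_mat_carrier)
  also have "\<dots> = (\<Sum>k<n. (?d * ?G i k) * (A k j - (if k = j then z else 0)))"
    using ij by (intro sum.cong refl) (simp add: M dG)
  also have "\<dots> = ?d * ((\<Sum>k<n. ?G i k * A k j) - (\<Sum>k<n. if k = j then z * ?G i k else 0))"
    unfolding sum_subtractf[symmetric] sum_distrib_left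
    by (intro sum.cong) (auto simp: algebra_simps)
  also have "(\<Sum>k<n. if k = j then z * ?G i k else 0) = z * ?G i j"
    using ij by (subst sum.delta) auto
  finally show "(\<Sum>k<n. ?G i k * A k j) = z * ?G i j + (if i = j then 1 else 0)"
    by (rule cancel)
qed

text \<open>Let \<open>G\<close> and \<open>H\<close> be the two resolvents. Evaluate
  \<open>G A H\<close> by the left equation of \<open>G\<close> and \<open>G B H\<close> by the
  right equation of \<open>H\<close>, then subtract. Two matrices and two points at once cover
  perturbations as well as the dependence on \<open>z\<close>.\<close>

lemma resolvent_identity:
  assumes A: "hermitian_on n A" and B: "hermitian_on n B" and z: "Im z \<noteq> 0" "Im w \<noteq> 0"
    and ij: "i < n" "j < n"
  shows "resolvent n A z i j - resolvent n B w i j =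
    (\<Sum>k<n. \<Sum>l<n. resolvent n A z i k * (B k l - A k l) * resolvent n B w l j)
     + (z - w) * (\<Sum>k<n. resolvent n A z i k * resolvent n B w k j)"
proof -
  let ?G = "resolvent n A z" and ?H = "resolvent n B w"
  have *: "(\<Sum>l<n. (\<Sum>k<n. ?G i k * A k l) * ?H l j) = (\<Sum>l<n. (z * ?G i l + (if i = l then 1 else 0)) * ?H l j)"
    by (intro sum.cong refl) (simp add: resolvent_left[OF A z(1) ij(1)])
  also have "\<dots> = z * (\<Sum>l<n. ?G i l * ?H l j) + (\<Sum>l<n. if i = l then ?H l j else 0)"
    unfolding sum_distrib_left sum.distrib[symmetric] by (intro sum.cong) (auto simp: algebra_simps)
  also have "(\<Sum>l<n. if i = l then ?H l j else 0) = ?H i j"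
    using ij by (subst sum.delta') auto
  finally have 1: "(\<Sum>k<n. \<Sum>l<n. ?G i k * A k l * ?H l j) = z * (\<Sum>l<n. ?G i l * ?H l j) + ?H i j"
    by (subst sum.swap) (simp add: sum_distrib_right)
  have "(\<Sum>k<n. ?G i k * (\<Sum>l<n. B k l * ?H l j)) = (\<Sum>k<n. ?G i k * (w * ?H k j + (if k = j then 1 else 0)))"
    by (intro sum.cong refl) (simp add: resolvent_right[OF B z(2) _ ij(2)])
  also have "\<dots> = w * (\<Sum>l<n. ?G i l * ?H l j) + (\<Sum>l<n. if l = j then ?G i l else 0)"
    unfolding sum_distrib_left sum.distrib[symmetric] by (intro sum.cong) (auto simp: algebra_simps)
  also have "(\<Sum>l<n. if l = j then ?G i l else 0) = ?G i j"
    using ij by (subst sum.delta) auto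
  finally have 2: "(\<Sum>k<n. \<Sum>l<n. ?G i k * B k l * ?H l j) = w * (\<Sum>l<n. ?G i l * ?H l j) + ?G i j"
    by (simp add: sum_distrib_left mult.assoc)
  have "(\<Sum>k<n. \<Sum>l<n. ?G i k * (B k l - A k l) * ?H l j) =
      (\<Sum>k<n. \<Sum>l<n. ?G i k * B k l * ?H l j) - (\<Sum>k<n. \<Sum>l<n. ?G i k * A k l * ?H l j)"
    by (simp add: algebra_simps sum_subtractf)
  then show ?thesis unfolding 1 2 by (simp add: algebra_simps)
qed

text \<open>Two candidates for a column differ by a solution of the shifted equation with
  \<open>u = 0\<close>. This recognises an explicit formula as a resolvent: for the transpose, and
  later for the block circulant.\<close>

lemma resolvent_unique:
  assumes A: "hermitian_on n A" and z: "Im z \<noteq> 0"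
    and R: "\<And>i j. i < n \<Longrightarrow> j < n \<Longrightarrow> (\<Sum>k<n. A i k * R k j) = z * R i j + (if i = j then 1 else 0)"
    and ij: "i < n" "j < n"
  shows "resolvent n A z i j = R i j"
proof -
  let ?G = "resolvent n A z"
  have "(\<Sum>j'<n. A k j' * (?G j' j - R j' j)) = z * (?G k j - R k j) + 0" if "k < n" for k
    using resolvent_right[OF A z that ij(2)] R[OF that ij(2)]
    by (simp add: algebra_simps sum_subtractf)
  from hermitian_shifted_solution[OF A, of "\<lambda>i. ?G i j - R i j", OF this] z
  have "(\<Sum>i<n. (cmod (?G i j - R i j))\<^sup>2) = 0" by simp
  then have "\<forall>i<n. ?G i j - R i j = 0" by (subst (asm) sum_nonneg_eq_0_iff) auto
  with ij show ?thesis by auto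
qed

text \<open>Column \<open>j\<close> solves the shifted equation whose right-hand side is the
  \<open>j\<close>-th unit vector. A whole column of squares is thereby controlled by a single
  diagonal entry.\<close>

lemma ward_identity_col:
  assumes A: "hermitian_on n A" and z: "Im z \<noteq> 0" and j: "j < n"
  shows "Im z * (\<Sum>i<n. (cmod (resolvent n A z i j))\<^sup>2) = Im (resolvent n A z j j)"
proof -
  have "Im z * (\<Sum>i<n. (cmod (resolvent n A z i j))\<^sup>2) =
      Im (\<Sum>i<n. cnj (if i = j then 1 else 0) * resolvent n A z i j)"
    by (rule hermitian_shifted_solution[OF A]) (rule resolvent_right[OF A z _ j])
  also have "(\<Sum>i<n. cnj (if i = j then 1 else 0) * resolvent n A z i j) =
      (\<Sum>i<n. if i = j then resolvent n A z i j else 0)"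
    by (intro sum.cong) auto
  also have "\<dots> = resolvent n A z j j" using j by (subst sum.delta) auto
  finally show ?thesis .
qed

lemma hermitian_on_transpose: "hermitian_on n A \<Longrightarrow> hermitian_on n (\<lambda>i j. A j i)"
  unfolding hermitian_on_def by blast

lemma resolvent_transpose:
  assumes A: "hermitian_on n A" and z: "Im z \<noteq> 0" and ij: "i < n" "j < n"
  shows "resolvent n (\<lambda>i j. A j i) z i j = resolvent n A z j i"
proof (rule resolvent_unique[OF hermitian_on_transpose[OF A] z _ ij, where R = "\<lambda>i j. resolvent n A z j i"])
  fix i j assume ij: "i < n" "j < n"
  have "(\<Sum>k<n. A k i * resolvent n A z j k) = (\<Sum>k<n. resolvent n A z j k * A k i)"
    by (intro sum.cong refl mult.commute)
  also have "\<dots> = z * resolvent n A z j i + (if j = i then 1 else 0)"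
    by (rule resolvent_left[OF A z ij(2,1)])
  finally show "(\<Sum>k<n. A k i * resolvent n A z j k) = z * resolvent n A z j i + (if i = j then 1 else 0)"
    by (cases "i = j") simp_all
qed

lemma resolvent_Im_diag_pos:
  assumes A: "hermitian_on n A" and z: "Im z > 0" and j: "j < n"
  shows "Im (resolvent n A z j j) > 0"
proof -
  have "(\<Sum>i<n. (cmod (resolvent n A z i j))\<^sup>2) \<noteq> 0"
  proof
    assume "(\<Sum>i<n. (cmod (resolvent n A z i j))\<^sup>2) = 0"
    then have "\<forall>i<n. resolvent n A z i j = 0" by (subst (asm) sum_nonneg_eq_0_iff) auto
    then show False using resolvent_right[OF A _ j j, of z] z j by auto
  qed
  moreover have "(\<Sum>i<n. (cmod (resolvent n A z i j))\<^sup>2) \<ge> 0" by (intro sum_nonneg) auto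
  ultimately show ?thesis using ward_identity_col[OF A _ j, of z] z
    by (metis less_eq_real_def less_irrefl mult_pos_pos)
qed

text \<open>The Ward identity gives \<open>Im z * |G j j|^2 \<le> |G j j|\<close>, which bounds the
  diagonal; inserting that bound once more controls the rest of the column.\<close>

lemma cmod_resolvent_le:
  assumes A: "hermitian_on n A" and z: "Im z > 0" and ij: "i < n" "j < n"
  shows "cmod (resolvent n A z i j) \<le> 1 / Im z"
proof -
  let ?G = "resolvent n A z"
  have *: "Im z * (cmod (?G i j))\<^sup>2 \<le> cmod (?G j j)" if "i < n" for i
  proof -
    have "(cmod (?G i j))\<^sup>2 \<le> (\<Sum>i<n. (cmod (?G i j))\<^sup>2)"
      using that by (intro member_le_sum) auto
    then have "Im z * (cmod (?G i j))\<^sup>2 \<le> Im (?G j j)"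
      unfolding ward_identity_col[OF A less_imp_neq[OF z, symmetric] ij(2), symmetric]
      using z by (intro mult_left_mono) auto
    also have "\<dots> \<le> cmod (?G j j)" using abs_Im_le_cmod[of "?G j j"] by linarith
    finally show ?thesis .
  qed
  have jj: "cmod (?G j j) \<le> 1 / Im z"
  proof (cases "?G j j = 0")
    case False
    then have "cmod (?G j j) > 0" by simp
    with *[OF ij(2)] have "Im z * cmod (?G j j) \<le> 1"
      by (simp add: power2_eq_square)
    with z show ?thesis by (simp add: field_simps)
  qed (use z in auto)
  have "Im z * (cmod (?G i j))\<^sup>2 \<le> 1 / Im z" using *[OF ij(1)] jj by linarith
  then have "(cmod (?G i j))\<^sup>2 \<le> (1 / Im z)\<^sup>2"
    using z by (simp add: field_simps power2_eq_square)
  then show ?thesis by (rule power2_le_imp_le) (use z in simp)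
qed

lemma sum_resolvent_col_le:
  assumes A: "hermitian_on n A" and z: "Im z > 0" and j: "j < n"
  shows "(\<Sum>i<n. (cmod (resolvent n A z i j))\<^sup>2) \<le> 1 / (Im z)\<^sup>2"
proof -
  have "Im z * (\<Sum>i<n. (cmod (resolvent n A z i j))\<^sup>2) \<le> 1 / Im z"
    unfolding ward_identity_col[OF A less_imp_neq[OF z, symmetric] j]
    using cmod_resolvent_le[OF A z j j] abs_Im_le_cmod[of "resolvent n A z j j"] by linarith
  then show ?thesis using z by (simp add: field_simps power2_eq_square)
qed

lemma sum_resolvent_row_le:
  assumes A: "hermitian_on n A" and z: "Im z > 0" and i: "i < n"
  shows "(\<Sum>j<n. (cmod (resolvent n A z i j))\<^sup>2) \<le> 1 / (Im z)\<^sup>2"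
proof -
  have "(\<Sum>j<n. (cmod (resolvent n A z i j))\<^sup>2) = (\<Sum>j<n. (cmod (resolvent n (\<lambda>i j. A j i) z j i))\<^sup>2)"
    using z i by (intro sum.cong refl) (simp add: resolvent_transpose[OF A])
  then show ?thesis using sum_resolvent_col_le[OF hermitian_on_transpose[OF A] z i] by simp
qed

lemma cmod_sum_mult_le:
  fixes f g :: "nat \<Rightarrow> complex"
  shows "cmod (\<Sum>i<n. f i * g i) \<le> sqrt (\<Sum>i<n. (cmod (f i))\<^sup>2) * sqrt (\<Sum>i<n. (cmod (g i))\<^sup>2)"
proof -
  have "cmod (\<Sum>i<n. f i * g i) \<le> (\<Sum>i<n. \<bar>cmod (f i)\<bar> * \<bar>cmod (g i)\<bar>)"
    by (rule order_trans[OF norm_sum]) (simp add: norm_mult)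
  also have "\<dots> \<le> L2_set (\<lambda>i. cmod (f i)) {..<n} * L2_set (\<lambda>i. cmod (g i)) {..<n}"
    by (rule L2_set_mult_ineq)
  finally show ?thesis by (simp add: L2_set_def)
qed

lemma cmod_sum_mult_le':
  fixes f g :: "nat \<Rightarrow> complex"
  assumes "(\<Sum>i<n. (cmod (f i))\<^sup>2) \<le> c" "(\<Sum>i<n. (cmod (g i))\<^sup>2) \<le> c"
  shows "cmod (\<Sum>i<n. f i * g i) \<le> c"
proof -
  have c: "0 \<le> c" using assms(1) by (rule order_trans[rotated]) (intro sum_nonneg, auto)
  have "cmod (\<Sum>i<n. f i * g i) \<le> sqrt c * sqrt c"
    by (rule order_trans[OF cmod_sum_mult_le]) (intro mult_mono real_sqrt_le_mono assms, auto simp: c sum_nonneg)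
  with c show ?thesis by simp
qed

definition stieltjes :: "nat \<Rightarrow> (nat \<Rightarrow> nat \<Rightarrow> complex) \<Rightarrow> complex \<Rightarrow> complex" where
  "stieltjes n A z = (\<Sum>i<n. resolvent n A z i i) / of_nat n"

lemma cmod_stieltjes_le:
  assumes A: "hermitian_on n A" and z: "Im z > 0"
  shows "cmod (stieltjes n A z) \<le> 1 / Im z"
proof -
  have "cmod (\<Sum>i<n. resolvent n A z i i) \<le> (\<Sum>i<n. 1 / Im z)"
    by (rule order_trans[OF norm_sum]) (intro sum_mono cmod_resolvent_le A z, auto)
  then show ?thesis using z by (cases "n = 0") (auto simp: stieltjes_def norm_divide field_simps)
qed

lemma Im_stieltjes_pos:
  assumes A: "hermitian_on n A" and z: "Im z > 0" and n: "n > 0"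
  shows "Im (stieltjes n A z) > 0"
proof -
  have "(\<Sum>i<n. Im (resolvent n A z i i)) > 0"
    using n by (intro sum_pos resolvent_Im_diag_pos[OF A z]) auto
  then show ?thesis using n by (simp add: stieltjes_def)
qed

text \<open>The resolvent identity with equal matrices leaves \<open>(z - w)\<close> times a product
  of a row and a column, to which Cauchy-Schwarz and the Ward bounds apply. The constant does not
  depend on \<open>n\<close>, which allows passing from rational points to the half plane.\<close>

lemma stieltjes_lipschitz:
  assumes A: "hermitian_on n A" and z: "Im z \<ge> e" "Im w \<ge> e" "e > 0"
  shows "cmod (stieltjes n A z - stieltjes n A w) \<le> cmod (z - w) / e\<^sup>2"
proof (cases "n = 0")
  case False
  have *: "cmod (resolvent n A z i i - resolvent n A w i i) \<le> cmod (z - w) / e\<^sup>2" if i: "i < n" for i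
  proof -
    have "resolvent n A z i i - resolvent n A w i i = (z - w) * (\<Sum>k<n. resolvent n A z i k * resolvent n A w k i)"
      using resolvent_identity[OF A A _ _ i i, of z w] z by simp
    moreover have "cmod (\<Sum>k<n. resolvent n A z i k * resolvent n A w k i) \<le> 1 / e\<^sup>2"
      using z i
      by (intro cmod_sum_mult_le' order_trans[OF sum_resolvent_row_le[OF A]]
        order_trans[OF sum_resolvent_col_le[OF A]]) (auto intro!: divide_left_mono power_mono mult_pos_pos)
    ultimately show ?thesis
      using mult_left_mono[of _ "1 / e\<^sup>2" "cmod (z - w)"] by (simp add: norm_mult)
  qed
  have "cmod (\<Sum>i<n. resolvent n A z i i - resolvent n A w i i) \<le> (\<Sum>i<n. cmod (z - w) / e\<^sup>2)"
    by (rule order_trans[OF norm_sum]) (intro sum_mono *, auto)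
  then show ?thesis using False
    by (simp add: stieltjes_def norm_divide diff_divide_distrib[symmetric] sum_subtractf field_simps)
qed (use z in \<open>simp add: stieltjes_def\<close>)

text \<open>By Sherman--Morrison the difference of the traces is \<open>- t \<beta> / (1 + t \<alpha>)\<close> with
  \<open>\<alpha> = \<langle>u, G u\<rangle>\<close> and \<open>\<bar>\<beta>\<bar> \<le> Im \<alpha> / Im z\<close>, which is bounded independently of \<open>t\<close> and \<open>u\<close>.\<close>

lemma trace_resolvent_rank_one:
  fixes t :: real and u :: "nat \<Rightarrow> complex"
  assumes A: "hermitian_on n A" and z: "Im z > 0"
    and B: "\<And>i j. i < n \<Longrightarrow> j < n \<Longrightarrow> B i j = A i j + of_real t * u i * cnj (u j)"
  shows "cmod ((\<Sum>i<n. resolvent n B z i i) - (\<Sum>i<n. resolvent n A z i i)) \<le> 1 / Im z"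
proof -
  let ?G = "resolvent n A z" and ?H = "resolvent n B z"
  have z0: "Im z \<noteq> 0" using z by simp
  have hB: "hermitian_on n B"
    unfolding hermitian_on_def
  proof (intro allI impI)
    fix i j assume "i < n" "j < n"
    then show "B j i = cnj (B i j)"
      using hermitian_onD[OF A, of i j] by (simp add: B mult_ac)
  qed
  \<comment> \<open>\<open>g = G u\<close>, \<open>h\<close> is the row vector \<open>u^* G\<close>,
    and \<open>f = H u\<close>; in this notation \<open>H - G\<close> is the rank one matrix
    \<open>- t f h\<close>.\<close>
  define g where "g = (\<lambda>i. \<Sum>j<n. ?G i j * u j)"
  define h where "h = (\<lambda>j. \<Sum>i<n. cnj (u i) * ?G i j)"
  define f where "f = (\<lambda>i. \<Sum>j<n. ?H i j * u j)"
  define \<alpha> where "\<alpha> = (\<Sum>i<n. cnj (u i) * g i)"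
  have Ag: "(\<Sum>j<n. A i j * g j) = z * g i + u i" if i: "i < n" for i
  proof -
    have "(\<Sum>j<n. A i j * g j) = (\<Sum>k<n. (\<Sum>j<n. A i j * ?G j k) * u k)"
      unfolding g_def sum_distrib_left sum_distrib_right by (subst sum.swap) (simp add: mult.assoc)
    also have "\<dots> = (\<Sum>k<n. (z * ?G i k + (if i = k then 1 else 0)) * u k)"
      by (intro sum.cong refl) (simp only: resolvent_right[OF A z0 i] lessThan_iff)
    also have "\<dots> = z * g i + (\<Sum>k<n. if i = k then u k else 0)"
      unfolding g_def sum_distrib_left sum.distrib[symmetric]
      by (intro sum.cong) (auto simp: algebra_simps)
    finally show ?thesis using i by simp
  qed
  have Ah: "(\<Sum>j<n. A j i * h j) = z * h i + cnj (u i)" if i: "i < n" for i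
  proof -
    have "(\<Sum>j<n. A j i * h j) = (\<Sum>k<n. cnj (u k) * (\<Sum>j<n. ?G k j * A j i))"
      unfolding h_def sum_distrib_left by (subst sum.swap) (simp add: mult_ac)
    also have "\<dots> = (\<Sum>k<n. cnj (u k) * (z * ?G k i + (if k = i then 1 else 0)))"
      by (intro sum.cong refl) (simp only: resolvent_left[OF A z0 _ i] lessThan_iff)
    also have "\<dots> = z * h i + (\<Sum>k<n. if k = i then cnj (u k) else 0)"
      unfolding h_def sum_distrib_left sum.distrib[symmetric]
      by (intro sum.cong) (auto simp: algebra_simps)
    finally show ?thesis using i by simp
  qed
  have \<alpha>_h: "\<alpha> = (\<Sum>j<n. h j * u j)"
    unfolding \<alpha>_def g_def h_def sum_distrib_left sum_distrib_right
    by (subst sum.swap) (simp add: mult.assoc)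
  have ng: "(\<Sum>i<n. (cmod (g i))\<^sup>2) = Im \<alpha> / Im z"
    using hermitian_shifted_solution[OF A Ag] z by (simp add: \<alpha>_def field_simps)
  have nh: "(\<Sum>i<n. (cmod (h i))\<^sup>2) = Im \<alpha> / Im z"
    using hermitian_shifted_solution[OF hermitian_on_transpose[OF A], of h z "\<lambda>i. cnj (u i)", OF Ah] z
    by (simp add: \<alpha>_h field_simps del: Im_sum)
  have diff: "?H i j - ?G i j = - of_real t * f i * h j" if "i < n" "j < n" for i j
  proof -
    have "?H i j - ?G i j = (\<Sum>k<n. \<Sum>l<n. ?H i k * (A k l - B k l) * ?G l j)"
      using resolvent_identity[OF hB A z0 z0 that] by simp
    also have "\<dots> = (\<Sum>k<n. \<Sum>l<n. - of_real t * (?H i k * u k) * (cnj (u l) * ?G l j))"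
      by (intro sum.cong refl) (auto simp: B algebra_simps)
    also have "\<dots> = - of_real t * f i * h j"
      unfolding f_def h_def sum_distrib_left sum_distrib_right by (subst sum.swap) (simp add: mult_ac)
    finally show ?thesis .
  qed
  have fg: "f i * (1 + of_real t * \<alpha>) = g i" if i: "i < n" for i
  proof -
    have "f i - g i = (\<Sum>j<n. (?H i j - ?G i j) * u j)"
      by (simp add: f_def g_def algebra_simps sum_subtractf)
    also have "\<dots> = - of_real t * f i * \<alpha>"
      unfolding \<alpha>_h sum_distrib_left by (intro sum.cong refl) (simp add: diff i)
    finally show ?thesis by (simp add: algebra_simps)
  qed
  define T where "T = (\<Sum>i<n. ?H i i) - (\<Sum>i<n. ?G i i)"
  have T: "T = - of_real t * (\<Sum>i<n. f i * h i)"
    unfolding T_def sum_subtractf[symmetric] sum_distrib_left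
    by (intro sum.cong refl) (simp add: diff)
  have T': "T * (1 + of_real t * \<alpha>) = - of_real t * (\<Sum>i<n. g i * h i)"
  proof -
    have "(\<Sum>i<n. f i * h i) * (1 + of_real t * \<alpha>) = (\<Sum>i<n. g i * h i)"
      unfolding sum_distrib_right
      by (intro sum.cong refl) (simp add: fg[symmetric] mult_ac)
    then show ?thesis unfolding T by (simp add: mult.assoc)
  qed
  have "Im \<alpha> / Im z \<ge> 0" unfolding ng[symmetric] by (intro sum_nonneg) auto
  then have \<alpha>0: "Im \<alpha> \<ge> 0" using z by (simp add: zero_le_divide_iff)
  have "cmod T \<le> 1 / Im z"
  \<comment> \<open>Here the imaginary part of the denominator gives no lower bound, but then
    \<open>t = 0\<close> or \<open>h = 0\<close>, and the traces agree.\<close>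
  proof (cases "\<bar>t\<bar> * Im \<alpha> = 0")
    case True
    have "T = 0"
    proof (cases "t = 0")
      case False
      then have "(\<Sum>i<n. (cmod (h i))\<^sup>2) = 0" using True nh by simp
      then have "\<forall>i<n. h i = 0" by (subst (asm) sum_nonneg_eq_0_iff) auto
      then show ?thesis unfolding T by simp
    qed (use T in simp)
    then show ?thesis using z by simp
  next
    case False
    then have pos: "\<bar>t\<bar> * Im \<alpha> > 0" using \<alpha>0 by (simp add: less_eq_real_def)
    have "\<bar>t\<bar> * Im \<alpha> \<le> cmod (1 + of_real t * \<alpha>)"
      using abs_Im_le_cmod[of "1 + of_real t * \<alpha>"] \<alpha>0 by (simp add: abs_mult)
    then have "cmod T * (\<bar>t\<bar> * Im \<alpha>) \<le> cmod (T * (1 + of_real t * \<alpha>))"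
      unfolding norm_mult by (intro mult_left_mono) auto
    also have "\<dots> = \<bar>t\<bar> * cmod (\<Sum>i<n. g i * h i)" unfolding T' by (simp add: norm_mult)
    also have "\<dots> \<le> \<bar>t\<bar> * (Im \<alpha> / Im z)"
      by (intro mult_left_mono cmod_sum_mult_le') (auto simp: ng nh)
    finally have "cmod T * (\<bar>t\<bar> * Im \<alpha>) \<le> 1 / Im z * (\<bar>t\<bar> * Im \<alpha>)" by simp
    then show ?thesis using pos by (rule mult_right_le_imp_le)
  qed
  then show ?thesis unfolding T_def .
qed

text \<open>The difference \<open>e w\<^sup>* + w e\<^sup>*\<close> of the two matrices is
  \<open>((e + w) (e + w)\<^sup>* - (e - w) (e - w)\<^sup>*) / 2\<close>, i.e. two rank one perturbations.\<close>

lemma trace_resolvent_row_change: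
  assumes A: "hermitian_on n A" and B: "hermitian_on n B" and z: "Im z > 0" and m: "m < n"
    and eq: "\<And>i j. i < n \<Longrightarrow> j < n \<Longrightarrow> i \<noteq> m \<Longrightarrow> j \<noteq> m \<Longrightarrow> A i j = B i j"
  shows "cmod ((\<Sum>i<n. resolvent n A z i i) - (\<Sum>i<n. resolvent n B z i i)) \<le> 2 / Im z"
proof -
  \<comment> \<open>Position \<open>(m, m)\<close> is reached by both \<open>e w^*\<close> and
    \<open>w e^*\<close>, so \<open>w\<close> carries half of the diagonal difference there.\<close>
  define w where "w = (\<lambda>j. if j = m then (B m m - A m m) / 2 else cnj (B m j - A m j))"
  define e where "e = (\<lambda>j. if j = m then 1 else 0 :: complex)"
  define C where "C = (\<lambda>i j. A i j + of_real (1/2) * (e i + w i) * cnj (e j + w j))"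
  have real: "cnj (A m m) = A m m" "cnj (B m m) = B m m"
    using hermitian_onD[OF A m m] hermitian_onD[OF B m m] by auto
  have C: "hermitian_on n C"
    unfolding hermitian_on_def C_def
  proof (intro allI impI)
    fix i j assume "i < n" "j < n"
    then show "A j i + of_real (1/2) * (e j + w j) * cnj (e i + w i) =
        cnj (A i j + of_real (1/2) * (e i + w i) * cnj (e j + w j))"
      using hermitian_onD[OF A, of i j] by (simp add: mult_ac)
  qed
  have "B i j = C i j + of_real (-1/2) * (e i - w i) * cnj (e j - w j)" if ij: "i < n" "j < n" for i j
  proof -
    have "C i j + of_real (-1/2) * (e i - w i) * cnj (e j - w j) = A i j + (e i * cnj (w j) + w i * cnj (e j))"
      unfolding C_def by (simp add: field_simps)
    also have "\<dots> = B i j"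
    proof (cases "i = m")
      case True
      then show ?thesis using real by (cases "j = m") (auto simp: e_def w_def algebra_simps)
    next
      case i: False
      show ?thesis
      proof (cases "j = m")
        case True
        then show ?thesis using i hermitian_onD[OF A m ij(1)] hermitian_onD[OF B m ij(1)]
          by (auto simp: e_def w_def)
      next
        case False
        then show ?thesis using i eq ij by (auto simp: e_def w_def)
      qed
    qed
    finally show ?thesis by simp
  qed
  then have "cmod ((\<Sum>i<n. resolvent n B z i i) - (\<Sum>i<n. resolvent n C z i i)) \<le> 1 / Im z"
    by (intro trace_resolvent_rank_one[OF C z])
  moreover have "cmod ((\<Sum>i<n. resolvent n C z i i) - (\<Sum>i<n. resolvent n A z i i)) \<le> 1 / Im z"
    by (rule trace_resolvent_rank_one[OF A z, where t = "1/2" and u = "\<lambda>i. e i + w i"]) (simp add: C_def)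
  ultimately show ?thesis
    using norm_triangle_ineq[of "(\<Sum>i<n. resolvent n A z i i) - (\<Sum>i<n. resolvent n C z i i)"
        "(\<Sum>i<n. resolvent n C z i i) - (\<Sum>i<n. resolvent n B z i i)"]
    by (simp add: norm_minus_commute)
qed

text \<open>Two bounds are combined: \<open>1 / Im z\<close> from the rank one perturbation,
  whatever \<open>d\<close> is, and \<open>\<bar>d\<bar> / (Im z)^2\<close> from the resolvent
  identity. The factor \<open>min 1 \<bar>d\<bar>\<close> is bounded, so its mean exists for any
  diagonal distribution.\<close>

lemma trace_resolvent_diagonal_change:
  fixes d :: real
  assumes A: "hermitian_on n A" and z: "Im z > 0" and m: "m < n"
    and B: "\<And>i j. i < n \<Longrightarrow> j < n \<Longrightarrow> B i j = A i j + (if i = m \<and> j = m then of_real d else 0)"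
  shows "cmod ((\<Sum>i<n. resolvent n B z i i) - (\<Sum>i<n. resolvent n A z i i))
    \<le> (1 / Im z + 1 / (Im z)\<^sup>2) * min 1 \<bar>d\<bar>"
proof -
  let ?G = "resolvent n A z" and ?H = "resolvent n B z"
  let ?T = "(\<Sum>i<n. ?H i i) - (\<Sum>i<n. ?G i i)"
  have z0: "Im z \<noteq> 0" using z by simp
  have hB: "hermitian_on n B"
    unfolding hermitian_on_def
  proof (intro allI impI)
    fix i j assume "i < n" "j < n"
    then show "B j i = cnj (B i j)"
      using hermitian_onD[OF A, of i j] by (simp add: B)
  qed
  have b1: "cmod ?T \<le> 1 / Im z"
    by (rule trace_resolvent_rank_one[OF A z, where t = d and u = "\<lambda>i. if i = m then 1 else 0"])
       (auto simp: B)
  have b2: "cmod ?T \<le> \<bar>d\<bar> * (1 / (Im z)\<^sup>2)"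
  proof -
    have diff: "?H i i - ?G i i = - of_real d * (?G m i * ?H i m)" if i: "i < n" for i
    proof -
      have "?H i i - ?G i i = (\<Sum>k<n. \<Sum>l<n. ?H i k * (A k l - B k l) * ?G l i)"
        using resolvent_identity[OF hB A z0 z0 i i] by simp
      also have "\<dots> = (\<Sum>k<n. \<Sum>l<n. if l = m then (if k = m then - of_real d * (?G m i * ?H i m) else 0) else 0)"
        by (intro sum.cong refl) (auto simp: B)
      also have "\<dots> = - of_real d * (?G m i * ?H i m)"
        using m by simp
      finally show ?thesis .
    qed
    have "?T = - of_real d * (\<Sum>i<n. ?G m i * ?H i m)"
      unfolding sum_subtractf[symmetric] sum_distrib_left by (intro sum.cong refl) (simp add: diff)
    moreover have "cmod (\<Sum>i<n. ?G m i * ?H i m) \<le> 1 / (Im z)\<^sup>2"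
      using m by (intro cmod_sum_mult_le' sum_resolvent_row_le[OF A z] sum_resolvent_col_le[OF hB z])
    ultimately show ?thesis
      using mult_left_mono[of _ "1 / (Im z)\<^sup>2" "\<bar>d\<bar>"] by (simp add: norm_mult)
  qed
  have pos: "0 \<le> 1 / Im z" "0 \<le> 1 / (Im z)\<^sup>2" using z by auto
  show ?thesis
  proof (cases "\<bar>d\<bar> \<le> 1")
    case True
    have "cmod ?T \<le> 1 / (Im z)\<^sup>2 * \<bar>d\<bar>" using b2 by (simp add: mult.commute)
    also have "\<dots> \<le> (1 / Im z + 1 / (Im z)\<^sup>2) * \<bar>d\<bar>" using pos by (intro mult_right_mono) auto
    finally show ?thesis using True by simp
  next
    case False
    have "cmod ?T \<le> 1 / Im z + 1 / (Im z)\<^sup>2" using b1 pos by linarith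
    with False show ?thesis by simp
  qed
qed

section \<open>Changing one off-diagonal entry and its conjugate\<close>

context
  fixes n a b :: nat and A B :: "nat \<Rightarrow> nat \<Rightarrow> complex" and z h :: complex
  assumes A: "hermitian_on n A" and B: "hermitian_on n B" and z: "Im z > 0"
    and ab: "a < n" "b < n" "a \<noteq> b"
    and AB: "\<And>i j. i < n \<Longrightarrow> j < n \<Longrightarrow>
      A i j = B i j + (if i = a \<and> j = b then h else if i = b \<and> j = a then cnj h else 0)"
begin

text \<open>The difference matrix lives on two positions, so the double sum of the resolvent
  identity collapses. Only the right factor involves \<open>A\<close>; substituting the identity
  into itself replaces that factor by the resolvent of \<open>B\<close>.\<close>

lemma resolvent_entry_change:
  assumes ij: "i < n" "j < n"
  shows "resolvent n A z i j - resolvent n B z i j =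
    - (resolvent n B z i a * h * resolvent n A z b j + resolvent n B z i b * cnj h * resolvent n A z a j)"
proof -
  let ?G = "resolvent n A z" and ?H = "resolvent n B z"
  have z0: "Im z \<noteq> 0" using z by simp
  have "?H i j - ?G i j = (\<Sum>k<n. \<Sum>l<n. ?H i k * (A k l - B k l) * ?G l j)"
    using resolvent_identity[OF B A z0 z0 ij] by simp
  also have "\<dots> = (\<Sum>k<n. \<Sum>l<n. (if l = b then if k = a then ?H i a * h * ?G b j else 0 else 0)
      + (if l = a then if k = b then ?H i b * cnj h * ?G a j else 0 else 0))"
    using ab by (intro sum.cong refl) (auto simp: AB)
  also have "\<dots> = ?H i a * h * ?G b j + ?H i b * cnj h * ?G a j"
    using ab by (simp add: sum.distrib)
  finally show ?thesis by (simp add: algebra_simps)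
qed

text \<open>The minimum of two bounds: \<open>2 / Im z\<close> because both resolvents are bounded,
  and \<open>2 / (Im z)^2\<close> times \<open>cmod h\<close> from the two terms of the
  expansion.\<close>

lemma cmod_resolvent_entry_change:
  assumes ij: "i < n" "j < n"
  shows "cmod (resolvent n A z i j - resolvent n B z i j) \<le> (2 / Im z + 2 / (Im z)\<^sup>2) * min 1 (cmod h)"
proof -
  let ?G = "resolvent n A z" and ?H = "resolvent n B z"
  have 1: "cmod (?G i j - ?H i j) \<le> 2 / Im z"
    using norm_triangle_ineq4[of "?G i j" "?H i j"] cmod_resolvent_le[OF A z ij] cmod_resolvent_le[OF B z ij]
    by simp
  have "cmod (?H i a * h * ?G b j) \<le> (1 / Im z) * cmod h * (1 / Im z)"
    unfolding norm_mult using z ab ij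
    by (intro mult_mono cmod_resolvent_le[OF A z] cmod_resolvent_le[OF B z]) auto
  moreover have "cmod (?H i b * cnj h * ?G a j) \<le> (1 / Im z) * cmod h * (1 / Im z)"
    unfolding norm_mult complex_mod_cnj using z ab ij
    by (intro mult_mono cmod_resolvent_le[OF A z] cmod_resolvent_le[OF B z]) auto
  ultimately have "cmod (?G i j - ?H i j) \<le> 2 * ((1 / Im z) * cmod h * (1 / Im z))"
    unfolding resolvent_entry_change[OF ij] norm_minus_cancel
    by (intro order_trans[OF norm_triangle_ineq]) simp
  then have 2: "cmod (?G i j - ?H i j) \<le> 2 / (Im z)\<^sup>2 * cmod h"
    by (simp add: power2_eq_square)
  have pos: "0 \<le> 2 / Im z" "0 \<le> 2 / (Im z)\<^sup>2" using z by auto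
  show ?thesis
  proof (cases "cmod h \<le> 1")
    case True
    have "2 / (Im z)\<^sup>2 * cmod h \<le> (2 / Im z + 2 / (Im z)\<^sup>2) * cmod h"
      using pos by (intro mult_right_mono) auto
    with 2 True show ?thesis by simp
  next
    case False
    have "cmod (?G i j - ?H i j) \<le> 2 / Im z + 2 / (Im z)\<^sup>2" using 1 pos by linarith
    with False show ?thesis by simp
  qed
qed

text \<open>One application of the entry identity yields products of an entry of \<open>B\<close>'s
  resolvent with one of \<open>A\<close>'s. Replacing the latter by \<open>B\<close>'s costs a
  further difference, which supplies \<open>min 1 (cmod h)\<close>. There are four such remainders,
  each at most \<open>1 / Im z * C * ((cmod h)^2 * min 1 (cmod h))\<close>.\<close>

lemma resolvent_second_order:
  fixes C :: real
  defines "C \<equiv> 2 / Im z + 2 / (Im z)\<^sup>2"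
  shows "cmod ((h * resolvent n A z b a + cnj h * resolvent n A z a b)
      - (h * resolvent n B z b a + cnj h * resolvent n B z a b)
      + (h\<^sup>2 * (resolvent n B z b a)\<^sup>2 + (cnj h)\<^sup>2 * (resolvent n B z a b)\<^sup>2
          + 2 * (of_real ((cmod h)\<^sup>2) * (resolvent n B z a a * resolvent n B z b b))))
    \<le> 4 / Im z * C * ((cmod h)\<^sup>2 * min 1 (cmod h))" (is "cmod ?L \<le> _")
proof -
  let ?G = "resolvent n A z" and ?H = "resolvent n B z"
  have hh: "of_real ((cmod h)\<^sup>2) = h * cnj h" by (rule complex_norm_square)
  have e1: "h * (?G b a - ?H b a) = - (h * ?H b a * h * ?G b a + h * ?H b b * cnj h * ?G a a)"
    unfolding resolvent_entry_change[OF ab(2,1)] by (simp add: algebra_simps)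
  have e2: "cnj h * (?G a b - ?H a b) = - (cnj h * ?H a a * h * ?G b b + cnj h * ?H a b * cnj h * ?G a b)"
    unfolding resolvent_entry_change[OF ab(1,2)] by (simp add: algebra_simps)
  have "?L = h * (?G b a - ?H b a) + cnj h * (?G a b - ?H a b)
      + (h\<^sup>2 * (?H b a)\<^sup>2 + (cnj h)\<^sup>2 * (?H a b)\<^sup>2 + 2 * (h * cnj h * (?H a a * ?H b b)))"
    unfolding hh by (simp add: algebra_simps)
  also have "\<dots> = - (h * ?H b a * h * (?G b a - ?H b a) + h * ?H b b * cnj h * (?G a a - ?H a a)
      + (cnj h * ?H a a * h * (?G b b - ?H b b) + cnj h * ?H a b * cnj h * (?G a b - ?H a b)))"
    unfolding e1 e2 by (simp add: algebra_simps power2_eq_square)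
  finally have L: "?L = \<dots>" .
  have C0: "0 \<le> C" using z by (simp add: C_def)
  have *: "cmod (x * ?H i j * y * (?G k l - ?H k l)) \<le> 1 / Im z * C * ((cmod h)\<^sup>2 * min 1 (cmod h))"
    if "i < n" "j < n" "k < n" "l < n" "cmod x = cmod h" "cmod y = cmod h" for i j k l x y
  proof -
    have "cmod (x * ?H i j * y * (?G k l - ?H k l)) \<le> cmod h * (1 / Im z) * cmod h * (C * min 1 (cmod h))"
      unfolding norm_mult that(5,6) C_def using z that(1-4)
      by (intro mult_mono cmod_resolvent_le[OF B z] cmod_resolvent_entry_change) auto
    then show ?thesis by (simp add: power2_eq_square mult_ac)
  qed
  have "cmod ?L \<le> (1 / Im z * C * ((cmod h)\<^sup>2 * min 1 (cmod h)) + 1 / Im z * C * ((cmod h)\<^sup>2 * min 1 (cmod h)))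
      + (1 / Im z * C * ((cmod h)\<^sup>2 * min 1 (cmod h)) + 1 / Im z * C * ((cmod h)\<^sup>2 * min 1 (cmod h)))"
    unfolding L norm_minus_cancel
    using ab by (intro norm_triangle_mono *) auto
  then show ?thesis by (simp add: mult_ac)
qed

end

text \<open>The diagonal has full rank, so a rank bound alone gives nothing after division by
  \<open>n\<close>. Telescoping through the matrices with the first \<open>m\<close> diagonal
  entries set to zero keeps the small factor of every entry.\<close>

lemma stieltjes_diagonal_removal:
  assumes A: "hermitian_on n A" and z: "Im z > 0"
  shows "cmod (stieltjes n A z - stieltjes n (\<lambda>i j. if i = j then 0 else A i j) z)
    \<le> (1 / Im z + 1 / (Im z)\<^sup>2) * (\<Sum>i<n. min 1 (cmod (A i i))) / n"
proof -
  let ?D = "\<lambda>m i j. if i = j \<and> i < m then 0 else A i j"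
  let ?T = "\<lambda>B. \<Sum>i<n. resolvent n B z i i"
  have D: "hermitian_on n (?D m)" for m
    using A unfolding hermitian_on_def by (metis complex_cnj_zero)
  have "cmod (?T A - ?T (?D m)) \<le> (1 / Im z + 1 / (Im z)\<^sup>2) * (\<Sum>i<m. min 1 (cmod (A i i)))"
    if "m \<le> n" for m
    using that
  proof (induction m)
    case (Suc m)
    then have m: "m < n" by simp
    have "cnj (A m m) = A m m" using hermitian_onD[OF A m m] by simp
    then have real: "A m m = of_real (Re (A m m))"
      by (metis Reals_cnj_iff of_real_Re)
    have "cmod (?T (?D m) - ?T (?D (Suc m))) \<le> (1 / Im z + 1 / (Im z)\<^sup>2) * min 1 \<bar>Re (A m m)\<bar>"
      using real by (intro trace_resolvent_diagonal_change[OF D z m]) (auto simp: less_Suc_eq)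
    moreover have "\<bar>Re (A m m)\<bar> = cmod (A m m)"
      by (subst real) simp
    moreover have "cmod (?T A - ?T (?D (Suc m))) \<le> cmod (?T A - ?T (?D m)) + cmod (?T (?D m) - ?T (?D (Suc m)))"
      using norm_triangle_ineq[of "?T A - ?T (?D m)" "?T (?D m) - ?T (?D (Suc m))"] by simp
    ultimately have "cmod (?T A - ?T (?D (Suc m))) \<le>
      (1 / Im z + 1 / (Im z)\<^sup>2) * (\<Sum>i<m. min 1 (cmod (A i i))) + (1 / Im z + 1 / (Im z)\<^sup>2) * min 1 (cmod (A m m))"
      using Suc by simp
    then show ?case by (simp only: sum.lessThan_Suc distrib_left)
  qed simp
  from this[of n] have *: "cmod (?T A - ?T (?D n)) \<le> (1 / Im z + 1 / (Im z)\<^sup>2) * (\<Sum>i<n. min 1 (cmod (A i i)))" by simp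
  have "resolvent n (\<lambda>i j. if i = j then 0 else A i j) z = resolvent n (?D n) z"
    by (rule resolvent_cong) auto
  then show ?thesis using divide_right_mono[OF *, of "real n"]
    by (simp add: stieltjes_def norm_divide diff_divide_distrib[symmetric])
qed

section \<open>Eigenvalues\<close>

lemma logderiv_prod_mset_linear:
  fixes z :: complex
  assumes "z \<notin># R"
  shows "poly (pderiv (\<Prod>x\<in>#R. [:-x, 1:])) z = poly (\<Prod>x\<in>#R. [:-x, 1:]) z * (\<Sum>x\<in>#R. 1 / (z - x))"
  using assms
proof (induction R)
  case (add a R)
  then have "z - a \<noteq> 0" by auto
  then have alg: "(z - a) * (Q * S) + Q = (z - a) * Q * (1 / (z - a) + S)" for Q S
    by (simp add: field_simps)
  let ?q = "\<Prod>x\<in>#R. [:-x, 1:]"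
  have "poly (pderiv (\<Prod>x\<in>#add_mset a R. [:-x, 1:])) z = poly (pderiv ([:-a, 1:] * ?q)) z"
    by (simp only: image_mset_add_mset prod_mset.add_mset)
  also have "\<dots> = (z - a) * poly (pderiv ?q) z + poly ?q z"
    unfolding pderiv_mult by (simp add: pderiv_pCons del: mult_pCons_left)
  also have "poly (pderiv ?q) z = poly ?q z * (\<Sum>x\<in>#R. 1 / (z - x))"
    using add by auto
  also have "(z - a) * (poly ?q z * (\<Sum>x\<in>#R. 1 / (z - x))) + poly ?q z =
      (z - a) * poly ?q z * (1 / (z - a) + (\<Sum>x\<in>#R. 1 / (z - x)))"
    by (rule alg)
  also have "(z - a) * poly ?q z = poly (\<Prod>x\<in>#add_mset a R. [:-x, 1:]) z"
    by (simp add: algebra_simps)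
  finally show ?case by (simp only: image_mset_add_mset sum_mset.add_mset)
qed (simp add: pderiv_1)

text \<open>The sign reflects \<open>A - z\<close> against the \<open>z - A\<close> of the
  characteristic polynomial.\<close>

lemma poly_char_poly_shifted:
  assumes "C \<in> carrier_mat n n"
  shows "poly (char_poly C) z = (-1) ^ n * Determinant.det (shifted_mat n (\<lambda>i j. C $$ (i, j)) z)"
proof -
  have "poly (char_poly C) z = Determinant.det (- 1 \<cdot>\<^sub>m shifted_mat n (\<lambda>i j. C $$ (i, j)) z)"
    unfolding char_poly_def
    by (rule poly_det_cong[where n = n]) (use assms in \<open>auto simp: char_poly_matrix_def shifted_mat_def\<close>)
  also have "\<dots> = (-1) ^ n * Determinant.det (shifted_mat n (\<lambda>i j. C $$ (i, j)) z)"
    by (simp add: shifted_mat_def)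
  finally show ?thesis .
qed

lemma hermitian_char_poly_roots_real:
  assumes C: "C \<in> carrier_mat n n" "hermitian_on n (\<lambda>i j. C $$ (i, j))" and x: "x \<in># proots (char_poly C)"
  shows "Im x = 0"
proof (rule ccontr)
  assume "Im x \<noteq> 0"
  from det_shifted_mat_nonzero[OF C(2) this] have "poly (char_poly C) x \<noteq> 0"
    using poly_char_poly_shifted[OF C(1)] by simp
  with x show False by (cases "char_poly C = 0") auto
qed

text \<open>The derivative of the characteristic polynomial \<open>p\<close> is the sum of the
  characteristic polynomials of the principal minors, which are up to sign the diagonal of the
  adjugate. Hence the trace is \<open>- p' / p\<close>, and the logarithmic derivative of the
  factored \<open>p\<close> counts roots with multiplicity.\<close>

lemma trace_resolvent_eq_sum_roots:
  assumes C: "C \<in> carrier_mat n n" "hermitian_on n (\<lambda>i j. C $$ (i, j))" and z: "Im z \<noteq> 0"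
  shows "(\<Sum>i<n. resolvent n (\<lambda>i j. C $$ (i, j)) z i i) = (\<Sum>x\<in>#proots (char_poly C). 1 / (x - z))"
proof -
  let ?p = "char_poly C" and ?M = "shifted_mat n (\<lambda>i j. C $$ (i, j)) z"
  have d: "Determinant.det ?M \<noteq> 0" by (rule det_shifted_mat_nonzero[OF C(2) z])
  then have pz: "poly ?p z \<noteq> 0" using poly_char_poly_shifted[OF C(1)] by simp
  have monic: "lead_coeff ?p = 1" using degree_monic_char_poly[OF C(1)] by simp
  have fact: "?p = (\<Prod>x\<in>#proots ?p. [:-x, 1:])"
    using complex_poly_decompose_multiset[of ?p] monic by simp
  have neg: "- (\<Sum>x\<in>#R. f x) = (\<Sum>x\<in>#R. - f x)" for R and f :: "complex \<Rightarrow> complex"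
    by (induction R) auto
  have notin: "z \<notin># proots ?p" using hermitian_char_poly_roots_real[OF C, of z] z by auto
  have "poly (pderiv ?p) z = poly ?p z * (\<Sum>x\<in>#proots ?p. 1 / (z - x))"
    using logderiv_prod_mset_linear[OF notin] fact by simp
  then have 1: "(\<Sum>x\<in>#proots ?p. 1 / (z - x)) = poly (pderiv ?p) z / poly ?p z"
    by (metis nonzero_mult_div_cancel_left pz)
  have "resolvent n (\<lambda>i j. C $$ (i, j)) z i i = - (poly (char_poly (mat_delete C i i)) z / poly ?p z)"
    if i: "i < n" for i
  proof -
    have n: "n = Suc (n - 1)" using i by simp
    have del: "mat_delete ?M i i = shifted_mat (n - 1) (\<lambda>k l. mat_delete C i i $$ (k, l)) z"
      using C(1) i by (intro eq_matI) (auto simp: mat_delete_def shifted_mat_def)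
    have cd: "mat_delete C i i \<in> carrier_mat (n - 1) (n - 1)" using C(1) i by (auto simp: mat_delete_def)
    have "adj_mat ?M $$ (i, i) = Determinant.det (mat_delete ?M i i)"
      using i by (simp add: adj_mat_def cofactor_def shifted_mat_def)
    also have "\<dots> = (-1) ^ (n - 1) * poly (char_poly (mat_delete C i i)) z"
      unfolding del poly_char_poly_shifted[OF cd]
      by (simp add: mult.assoc[symmetric] power_mult_distrib[symmetric])
    finally have "resolvent n (\<lambda>i j. C $$ (i, j)) z i i =
        (-1) ^ (n - 1) * poly (char_poly (mat_delete C i i)) z / Determinant.det ?M"
      by (simp add: resolvent_def)
    \<comment> \<open>A minor has size \<open>n - 1\<close>, so the two sign factors differ by
      exactly \<open>- 1\<close>.\<close>
    moreover have "(-1) ^ n = - ((-1 :: complex) ^ (n - 1))" by (subst n) simp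
    moreover have "(-1 :: complex) ^ (n - 1) = 1 \<or> (-1 :: complex) ^ (n - 1) = -1"
      by (cases "even (n - 1)") auto
    ultimately show ?thesis unfolding poly_char_poly_shifted[OF C(1)] by auto
  qed
  then have "(\<Sum>i<n. resolvent n (\<lambda>i j. C $$ (i, j)) z i i) = - (poly (pderiv ?p) z / poly ?p z)"
    unfolding pderiv_char_poly[OF C(1)] by (simp add: poly_sum sum_divide_distrib sum_negf)
  also have "\<dots> = (\<Sum>x\<in>#proots ?p. - (1 / (z - x)))"
    unfolding 1[symmetric] by (rule neg)
  also have "\<dots> = (\<Sum>x\<in>#proots ?p. 1 / (x - z))"
    by (intro arg_cong[where f = sum_mset] image_mset_cong) (metis minus_diff_eq minus_divide_right)
  finally show ?thesis .
qed

section \<open>The bounded difference inequality\<close>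

context product_prob_space
begin

text \<open>Induction on the coordinates. Integrating out coordinate \<open>i\<close> gives a
  function \<open>g\<close> of the others with the same bound and the same differences; for fixed
  other coordinates, the fluctuation of \<open>f\<close> around \<open>g\<close> is estimated by
  Hoeffding's lemma.\<close>

lemma mcdiarmid_mgf:
  fixes f :: "('i \<Rightarrow> 'a) \<Rightarrow> real" and t c B :: real
  assumes "finite J" and t: "t > 0"
    and "f \<in> borel_measurable (Pi\<^sub>M J M)"
    and "\<And>x. x \<in> space (Pi\<^sub>M J M) \<Longrightarrow> \<bar>f x\<bar> \<le> B"
    and "\<And>x i y. x \<in> space (Pi\<^sub>M J M) \<Longrightarrow> i \<in> J \<Longrightarrow> y \<in> space (M i) \<Longrightarrow> \<bar>f x - f (x(i := y))\<bar> \<le> c"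
  shows "(\<integral>\<^sup>+x. ennreal (exp (t * (f x - integral\<^sup>L (Pi\<^sub>M J M) f))) \<partial>Pi\<^sub>M J M)
    \<le> ennreal (exp (real (card J) * (t\<^sup>2 * c\<^sup>2 / 2)))"
  using assms(1,3-5)
proof (induction J arbitrary: f rule: finite_induct)
  case empty
  have "integral\<^sup>L (Pi\<^sub>M {} M) f = f (\<lambda>_. undefined)"
    unfolding PiM_empty by (simp add: lebesgue_integral_count_space_finite)
  then show ?case unfolding PiM_empty by (simp add: nn_integral_count_space_finite)
next
  case (insert i J)
  note f [measurable] = insert.prems(1)
  note bnd = insert.prems(2) and diff = insert.prems(3)
  interpret J: prob_space "Pi\<^sub>M J M" by (rule prob_space_PiM) (rule prob_space)
  interpret iJ: prob_space "Pi\<^sub>M (insert i J) M" by (rule prob_space_PiM) (rule prob_space)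
  have upd: "x(i := y) \<in> space (Pi\<^sub>M (insert i J) M)" if "x \<in> space (Pi\<^sub>M J M)" "y \<in> space (M i)" for x y
    using that by (auto simp: space_PiM PiE_iff extensional_def)
  define g where "g x = (\<integral>y. f (x(i := y)) \<partial>M i)" for x
  have f_pair [measurable]: "(\<lambda>(x, y). f (x(i := y))) \<in> borel_measurable (Pi\<^sub>M J M \<Otimes>\<^sub>M M i)"
    using measurable_compose[OF measurable_add_dim f] by (simp add: case_prod_beta)
  have g [measurable]: "g \<in> borel_measurable (Pi\<^sub>M J M)"
    unfolding g_def by (rule M.borel_measurable_lebesgue_integral) measurable
  have fx [measurable]: "(\<lambda>y. f (x(i := y))) \<in> borel_measurable (M i)" if "x \<in> space (Pi\<^sub>M J M)" for x
    using measurable_Pair2[OF f_pair that] by simp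
  have int_f: "integrable (Pi\<^sub>M (insert i J) M) f"
    by (rule iJ.integrable_const_bound[where B = B]) (auto intro!: AE_I2 bnd)
  have int_fx: "integrable (M i) (\<lambda>y. f (x(i := y)))" if "x \<in> space (Pi\<^sub>M J M)" for x
    by (rule M.integrable_const_bound[where B = B]) (use that in \<open>auto intro!: AE_I2 bnd upd fx\<close>)
  have Ef: "integral\<^sup>L (Pi\<^sub>M (insert i J) M) f = integral\<^sup>L (Pi\<^sub>M J M) g"
    unfolding g_def by (rule product_integral_insert[OF insert.hyps int_f])
  have g_bnd: "\<bar>g x\<bar> \<le> B" if x: "x \<in> space (Pi\<^sub>M J M)" for x
  proof -
    have "\<bar>g x\<bar> \<le> (\<integral>y. \<bar>f (x(i := y))\<bar> \<partial>M i)" unfolding g_def by (rule integral_abs_bound)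
    also have "\<dots> \<le> (\<integral>y. B \<partial>M i)"
      using int_fx[OF x] bnd upd[OF x] by (intro integral_mono) auto
    finally show ?thesis by (simp add: M.prob_space)
  qed
  have g_diff: "\<bar>g x - g (x(j := y))\<bar> \<le> c"
    if x: "x \<in> space (Pi\<^sub>M J M)" and j: "j \<in> J" and y: "y \<in> space (M j)" for x j y
  proof -
    have ji: "j \<noteq> i" using j insert.hyps by auto
    have xj: "x(j := y) \<in> space (Pi\<^sub>M J M)"
      using x j y by (auto simp: space_PiM PiE_iff extensional_def)
    have "g x - g (x(j := y)) = (\<integral>w. f (x(i := w)) - f (x(j := y, i := w)) \<partial>M i)"
      unfolding g_def by (rule Bochner_Integration.integral_diff[symmetric]) (intro int_fx x xj)+
    also have "\<bar>\<dots>\<bar> \<le> (\<integral>w. \<bar>f (x(i := w)) - f (x(j := y, i := w))\<bar> \<partial>M i)"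
      by (rule integral_abs_bound)
    also have "\<dots> \<le> (\<integral>w. c \<partial>M i)"
    proof (rule integral_mono)
      fix w assume w: "w \<in> space (M i)"
      show "\<bar>f (x(i := w)) - f (x(j := y, i := w))\<bar> \<le> c"
        unfolding fun_upd_twist[OF ji, of x y w] by (rule diff[OF upd[OF x w]]) (use j y in auto)
    qed (intro integrable_abs Bochner_Integration.integrable_diff int_fx x xj, auto)
    finally show ?thesis by (simp add: M.prob_space)
  qed
  have inner: "(\<integral>\<^sup>+y. ennreal (exp (t * (f (x(i := y)) - g x))) \<partial>M i) \<le> ennreal (exp (t\<^sup>2 * c\<^sup>2 / 2))"
    if x: "x \<in> space (Pi\<^sub>M J M)" for x
  proof -
    obtain y0 where y0: "y0 \<in> space (M i)" using M.not_empty by auto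
    let ?a = "f (x(i := y0))"
    \<comment> \<open>All values lie within \<open>c\<close> of the one at \<open>y0\<close>, in an
      interval of length \<open>2 c\<close>; Hoeffding's exponent \<open>t^2 (2 c)^2 / 8\<close>
      becomes \<open>t^2 c^2 / 2\<close>.\<close>
    interpret h: interval_bounded_random_variable "M i" "\<lambda>y. f (x(i := y))" "?a - c" "?a + c"
    proof
      show "AE y in M i. f (x(i := y)) \<in> {?a - c..?a + c}"
      proof (rule AE_I2)
        fix y assume y: "y \<in> space (M i)"
        have d: "\<bar>?a - f (x(i := y))\<bar> \<le> c"
          using diff[OF upd[OF x y0], of i y] y unfolding fun_upd_upd by blast
        show "f (x(i := y)) \<in> {?a - c..?a + c}"
          using d by (auto simp: abs_le_iff)
      qed
    qed (rule fx[OF x])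
    have "(?a + c - (?a - c))\<^sup>2 = 4 * c\<^sup>2" by (simp add: power2_eq_square algebra_simps)
    with h.Hoeffdings_lemma_nn_integral[OF t] show ?thesis by (simp add: g_def mult_ac)
  qed
  have "(\<integral>\<^sup>+x. ennreal (exp (t * (f x - integral\<^sup>L (Pi\<^sub>M (insert i J) M) f))) \<partial>Pi\<^sub>M (insert i J) M)
      = (\<integral>\<^sup>+x. (\<integral>\<^sup>+y. ennreal (exp (t * (f (x(i := y)) - integral\<^sup>L (Pi\<^sub>M J M) g))) \<partial>M i) \<partial>Pi\<^sub>M J M)"
    unfolding Ef by (rule product_nn_integral_insert[OF insert.hyps]) measurable
  also have "\<dots> \<le> (\<integral>\<^sup>+x. ennreal (exp (t * (g x - integral\<^sup>L (Pi\<^sub>M J M) g))) * ennreal (exp (t\<^sup>2 * c\<^sup>2 / 2)) \<partial>Pi\<^sub>M J M)"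
  proof (rule nn_integral_mono)
    fix x assume x: "x \<in> space (Pi\<^sub>M J M)"
    note [measurable] = fx[OF x]
    have "(\<integral>\<^sup>+y. ennreal (exp (t * (f (x(i := y)) - integral\<^sup>L (Pi\<^sub>M J M) g))) \<partial>M i) =
        (\<integral>\<^sup>+y. ennreal (exp (t * (g x - integral\<^sup>L (Pi\<^sub>M J M) g))) * ennreal (exp (t * (f (x(i := y)) - g x))) \<partial>M i)"
      by (intro nn_integral_cong) (simp add: ennreal_mult[symmetric] exp_add[symmetric] algebra_simps)
    also have "\<dots> = ennreal (exp (t * (g x - integral\<^sup>L (Pi\<^sub>M J M) g))) * (\<integral>\<^sup>+y. ennreal (exp (t * (f (x(i := y)) - g x))) \<partial>M i)"
      by (rule nn_integral_cmult) measurable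
    also have "\<dots> \<le> ennreal (exp (t * (g x - integral\<^sup>L (Pi\<^sub>M J M) g))) * ennreal (exp (t\<^sup>2 * c\<^sup>2 / 2))"
      by (intro mult_left_mono inner x) auto
    finally show "(\<integral>\<^sup>+y. ennreal (exp (t * (f (x(i := y)) - integral\<^sup>L (Pi\<^sub>M J M) g))) \<partial>M i) \<le> \<dots>" .
  qed
  also have "\<dots> = (\<integral>\<^sup>+x. ennreal (exp (t * (g x - integral\<^sup>L (Pi\<^sub>M J M) g))) \<partial>Pi\<^sub>M J M) * ennreal (exp (t\<^sup>2 * c\<^sup>2 / 2))"
    by (rule nn_integral_multc) measurable
  also have "\<dots> \<le> ennreal (exp (real (card J) * (t\<^sup>2 * c\<^sup>2 / 2))) * ennreal (exp (t\<^sup>2 * c\<^sup>2 / 2))"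
    by (intro mult_right_mono insert.IH g g_bnd g_diff) auto
  also have "\<dots> = ennreal (exp (real (card (insert i J)) * (t\<^sup>2 * c\<^sup>2 / 2)))"
    using insert.hyps by (simp add: ennreal_mult[symmetric] exp_add[symmetric] algebra_simps)
  finally show ?case .
qed

lemma mcdiarmid_upper_tail:
  fixes f :: "('i \<Rightarrow> 'a) \<Rightarrow> real" and c B e :: real
  assumes J: "finite J" "J \<noteq> {}" and c: "c > 0" and e: "e > 0"
    and f: "f \<in> borel_measurable (Pi\<^sub>M J M)"
    and bnd: "\<And>x. x \<in> space (Pi\<^sub>M J M) \<Longrightarrow> \<bar>f x\<bar> \<le> B"
    and diff: "\<And>x i y. x \<in> space (Pi\<^sub>M J M) \<Longrightarrow> i \<in> J \<Longrightarrow> y \<in> space (M i) \<Longrightarrow> \<bar>f x - f (x(i := y))\<bar> \<le> c"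
  shows "measure (Pi\<^sub>M J M) {x \<in> space (Pi\<^sub>M J M). f x - integral\<^sup>L (Pi\<^sub>M J M) f \<ge> e}
    \<le> exp (- (e\<^sup>2 / (2 * real (card J) * c\<^sup>2)))"
proof -
  interpret J: prob_space "Pi\<^sub>M J M" by (rule prob_space_PiM) (rule prob_space)
  let ?E = "integral\<^sup>L (Pi\<^sub>M J M) f"
  let ?N = "real (card J)"
  have N: "?N > 0" using J by (simp add: card_gt_0_iff)
  \<comment> \<open>The minimiser of the Chernoff exponent
    \<open>- t e + N t^2 c^2 / 2\<close>.\<close>
  define t where "t = e / (?N * c\<^sup>2)"
  have t: "t > 0" using N c e by (simp add: t_def)
  note [measurable] = f
  have "emeasure (Pi\<^sub>M J M) {x \<in> space (Pi\<^sub>M J M). f x - ?E \<ge> e} \<le>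
      emeasure (Pi\<^sub>M J M) {x \<in> space (Pi\<^sub>M J M). 1 \<le> ennreal (exp (- t * e)) * ennreal (exp (t * (f x - ?E)))}"
  proof (rule emeasure_mono)
    show "{x \<in> space (Pi\<^sub>M J M). f x - ?E \<ge> e} \<subseteq>
      {x \<in> space (Pi\<^sub>M J M). 1 \<le> ennreal (exp (- t * e)) * ennreal (exp (t * (f x - ?E)))}"
    proof safe
      fix x assume "e \<le> f x - ?E"
      then have "0 \<le> - t * e + t * (f x - ?E)"
        using mult_left_mono[of e "f x - ?E" t] t by simp
      then have "1 \<le> exp (- t * e) * exp (t * (f x - ?E))"
        unfolding exp_add[symmetric] by simp
      then show "1 \<le> ennreal (exp (- t * e)) * ennreal (exp (t * (f x - ?E)))"
        by (simp add: ennreal_mult[symmetric] flip: ennreal_1)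
    qed
  qed measurable
  also have "\<dots> \<le> ennreal (exp (- t * e)) * (\<integral>\<^sup>+x. ennreal (exp (t * (f x - ?E))) * indicator (space (Pi\<^sub>M J M)) x \<partial>Pi\<^sub>M J M)"
    using nn_integral_Markov_inequality[where u = "\<lambda>x. ennreal (exp (t * (f x - ?E)))" and M = "Pi\<^sub>M J M"
        and A = "space (Pi\<^sub>M J M)" and c = "ennreal (exp (- t * e))"]
    by (simp add: Int_def conj_commute)
  also have "(\<integral>\<^sup>+x. ennreal (exp (t * (f x - ?E))) * indicator (space (Pi\<^sub>M J M)) x \<partial>Pi\<^sub>M J M) =
      (\<integral>\<^sup>+x. ennreal (exp (t * (f x - ?E))) \<partial>Pi\<^sub>M J M)"
    by (intro nn_integral_cong) auto
  also have "ennreal (exp (- t * e)) * \<dots> \<le> ennreal (exp (- t * e)) * ennreal (exp (?N * (t\<^sup>2 * c\<^sup>2 / 2)))"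
    by (intro mult_left_mono mcdiarmid_mgf[OF J(1) t f bnd diff]) auto
  also have "\<dots> = ennreal (exp (- t * e + ?N * (t\<^sup>2 * c\<^sup>2 / 2)))"
    by (simp add: ennreal_mult[symmetric] exp_add[symmetric])
  also have "- t * e + ?N * (t\<^sup>2 * c\<^sup>2 / 2) = - (e\<^sup>2 / (2 * ?N * c\<^sup>2))"
    unfolding t_def using N c by (simp add: field_simps power2_eq_square)
  finally show ?thesis
    unfolding J.emeasure_eq_measure by (simp only: ennreal_le_iff[OF exp_ge_zero])
qed

end

text \<open>By independence the joint distribution is a product measure, to which the one-sided tail
  applies for \<open>f\<close> and \<open>- f\<close>. Every \<open>X i\<close> is measurable
  because the product locale wants a probability measure at each index, also outside
  \<open>J\<close>.\<close>

lemma (in prob_space) mcdiarmid: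
  fixes f :: "('i \<Rightarrow> 'b) \<Rightarrow> real" and c B e :: real
  assumes J: "finite J" "J \<noteq> {}" and c: "c > 0" and e: "e > 0"
    and X: "\<And>i. random_variable (N i) (X i)" and indep: "indep_vars N X J"
    and f: "f \<in> borel_measurable (Pi\<^sub>M J N)"
    and bnd: "\<And>x. x \<in> space (Pi\<^sub>M J N) \<Longrightarrow> \<bar>f x\<bar> \<le> B"
    and diff: "\<And>x i y. x \<in> space (Pi\<^sub>M J N) \<Longrightarrow> i \<in> J \<Longrightarrow> y \<in> space (N i) \<Longrightarrow> \<bar>f x - f (x(i := y))\<bar> \<le> c"
  defines "Y \<equiv> \<lambda>\<omega>. f (\<lambda>i\<in>J. X i \<omega>)"
  shows "prob {\<omega> \<in> space M. \<bar>Y \<omega> - expectation Y\<bar> \<ge> e} \<le> 2 * exp (- (e\<^sup>2 / (2 * real (card J) * c\<^sup>2)))"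
proof -
  define D where "D = (\<lambda>i. distr M (N i) (X i))"
  have "prob_space (D i)" for i unfolding D_def by (rule prob_space_distr[OF X])
  then interpret D: product_prob_space D by (rule product_prob_spaceI)
  have space_D: "space (D i) = space (N i)" for i by (simp add: D_def)
  have sD: "sets (Pi\<^sub>M J D) = sets (Pi\<^sub>M J N)" by (intro sets_PiM_cong) (auto simp: D_def)
  have spD: "space (Pi\<^sub>M J D) = space (Pi\<^sub>M J N)" using sets_eq_imp_space_eq[OF sD] .
  have X' [measurable]: "(\<lambda>\<omega>. \<lambda>i\<in>J. X i \<omega>) \<in> measurable M (Pi\<^sub>M J N)"
    by (intro measurable_restrict X)
  have distr: "distr M (Pi\<^sub>M J N) (\<lambda>\<omega>. \<lambda>i\<in>J. X i \<omega>) = Pi\<^sub>M J D"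
    using indep indep_vars_iff_distr_eq_PiM'[OF J(2) X] by (simp add: D_def)
  have fD: "f \<in> borel_measurable (Pi\<^sub>M J D)" using f measurable_cong_sets[OF sD refl] by auto
  have EY: "expectation Y = integral\<^sup>L (Pi\<^sub>M J D) f"
    unfolding Y_def distr[symmetric] by (rule integral_distr[symmetric]) (use f in measurable)
  have tail: "prob {\<omega> \<in> space M. g (\<lambda>i\<in>J. X i \<omega>) - integral\<^sup>L (Pi\<^sub>M J D) g \<ge> e} \<le> exp (- (e\<^sup>2 / (2 * real (card J) * c\<^sup>2)))"
    if g: "g \<in> borel_measurable (Pi\<^sub>M J D)" and gb: "\<And>x. x \<in> space (Pi\<^sub>M J N) \<Longrightarrow> \<bar>g x\<bar> \<le> B"
      and gd: "\<And>x i y. x \<in> space (Pi\<^sub>M J N) \<Longrightarrow> i \<in> J \<Longrightarrow> y \<in> space (N i) \<Longrightarrow> \<bar>g x - g (x(i := y))\<bar> \<le> c"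
    for g :: "_ \<Rightarrow> real"
  proof -
    have gN [measurable]: "g \<in> borel_measurable (Pi\<^sub>M J N)" using g measurable_cong_sets[OF sD refl] by auto
    let ?A = "{x \<in> space (Pi\<^sub>M J N). g x - integral\<^sup>L (Pi\<^sub>M J D) g \<ge> e}"
    have "prob {\<omega> \<in> space M. g (\<lambda>i\<in>J. X i \<omega>) - integral\<^sup>L (Pi\<^sub>M J D) g \<ge> e}
        = prob ((\<lambda>\<omega>. \<lambda>i\<in>J. X i \<omega>) -` ?A \<inter> space M)"
      using measurable_space[OF X'] by (intro arg_cong[where f = prob]) auto
    also have "\<dots> = measure (distr M (Pi\<^sub>M J N) (\<lambda>\<omega>. \<lambda>i\<in>J. X i \<omega>)) ?A"
      by (rule measure_distr[symmetric]) measurable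
    also have "\<dots> \<le> exp (- (e\<^sup>2 / (2 * real (card J) * c\<^sup>2)))"
      unfolding distr spD[symmetric]
      by (rule D.mcdiarmid_upper_tail[OF J c e g, where B = B])
         (auto simp: spD gb space_D intro!: gd)
    finally show ?thesis .
  qed
  have Y [measurable]: "Y \<in> borel_measurable M" unfolding Y_def using f by measurable
  have "prob {\<omega> \<in> space M. \<bar>Y \<omega> - expectation Y\<bar> \<ge> e} \<le>
      prob ({\<omega> \<in> space M. Y \<omega> - expectation Y \<ge> e} \<union> {\<omega> \<in> space M. - Y \<omega> + expectation Y \<ge> e})"
    by (intro finite_measure_mono) auto
  also have "\<dots> \<le> prob {\<omega> \<in> space M. Y \<omega> - expectation Y \<ge> e} + prob {\<omega> \<in> space M. - Y \<omega> + expectation Y \<ge> e}"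
    by (rule measure_Un_le) measurable
  also have "prob {\<omega> \<in> space M. Y \<omega> - expectation Y \<ge> e} \<le> exp (- (e\<^sup>2 / (2 * real (card J) * c\<^sup>2)))"
    unfolding EY by (unfold Y_def, rule tail[OF fD bnd diff])
  also have "prob {\<omega> \<in> space M. - Y \<omega> + expectation Y \<ge> e} \<le> exp (- (e\<^sup>2 / (2 * real (card J) * c\<^sup>2)))"
    unfolding EY using tail[of "\<lambda>x. - f x"] fD bnd diff by (simp add: Y_def abs_minus_commute)
  finally show ?thesis by simp
qed

section \<open>Linear combinations of Wigner matrices\<close>

lemma borel_measurable_det:
  fixes F :: "'a \<Rightarrow> nat \<Rightarrow> nat \<Rightarrow> complex"
  assumes "\<And>i j. i < n \<Longrightarrow> j < n \<Longrightarrow> (\<lambda>\<omega>. F \<omega> i j) \<in> borel_measurable N"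
  shows "(\<lambda>\<omega>. Determinant.det (Matrix.mat n n (\<lambda>(i, j). F \<omega> i j))) \<in> borel_measurable N"
proof -
  have eq: "Determinant.det (Matrix.mat n n (\<lambda>(i, j). F \<omega> i j)) =
      (\<Sum>p | p permutes {0..<n}. signof p * (\<Prod>i=0..<n. F \<omega> i (p i)))" for \<omega>
    unfolding Determinant.det_def by (auto intro!: sum.cong prod.cong simp: permutes_in_image)
  have "(\<lambda>\<omega>. F \<omega> i (p i)) \<in> borel_measurable N" if "p permutes {0..<n}" "i < n" for p i
    using permutes_in_image[OF that(1), of i] that(2) by (intro assms) auto
  then show ?thesis unfolding eq
    by (intro borel_measurable_sum borel_measurable_times borel_measurable_const borel_measurable_prod) auto
qed

text \<open>A cofactor divided by a determinant. Writing the minor as a matrix with shifted indices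
  brings it into the form to which the Leibniz expansion of determinants applies.\<close>

lemma borel_measurable_resolvent:
  assumes A: "\<And>i j. i < n \<Longrightarrow> j < n \<Longrightarrow> (\<lambda>\<omega>. A \<omega> i j) \<in> borel_measurable N"
    and ij: "i < n" "j < n"
  shows "(\<lambda>\<omega>. resolvent n (A \<omega>) z i j) \<in> borel_measurable N"
proof -
  let ?F = "\<lambda>\<omega> i j. A \<omega> i j - (if i = j then z else 0)"
  have F: "(\<lambda>\<omega>. ?F \<omega> i j) \<in> borel_measurable N" if "i < n" "j < n" for i j
    using A[OF that] by (intro borel_measurable_diff) auto
  let ?k = "\<lambda>a b. if b < a then b else Suc b"
  have del: "mat_delete (Matrix.mat n n (\<lambda>(i, j). ?F \<omega> i j)) j i =
      Matrix.mat (n - 1) (n - 1) (\<lambda>(k, l). ?F \<omega> (?k j k) (?k i l))" for \<omega>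
    by (intro eq_matI) (auto simp: mat_delete_def)
  have eq: "resolvent n (A \<omega>) z i j = ((-1) ^ (j + i) *
        Determinant.det (Matrix.mat (n - 1) (n - 1) (\<lambda>(k, l). ?F \<omega> (?k j k) (?k i l))))
      / Determinant.det (Matrix.mat n n (\<lambda>(i, j). ?F \<omega> i j))" for \<omega>
  proof -
    have "resolvent n (A \<omega>) z i j = cofactor (Matrix.mat n n (\<lambda>(i, j). ?F \<omega> i j)) j i
        / Determinant.det (Matrix.mat n n (\<lambda>(i, j). ?F \<omega> i j))"
      using ij unfolding resolvent_def shifted_mat_def adj_mat_def by simp
    then show ?thesis unfolding cofactor_def del .
  qed
  show ?thesis unfolding eq
    by (intro borel_measurable_divide borel_measurable_times borel_measurable_const borel_measurable_det F) auto
qed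

lemma borel_measurable_stieltjes:
  assumes "\<And>i j. i < n \<Longrightarrow> j < n \<Longrightarrow> (\<lambda>\<omega>. A \<omega> i j) \<in> borel_measurable N"
  shows "(\<lambda>\<omega>. stieltjes n (A \<omega>) z) \<in> borel_measurable N"
  unfolding stieltjes_def
  by (intro borel_measurable_divide borel_measurable_sum borel_measurable_const borel_measurable_resolvent assms) auto

lemma borel_measurable_if_const:
  "(\<not> P \<Longrightarrow> f \<in> borel_measurable N) \<Longrightarrow> (\<lambda>x. if P then 0 else f x :: complex) \<in> borel_measurable N"
  by (cases P) simp_all

text \<open>Only the entries \<open>x (r, i, j)\<close> with \<open>i \<le> j\<close> are used, and the real part is taken on the diagonal,
  so that the matrix is Hermitian for every array \<open>x\<close>; the bounded difference inequality needs this.\<close>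

definition wigner_comb :: "'r set \<Rightarrow> ('r \<Rightarrow> real) \<Rightarrow> nat \<Rightarrow> ('r \<times> nat \<times> nat \<Rightarrow> complex) \<Rightarrow> nat \<Rightarrow> nat \<Rightarrow> complex" where
  "wigner_comb R c n x i j =
     (if i = j then of_real (Re (\<Sum>r\<in>R. of_real (c r) * x (r, i, i)))
      else if i < j then \<Sum>r\<in>R. of_real (c r) * x (r, i, j)
      else cnj (\<Sum>r\<in>R. of_real (c r) * x (r, j, i))) / of_real (sqrt (real n))"

lemma hermitian_wigner_comb: "hermitian_on m (wigner_comb R c n x)"
  unfolding hermitian_on_def wigner_comb_def by auto

text \<open>Entry \<open>(i, j)\<close> reads only coordinates whose larger index is
  \<open>i\<close> or \<open>j\<close>. Altering the coordinates with larger index \<open>m\<close>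
  therefore leaves everything outside row and column \<open>m\<close> fixed.\<close>

lemma wigner_comb_cong:
  assumes "\<And>r a b. r \<in> R \<Longrightarrow> a \<le> b \<Longrightarrow> b \<le> max i j \<Longrightarrow> b = i \<or> b = j \<Longrightarrow> x (r, a, b) = y (r, a, b)"
  shows "wigner_comb R c n x i j = wigner_comb R c n y i j"
proof (cases i j rule: linorder_cases)
  case less
  then have "(\<Sum>r\<in>R. of_real (c r) * x (r, i, j)) = (\<Sum>r\<in>R. of_real (c r) * y (r, i, j))"
    using assms by (intro sum.cong refl) auto
  then show ?thesis using less by (simp add: wigner_comb_def)
next
  case equal
  then have "(\<Sum>r\<in>R. of_real (c r) * x (r, i, i)) = (\<Sum>r\<in>R. of_real (c r) * y (r, i, i))"
    using assms by (intro sum.cong refl) auto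
  then show ?thesis using equal by (simp add: wigner_comb_def)
next
  case greater
  then have "(\<Sum>r\<in>R. of_real (c r) * x (r, j, i)) = (\<Sum>r\<in>R. of_real (c r) * y (r, j, i))"
    using assms by (intro sum.cong refl) auto
  then show ?thesis using greater by (simp add: wigner_comb_def)
qed

lemma borel_measurable_wigner_comb:
  assumes "\<And>r a b. r \<in> R \<Longrightarrow> a \<le> b \<Longrightarrow> b < n \<Longrightarrow> (\<lambda>\<omega>. F \<omega> (r, a, b)) \<in> borel_measurable N"
    and "i < n" "j < n"
  shows "(\<lambda>\<omega>. wigner_comb R c n (F \<omega>) i j) \<in> borel_measurable N"
proof -
  have *: "(\<lambda>\<omega>. \<Sum>r\<in>R. of_real (c r) * F \<omega> (r, a, b)) \<in> borel_measurable N" if "a \<le> b" "b < n" for a b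
    by (intro borel_measurable_sum borel_measurable_times borel_measurable_const assms that)
  have re: "(\<lambda>\<omega>. of_real (Re (\<Sum>r\<in>R. of_real (c r) * F \<omega> (r, i, i))) :: complex) \<in> borel_measurable N"
    using *[OF order_refl assms(2)] by measurable
  have cn: "(\<lambda>\<omega>. cnj (\<Sum>r\<in>R. of_real (c r) * F \<omega> (r, j, i))) \<in> borel_measurable N" if "j < i"
  proof (rule measurable_compose[OF *])
    show "cnj \<in> borel_measurable borel"
      by (intro borel_measurable_continuous_onI continuous_intros)
  qed (use that assms in auto)
  show ?thesis
    unfolding wigner_comb_def using * re cn assms(2,3) by (cases i j rule: linorder_cases) simp_all
qed

lemma integrable_mult_bounded:
  fixes f g :: "'a \<Rightarrow> complex"
  assumes f: "integrable M f" and g: "g \<in> borel_measurable M"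
    and B: "\<And>\<omega>. \<omega> \<in> space M \<Longrightarrow> cmod (g \<omega>) \<le> B"
  shows "integrable M (\<lambda>\<omega>. f \<omega> * g \<omega>)"
proof (rule Bochner_Integration.integrable_bound)
  show "integrable M (\<lambda>\<omega>. B * cmod (f \<omega>))" using f by simp
  show "(\<lambda>\<omega>. f \<omega> * g \<omega>) \<in> borel_measurable M" using f g by measurable
  show "AE \<omega> in M. norm (f \<omega> * g \<omega>) \<le> norm (B * cmod (f \<omega>))"
  proof (rule AE_I2)
    fix \<omega> assume "\<omega> \<in> space M"
    then have "cmod (f \<omega>) * cmod (g \<omega>) \<le> cmod (f \<omega>) * \<bar>B\<bar>"
      by (intro mult_left_mono order_trans[OF B]) auto
    then show "norm (f \<omega> * g \<omega>) \<le> norm (B * cmod (f \<omega>))"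
      by (simp add: norm_mult abs_mult mult.commute)
  qed
qed

text \<open>Pairs \<open>(a, b)\<close> and \<open>(b, a)\<close> are brought together because both
  matrix entries come from the same random variables.\<close>

lemma sum_square_split:
  fixes f :: "nat \<Rightarrow> nat \<Rightarrow> 'b::comm_monoid_add"
  shows "(\<Sum>i<n. \<Sum>j<n. f i j) = (\<Sum>i<n. f i i) + (\<Sum>b<n. \<Sum>a<b. f a b + f b a)"
  by (induction n) (simp_all add: sum.distrib ac_simps)

lemma min_1_sum_le:
  fixes f :: "'b \<Rightarrow> real"
  assumes "finite S" "\<And>x. x \<in> S \<Longrightarrow> 0 \<le> f x"
  shows "min 1 (\<Sum>x\<in>S. f x) \<le> (\<Sum>x\<in>S. min 1 (f x))"
  using assms
proof (induction S rule: finite_induct)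
  case (insert x S)
  then have "0 \<le> f x" "0 \<le> sum f S" "min 1 (sum f S) \<le> (\<Sum>x\<in>S. min 1 (f x))" by (auto intro: sum_nonneg)
  with insert.hyps show ?case by (auto simp: min_def split: if_splits)
qed simp

section \<open>The quadratic equation of the semicircle law\<close>

text \<open>The product of the roots is \<open>1 / v > 0\<close>, so each is a positive multiple of
  the conjugate of the other and their imaginary parts have opposite signs. The sum
  \<open>- z / v\<close> is not real, so they cannot both be real.\<close>

lemma semicircle_root_exists:
  fixes z :: complex and v :: real
  assumes v: "v > 0" and z: "Im z > 0"
  shows "\<exists>m. Im m > 0 \<and> of_real v * m\<^sup>2 + z * m + 1 = 0"
proof -
  define w where "w = csqrt (z\<^sup>2 - 4 * of_real v)"
  define m1 where "m1 = (- z + w) / (2 * of_real v)"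
  define m2 where "m2 = (- z - w) / (2 * of_real v)"
  have w2: "w\<^sup>2 = z\<^sup>2 - 4 * of_real v" by (simp add: w_def)
  have v0: "complex_of_real v \<noteq> 0" using v by simp
  have root1: "of_real v * m1\<^sup>2 + z * m1 + 1 = 0"
  proof -
    have "4 * of_real v * (of_real v * m1\<^sup>2 + z * m1 + 1) = w\<^sup>2 - (z\<^sup>2 - 4 * of_real v)"
      using v0 unfolding m1_def by (simp add: field_simps power2_eq_square)
    then show ?thesis using v0 w2 by simp
  qed
  have root2: "of_real v * m2\<^sup>2 + z * m2 + 1 = 0"
  proof -
    have "4 * of_real v * (of_real v * m2\<^sup>2 + z * m2 + 1) = w\<^sup>2 - (z\<^sup>2 - 4 * of_real v)"
      using v0 unfolding m2_def by (simp add: field_simps power2_eq_square)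
    then show ?thesis using v0 w2 by simp
  qed
  have sum: "of_real v * (m1 + m2) = - z" using v0 unfolding m1_def m2_def by (simp add: field_simps)
  have prod: "of_real v * (m1 * m2) = 1"
  proof -
    have "4 * of_real v * (of_real v * (m1 * m2)) = z\<^sup>2 - w\<^sup>2"
      using v0 unfolding m1_def m2_def by (simp add: field_simps power2_eq_square)
    then show ?thesis using v0 w2 by simp
  qed
  have "Im m1 > 0 \<or> Im m2 > 0"
  proof (rule ccontr)
    assume neg: "\<not> (Im m1 > 0 \<or> Im m2 > 0)"
    have "of_real ((cmod m1)\<^sup>2) * (of_real v * m2) = cnj m1"
    proof -
      have "of_real ((cmod m1)\<^sup>2) * (of_real v * m2) = of_real v * (m1 * m2) * cnj m1"
        unfolding complex_norm_square by (simp only: mult_ac)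
      then show ?thesis using prod by simp
    qed
    then have "Im (of_real ((cmod m1)\<^sup>2) * (of_real v * m2)) = - Im m1" by simp
    then have q: "v * Im m2 * (cmod m1)\<^sup>2 = - Im m1" by (simp add: mult_ac)
    have "v * Im m2 * (cmod m1)\<^sup>2 \<le> 0"
      using neg v by (intro mult_nonpos_nonneg mult_nonneg_nonpos) auto
    with q have 1: "Im m1 = 0" using neg by linarith
    have "v * (Im m1 + Im m2) = - Im z" using arg_cong[OF sum, of Im] by simp
    with 1 have "v * Im m2 < 0" using z by simp
    then have "Im m2 < 0" using v by (simp add: mult_less_0_iff)
    moreover have "m1 \<noteq> 0" using prod by auto
    ultimately have "v * Im m2 * (cmod m1)\<^sup>2 < 0" using v by (intro mult_neg_pos mult_pos_neg) auto
    with q 1 show False by linarith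
  qed
  with root1 root2 show ?thesis by blast
qed

text \<open>Selecting the root by its half plane avoids fixing a branch of the square root. For
  \<open>v > 0\<close> and \<open>Im z > 0\<close> the choice is unique: apply
  \<open>semicircle_stieltjes_stable\<close> to another such root.\<close>

definition semicircle_stieltjes :: "real \<Rightarrow> complex \<Rightarrow> complex" where
  "semicircle_stieltjes v z = (SOME m. Im m > 0 \<and> of_real v * m\<^sup>2 + z * m + 1 = 0)"

context
  fixes v :: real
  assumes v: "v > 0"
begin

lemma semicircle_stieltjes:
  assumes "Im z > 0"
  shows "Im (semicircle_stieltjes v z) > 0"
    and "of_real v * (semicircle_stieltjes v z)\<^sup>2 + z * semicircle_stieltjes v z + 1 = 0"
  unfolding semicircle_stieltjes_def using someI_ex[OF semicircle_root_exists[OF v assms]] by auto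

text \<open>The other root has imaginary part at most \<open>- Im z / v\<close>, which makes the quadratic
  equation stable in the upper half plane.\<close>

lemma semicircle_stieltjes_stable:
  assumes z: "Im z > 0"
  shows "cmod (s - semicircle_stieltjes v z) * (v * Im s + Im z) \<le> cmod (1 + z * s + of_real v * s\<^sup>2)"
proof -
  define m where "m = semicircle_stieltjes v z"
  define m2 where "m2 = - z / of_real v - m"
  have m: "Im m > 0" "of_real v * m\<^sup>2 + z * m + 1 = 0"
    unfolding m_def by (rule semicircle_stieltjes[OF z])+
  have v0: "complex_of_real v \<noteq> 0" using v by simp
  have "of_real v * (s - m) * (s - m2) = of_real v * s\<^sup>2 + z * s - (of_real v * m\<^sup>2 + z * m)"
    unfolding m2_def using v0 by (simp add: field_simps power2_eq_square)
  also have "\<dots> = 1 + z * s + of_real v * s\<^sup>2" using m(2) by (simp add: algebra_simps add_eq_0_iff)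
  finally have eq: "of_real v * (s - m) * (s - m2) = 1 + z * s + of_real v * s\<^sup>2" .
  have "cmod (1 + z * s + of_real v * s\<^sup>2) = cmod (s - m) * (v * cmod (s - m2))"
    unfolding eq[symmetric] norm_mult using v by simp
  moreover have "v * Im s + Im z \<le> v * cmod (s - m2)"
  proof -
    have "Im s + Im z / v \<le> Im (s - m2)" unfolding m2_def using m(1) by simp
    also have "\<dots> \<le> cmod (s - m2)" using abs_Im_le_cmod[of "s - m2"] by linarith
    finally have "v * (Im s + Im z / v) \<le> v * cmod (s - m2)" using v by (intro mult_left_mono) auto
    then show ?thesis using v by (simp add: distrib_left)
  qed
  ultimately show ?thesis unfolding m_def[symmetric] by (simp add: mult_left_mono)
qed

text \<open>Multiply \<open>m (v m + z) = - 1\<close> by the conjugate of \<open>m\<close> and take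
  imaginary parts: \<open>|m|^2 (v Im m + Im z) = Im m\<close>. Dropping \<open>Im z\<close> gives a
  bound uniform up to the real axis, as dominated convergence in the inversion requires.\<close>

lemma cmod_semicircle_stieltjes_le:
  assumes z: "Im z > 0"
  shows "cmod (semicircle_stieltjes v z) \<le> 1 / sqrt v"
proof -
  define m where "m = semicircle_stieltjes v z"
  have m: "Im m > 0" "of_real v * m\<^sup>2 + z * m + 1 = 0"
    unfolding m_def by (rule semicircle_stieltjes[OF z])+
  have m0: "m \<noteq> 0" using m by auto
  have "m * (of_real v * m + z) = - 1" using m(2) by (simp add: algebra_simps power2_eq_square add_eq_0_iff)
  then have "cnj m * (m * (of_real v * m + z)) = - cnj m" by simp
  then have "of_real ((cmod m)\<^sup>2) * (of_real v * m + z) = - cnj m"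
    unfolding complex_norm_square by (simp only: mult_ac)
  then have "Im (of_real ((cmod m)\<^sup>2) * (of_real v * m + z)) = Im m" by simp
  then have "(cmod m)\<^sup>2 * (v * Im m + Im z) = Im m" by simp
  moreover have "(cmod m)\<^sup>2 * Im z \<ge> 0" using z by simp
  ultimately have "((cmod m)\<^sup>2 * v) * Im m \<le> 1 * Im m" by (simp add: algebra_simps)
  then have "(cmod m)\<^sup>2 * v \<le> 1" using m(1) by (rule mult_right_le_imp_le)
  then have "(cmod m)\<^sup>2 \<le> 1 / v" using v by (simp add: field_simps)
  then have "cmod m \<le> sqrt (1 / v)" by (rule real_le_rsqrt)
  then show ?thesis unfolding m_def by (simp add: real_sqrt_divide)
qed

text \<open>The root at \<open>z\<close>, inserted into the equation at \<open>w\<close>, leaves the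
  defect \<open>(w - z)\<close> times the root; stability at \<open>w\<close> converts this into a
  distance.\<close>

lemma semicircle_stieltjes_lipschitz:
  assumes z: "Im z > 0" and w: "Im w > 0"
  shows "cmod (semicircle_stieltjes v z - semicircle_stieltjes v w) \<le> cmod (z - w) / (sqrt v * Im w)"
proof -
  let ?s = "semicircle_stieltjes v z"
  have "1 + w * ?s + of_real v * ?s\<^sup>2 = (w - z) * ?s"
    using semicircle_stieltjes(2)[OF z] by (simp add: algebra_simps add_eq_0_iff)
  then have "cmod (?s - semicircle_stieltjes v w) * (v * Im ?s + Im w) \<le> cmod ((w - z) * ?s)"
    using semicircle_stieltjes_stable[OF w, of ?s] by simp
  moreover have "cmod (?s - semicircle_stieltjes v w) * Im w \<le> cmod (?s - semicircle_stieltjes v w) * (v * Im ?s + Im w)"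
    using v semicircle_stieltjes(1)[OF z] by (intro mult_left_mono) auto
  moreover have "cmod ((w - z) * ?s) \<le> cmod (z - w) * (1 / sqrt v)"
    unfolding norm_mult norm_minus_commute[of w] by (intro mult_left_mono cmod_semicircle_stieltjes_le z) auto
  ultimately have "cmod (?s - semicircle_stieltjes v w) * Im w \<le> cmod (z - w) * (1 / sqrt v)" by linarith
  then show ?thesis using v w by (simp add: field_simps)
qed

lemma tendsto_semicircle_of_quadratic:
  fixes s :: "nat \<Rightarrow> complex"
  assumes z: "Im z > 0" and s: "\<And>n. Im (s n) \<ge> 0"
    and lim: "(\<lambda>n. 1 + z * s n + of_real v * (s n)\<^sup>2) \<longlonglongrightarrow> 0"
  shows "s \<longlonglongrightarrow> semicircle_stieltjes v z"
proof -
  have "(\<lambda>n. s n - semicircle_stieltjes v z) \<longlonglongrightarrow> 0"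
  proof (rule Lim_null_comparison)
    show "\<forall>\<^sub>F n in sequentially. norm (s n - semicircle_stieltjes v z) \<le> cmod (1 + z * s n + of_real v * (s n)\<^sup>2) / Im z"
    proof (intro always_eventually allI)
      fix n
      have "cmod (s n - semicircle_stieltjes v z) * Im z \<le> cmod (s n - semicircle_stieltjes v z) * (v * Im (s n) + Im z)"
        using v s by (intro mult_left_mono) auto
      with semicircle_stieltjes_stable[OF z, of "s n"]
      have "cmod (s n - semicircle_stieltjes v z) * Im z \<le> cmod (1 + z * s n + of_real v * (s n)\<^sup>2)" by linarith
      then show "norm (s n - semicircle_stieltjes v z) \<le> cmod (1 + z * s n + of_real v * (s n)\<^sup>2) / Im z"
        using z by (simp add: field_simps)
    qed
    show "(\<lambda>n. cmod (1 + z * s n + of_real v * (s n)\<^sup>2) / Im z) \<longlonglongrightarrow> 0"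
      using tendsto_divide[OF tendsto_norm_zero[OF lim] tendsto_const[of "Im z"]] z by simp
  qed
  then show ?thesis by (simp add: LIM_zero_iff)
qed

text \<open>For \<open>x^2 < 4 v\<close> the explicit root at \<open>x\<close> lies in the open
  upper half plane, so stability applies with a denominator that does not degenerate as
  \<open>e\<close> tends to \<open>0\<close>. Otherwise both roots \<open>r1\<close>,
  \<open>r2\<close> are real and \<open>(Im m)^2 \<le> |m - r1| |m - r2| = e |m| / v\<close> tends
  to \<open>0\<close>, whichever root is approached; the edges, with \<open>r1 = r2\<close>, are
  included.\<close>

lemma Im_semicircle_stieltjes_boundary:
  "((\<lambda>e. Im (semicircle_stieltjes v (Complex x e))) \<longlongrightarrow>
    pi * (1 / (2 * pi * v) * sqrt (4 * v - x\<^sup>2) * indicator {- 2 * sqrt v..2 * sqrt v} x)) (at_right 0)"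
proof -
  let ?S = "\<lambda>e. semicircle_stieltjes v (Complex x e)"
  have pos: "\<forall>\<^sub>F e in at_right (0 :: real). e > 0" by (simp add: eventually_at_right_less)
  have ind: "x \<in> {- 2 * sqrt v..2 * sqrt v} \<longleftrightarrow> x\<^sup>2 \<le> 4 * v"
  proof -
    have "x\<^sup>2 \<le> 4 * v \<longleftrightarrow> \<bar>x\<bar> \<le> \<bar>2 * sqrt v\<bar>"
      unfolding abs_le_square_iff using v by (simp add: power_mult_distrib)
    then show ?thesis using v by (auto simp: abs_le_iff)
  qed
  show ?thesis
  proof (cases "x\<^sup>2 < 4 * v")
    case True
    define m0 where "m0 = Complex (- x / (2 * v)) (sqrt (4 * v - x\<^sup>2) / (2 * v))"
    have im: "Im m0 > 0" using True v by (simp add: m0_def)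
    have "of_real v * m0\<^sup>2 + of_real x * m0 + 1 = 0"
    proof (rule complex_eqI)
      show "Re (of_real v * m0\<^sup>2 + of_real x * m0 + 1) = Re 0"
        using True v by (simp add: m0_def power2_eq_square field_simps)
      show "Im (of_real v * m0\<^sup>2 + of_real x * m0 + 1) = Im 0"
        using v by (simp add: m0_def power2_eq_square field_simps)
    qed
    \<comment> \<open>\<open>m0\<close> solves the equation exactly at height \<open>0\<close>, so
      at height \<open>e\<close> its defect is \<open>\<i> e m0\<close>.\<close>
    then have q: "1 + Complex x e * m0 + of_real v * m0\<^sup>2 = \<i> * of_real e * m0" for e
      by (simp add: Complex_eq algebra_simps add_eq_0_iff)
    have "((\<lambda>e. m0 - ?S e) \<longlongrightarrow> 0) (at_right 0)"
    proof (rule Lim_null_comparison)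
      show "\<forall>\<^sub>F e in at_right 0. norm (m0 - ?S e) \<le> e * (cmod m0 / (v * Im m0))"
        using pos
      proof eventually_elim
        case (elim e)
        have "cmod (m0 - ?S e) * (v * Im m0) \<le> cmod (m0 - ?S e) * (v * Im m0 + e)"
          using elim by (intro mult_left_mono) auto
        also have "\<dots> \<le> e * cmod m0"
          using semicircle_stieltjes_stable[of "Complex x e" m0] elim q[of e] by (simp add: norm_mult)
        finally show ?case using v im by (simp add: field_simps)
      qed
      show "((\<lambda>e. e * (cmod m0 / (v * Im m0))) \<longlongrightarrow> 0) (at_right 0)"
        by (rule tendsto_eq_intros | simp)+
    qed
    then have "((\<lambda>e. m0 - (m0 - ?S e)) \<longlongrightarrow> m0 - 0) (at_right 0)" by (intro tendsto_intros)
    then have "((\<lambda>e. Im (?S e)) \<longlongrightarrow> Im m0) (at_right 0)" by (intro tendsto_Im) simp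
    moreover have "Im m0 = pi * (1 / (2 * pi * v) * sqrt (4 * v - x\<^sup>2) * indicator {- 2 * sqrt v..2 * sqrt v} x)"
      using True ind by (simp add: m0_def)
    ultimately show ?thesis by simp
  next
    case False
    define d where "d = sqrt (x\<^sup>2 - 4 * v)"
    have d2: "d\<^sup>2 = x\<^sup>2 - 4 * v" using False by (simp add: d_def)
    define r1 r2 where "r1 = (- x + d) / (2 * v)" and "r2 = (- x - d) / (2 * v)"
    have "((\<lambda>e. Im (?S e)) \<longlongrightarrow> 0) (at_right 0)"
    proof (rule Lim_null_comparison)
      show "\<forall>\<^sub>F e in at_right 0. norm (Im (?S e)) \<le> sqrt (e * (1 / sqrt v / v))"
        using pos
      proof eventually_elim
        case (elim e)
        define m where "m = ?S e"
        have root: "of_real v * m\<^sup>2 + Complex x e * m + 1 = 0"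
          unfolding m_def using semicircle_stieltjes(2)[of "Complex x e"] elim by simp
        have sum: "v * (r1 + r2) = - x" using v by (simp add: r1_def r2_def field_simps)
        have "v * (r1 * r2) = (x\<^sup>2 - d\<^sup>2) / (4 * v)"
          using v by (simp add: r1_def r2_def field_simps power2_eq_square)
        then have prod: "v * (r1 * r2) = 1" using v d2 by simp
        have "of_real v * ((m - of_real r1) * (m - of_real r2)) = of_real v * m\<^sup>2 - of_real (v * (r1 + r2)) * m + of_real (v * (r1 * r2))"
          by (simp add: algebra_simps power2_eq_square)
        also have "\<dots> = of_real v * m\<^sup>2 + of_real x * m + 1" unfolding sum prod by simp
        also have "\<dots> = (of_real v * m\<^sup>2 + Complex x e * m + 1) - \<i> * of_real e * m"
          by (simp add: Complex_eq algebra_simps)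
        also have "\<dots> = - \<i> * of_real e * m" unfolding root by simp
        finally have "v * (cmod (m - of_real r1) * cmod (m - of_real r2)) = e * cmod m"
          using v elim by (metis (no_types, lifting) abs_of_pos norm_mult norm_of_real norm_ii norm_minus_cancel mult_1 mult_minus_left)
        moreover have "(Im m)\<^sup>2 \<le> cmod (m - of_real r1) * cmod (m - of_real r2)"
        proof -
          have "\<bar>Im m\<bar> * \<bar>Im m\<bar> \<le> cmod (m - of_real r1) * cmod (m - of_real r2)"
            using abs_Im_le_cmod[of "m - of_real r1"] abs_Im_le_cmod[of "m - of_real r2"]
            by (intro mult_mono) auto
          then show ?thesis by (simp add: power2_eq_square)
        qed
        ultimately have "v * (Im m)\<^sup>2 \<le> e * cmod m" using v by (metis mult_left_mono less_imp_le)
        also have "\<dots> \<le> e * (1 / sqrt v)" using elim unfolding m_def by (intro mult_left_mono cmod_semicircle_stieltjes_le) auto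
        finally have "(Im m)\<^sup>2 \<le> e * (1 / sqrt v / v)" using v by (simp add: field_simps)
        then have "sqrt ((Im m)\<^sup>2) \<le> sqrt (e * (1 / sqrt v / v))" by (rule real_sqrt_le_mono)
        then show ?case by (simp add: m_def)
      qed
      show "((\<lambda>e. sqrt (e * (1 / sqrt v / v))) \<longlongrightarrow> 0) (at_right 0)"
        by (rule tendsto_eq_intros | simp)+
    qed
    moreover have "sqrt (4 * v - x\<^sup>2) * indicator {- 2 * sqrt v..2 * sqrt v} x = 0"
      using False ind by (cases "x\<^sup>2 = 4 * v") (auto simp: indicator_def)
    then have "pi * (1 / (2 * pi * v) * sqrt (4 * v - x\<^sup>2) * indicator {- 2 * sqrt v..2 * sqrt v} x) = 0"
      by (simp add: mult.assoc del: mult_eq_0_iff)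
    ultimately show ?thesis by (simp only:)
  qed
qed

end

section \<open>The semicircle law for Stieltjes transforms\<close>

text \<open>Describes one Fourier block: real coefficients \<open>c\<close> and arrays whose upper
  triangles are jointly independent over all \<open>r\<close>, \<open>i\<close>, \<open>j\<close>.
  The Hermitian symmetry is built into \<open>wigner_comb\<close>, which reconstructs the matrix
  from the upper triangle.\<close>

locale wigner_family = prob_space M for M :: "'a measure" +
  fixes R :: "'r set" and c :: "'r \<Rightarrow> real" and X :: "'r \<Rightarrow> nat \<Rightarrow> nat \<Rightarrow> 'a \<Rightarrow> complex"
  assumes finite_R: "finite R"
    and random_variable_X: "\<And>r i j. r \<in> R \<Longrightarrow> random_variable borel (X r i j)"
    and indep: "indep_vars (\<lambda>_. borel) (\<lambda>(r, i, j). X r i j) {(r, i, j). r \<in> R \<and> i \<le> j}"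
    and distr_offdiag: "\<And>r i j. r \<in> R \<Longrightarrow> i < j \<Longrightarrow> distr M borel (X r i j) = distr M borel (X r 0 1)"
    and distr_diag: "\<And>r i. r \<in> R \<Longrightarrow> distr M borel (X r i i) = distr M borel (X r 0 0)"
    and integrable_X01: "\<And>r. r \<in> R \<Longrightarrow> integrable M (X r 0 1)"
    and mean_X01: "\<And>r. r \<in> R \<Longrightarrow> expectation (X r 0 1) = 0"
    and integrable_X01_sq: "\<And>r. r \<in> R \<Longrightarrow> integrable M (\<lambda>\<omega>. (cmod (X r 0 1 \<omega>))\<^sup>2)"
    and variance_X01: "\<And>r. r \<in> R \<Longrightarrow> expectation (\<lambda>\<omega>. (cmod (X r 0 1 \<omega>))\<^sup>2) = 1"
begin

definition entries :: "'a \<Rightarrow> 'r \<times> nat \<times> nat \<Rightarrow> complex" where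
  "entries \<omega> = (\<lambda>(r, i, j). X r i j \<omega>)"

definition W :: "nat \<Rightarrow> 'a \<Rightarrow> nat \<Rightarrow> nat \<Rightarrow> complex" where
  "W n \<omega> = wigner_comb R c n (entries \<omega>)"

lemma hermitian_W: "hermitian_on m (W n \<omega>)"
  unfolding W_def by (rule hermitian_wigner_comb)

lemma borel_measurable_entries: "r \<in> R \<Longrightarrow> (\<lambda>\<omega>. entries \<omega> (r, i, j)) \<in> borel_measurable M"
  using random_variable_X by (simp add: entries_def)

lemma borel_measurable_W: "i < n \<Longrightarrow> j < n \<Longrightarrow> (\<lambda>\<omega>. W n \<omega> i j) \<in> borel_measurable M"
  unfolding W_def by (rule borel_measurable_wigner_comb) (rule borel_measurable_entries)

lemma borel_measurable_stieltjes_W [measurable]: "(\<lambda>\<omega>. stieltjes n (W n \<omega>) z) \<in> borel_measurable M"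
  by (rule borel_measurable_stieltjes) (rule borel_measurable_W)

lemma integrable_stieltjes_W: "Im z > 0 \<Longrightarrow> integrable M (\<lambda>\<omega>. stieltjes n (W n \<omega>) z)"
  by (rule integrable_const_bound[where B = "1 / Im z"])
     (auto intro!: cmod_stieltjes_le hermitian_W)

text \<open>Group \<open>K b\<close> consists of all coordinates with larger index \<open>b\<close>.
  The \<open>n\<close> groups are independent, and changing one of them changes a single row and
  column, hence moves the value by at most \<open>2 / (n Im z)\<close>. McDiarmid's denominator
  \<open>2 n (2 / (n Im z))^2\<close> equals \<open>8 / (n (Im z)^2)\<close>. Real and imaginary
  parts are separated because the inequality is for real functions.\<close>

lemma stieltjes_concentration:
  fixes u :: "complex \<Rightarrow> real"
  assumes z: "Im z > 0" and n: "n > 0" and e: "e > 0" and u: "u = Re \<or> u = Im"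
  defines "Y \<equiv> \<lambda>\<omega>. u (stieltjes n (W n \<omega>) z)"
  shows "prob {\<omega> \<in> space M. \<bar>Y \<omega> - expectation Y\<bar> \<ge> e} \<le> 2 * exp (- (e\<^sup>2 * (Im z)\<^sup>2 / 8)) ^ n"
proof -
  define K where "K b = {(r, a, b') | r a b'. r \<in> R \<and> a \<le> b \<and> b' = b}" for b :: nat
  define N where "N b = Pi\<^sub>M (K b) (\<lambda>_. borel :: complex measure)" for b
  define row where "row b \<omega> = (\<lambda>k\<in>K b. entries \<omega> k)" for b \<omega>
  define f where "f \<rho> = u (stieltjes n (wigner_comb R c n (\<lambda>(r, a, b). \<rho> b (r, a, b))) z)" for \<rho>
  have u_diff: "u x - u y = u (x - y)" and u_le: "\<bar>u x\<bar> \<le> cmod x" for x y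
    using u abs_Re_le_cmod abs_Im_le_cmod by auto
  have u_meas: "u \<in> borel_measurable borel" using u by auto
  have row: "random_variable (N b) (row b)" for b
    unfolding N_def row_def by (rule measurable_restrict) (auto simp: K_def intro!: borel_measurable_entries)
  have "indep_vars (\<lambda>b. Pi\<^sub>M (K b) (\<lambda>_. borel)) (\<lambda>b \<omega>. \<lambda>k\<in>K b. (case k of (r, i, j) \<Rightarrow> X r i j) \<omega>) {..<n}"
    by (rule indep_vars_restrict[OF indep]) (auto simp: K_def disjoint_family_on_def)
  also have "(\<lambda>b \<omega>. \<lambda>k\<in>K b. (case k of (r, i, j) \<Rightarrow> X r i j) \<omega>) = row"
    by (intro ext) (auto simp: row_def entries_def restrict_def split: prod.splits)
  finally have ind: "indep_vars N row {..<n}" by (simp add: N_def[abs_def])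
  have comp: "(\<lambda>\<rho>. \<rho> b (r, a, b)) \<in> borel_measurable (Pi\<^sub>M {..<n} N)" if "r \<in> R" "a \<le> b" "b < n" for r a b
  proof -
    have "(\<lambda>\<rho>. \<rho> b) \<in> measurable (Pi\<^sub>M {..<n} N) (N b)" using that by (intro measurable_component_singleton) auto
    moreover have "(\<lambda>x. x (r, a, b)) \<in> measurable (N b) borel"
      unfolding N_def using that by (intro measurable_component_singleton) (auto simp: K_def)
    ultimately show ?thesis by (rule measurable_compose)
  qed
  have f: "f \<in> borel_measurable (Pi\<^sub>M {..<n} N)"
    unfolding f_def
    by (intro measurable_compose[OF _ u_meas] borel_measurable_stieltjes borel_measurable_wigner_comb) (auto intro: comp)
  have eq: "f (\<lambda>b\<in>{..<n}. row b \<omega>) = Y \<omega>" for \<omega>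
  proof -
    have "resolvent n (wigner_comb R c n (\<lambda>(r, a, b). (\<lambda>b\<in>{..<n}. row b \<omega>) b (r, a, b))) z = resolvent n (W n \<omega>) z"
      unfolding W_def by (intro resolvent_cong wigner_comb_cong) (auto simp: row_def K_def)
    then show ?thesis by (simp add: f_def Y_def stieltjes_def)
  qed
  have "prob {\<omega> \<in> space M. \<bar>Y \<omega> - expectation Y\<bar> \<ge> e} \<le> 2 * exp (- (e\<^sup>2 / (2 * real (card {..<n}) * (2 / (Im z * n))\<^sup>2)))"
    unfolding eq[symmetric]
  proof (rule mcdiarmid[OF _ _ _ e row ind f])
    show "\<bar>f x\<bar> \<le> 1 / Im z" for x
      unfolding f_def using u_le cmod_stieltjes_le[OF hermitian_wigner_comb z] by (rule order_trans)
    fix x i y assume i: "i \<in> {..<n}"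
    let ?A = "wigner_comb R c n (\<lambda>(r, a, b). x b (r, a, b))"
    let ?B = "wigner_comb R c n (\<lambda>(r, a, b). (x(i := y)) b (r, a, b))"
    have "cmod ((\<Sum>i<n. resolvent n ?A z i i) - (\<Sum>i<n. resolvent n ?B z i i)) \<le> 2 / Im z"
      by (rule trace_resolvent_row_change[OF hermitian_wigner_comb hermitian_wigner_comb z, of i])
         (use i in \<open>auto intro!: wigner_comb_cong\<close>)
    then have "cmod (stieltjes n ?A z - stieltjes n ?B z) \<le> 2 / Im z / n"
      unfolding stieltjes_def diff_divide_distrib[symmetric] norm_divide norm_of_nat
      by (rule divide_right_mono) simp
    then have "cmod (stieltjes n ?A z - stieltjes n ?B z) \<le> 2 / (Im z * n)" by (simp only: divide_divide_eq_left)
    then show "\<bar>f x - f (x(i := y))\<bar> \<le> 2 / (Im z * n)"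
      unfolding f_def u_diff by (rule order_trans[OF u_le])
  qed (use n z in auto)
  also have "e\<^sup>2 / (2 * real (card {..<n}) * (2 / (Im z * n))\<^sup>2) = real n * (e\<^sup>2 * (Im z)\<^sup>2 / 8)"
    using n z by (simp add: field_simps power2_eq_square)
  also have "exp (- (real n * (e\<^sup>2 * (Im z)\<^sup>2 / 8))) = exp (- (e\<^sup>2 * (Im z)\<^sup>2 / 8)) ^ n"
    by (simp add: exp_of_nat_mult[symmetric])
  finally show ?thesis .
qed

text \<open>The tail bounds are geometric in \<open>n\<close>, so Borel-Cantelli applies for each
  accuracy \<open>1 / (m + 1)\<close>. Matrices of different sizes share entries, so only
  summability is available, not independence in \<open>n\<close>.\<close>

lemma AE_stieltjes_minus_expectation:
  assumes z: "Im z > 0"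
  shows "AE \<omega> in M. (\<lambda>n. stieltjes n (W n \<omega>) z - expectation (\<lambda>\<omega>. stieltjes n (W n \<omega>) z)) \<longlonglongrightarrow> 0"
proof -
  let ?s = "\<lambda>n \<omega>. stieltjes n (W n \<omega>) z"
  have *: "AE \<omega> in M. (\<lambda>n. u (?s n \<omega>) - expectation (\<lambda>\<omega>. u (?s n \<omega>))) \<longlonglongrightarrow> 0" if u: "u = Re \<or> u = Im" for u
  proof -
    let ?Y = "\<lambda>n \<omega>. u (?s n \<omega>)"
    have u_meas [measurable]: "u \<in> borel_measurable borel" using u by auto
    have "AE \<omega> in M. \<forall>\<^sub>F n in sequentially. \<bar>?Y n \<omega> - expectation (?Y n)\<bar> < 1 / real (Suc m)" for m
    proof -
      define e where "e = 1 / real (Suc m)"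
      have e: "e > 0" by (simp add: e_def)
      have "AE \<omega> in M. \<forall>\<^sub>F n in sequentially. \<omega> \<in> space M - {\<omega> \<in> space M. \<bar>?Y n \<omega> - expectation (?Y n)\<bar> \<ge> e}"
      proof (rule borel_cantelli_AE1)
        have "summable (\<lambda>n. 2 * exp (- (e\<^sup>2 * (Im z)\<^sup>2 / 8)) ^ n)"
          using e z by (intro summable_mult summable_geometric) auto
        then show "summable (\<lambda>n. prob {\<omega> \<in> space M. \<bar>?Y n \<omega> - expectation (?Y n)\<bar> \<ge> e})"
          by (rule summable_comparison_test_ev[rotated])
             (use stieltjes_concentration[OF z _ e u] in \<open>auto intro!: eventually_sequentiallyI[of 1]\<close>)
      qed (simp_all add: emeasure_eq_measure)
      then show ?thesis
        by eventually_elim (auto elim!: eventually_mono simp: e_def not_le)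
    qed
    then have "AE \<omega> in M. \<forall>m. \<forall>\<^sub>F n in sequentially. \<bar>?Y n \<omega> - expectation (?Y n)\<bar> < 1 / real (Suc m)"
      by (simp add: AE_all_countable)
    then show ?thesis
    proof eventually_elim
      case (elim \<omega>)
      show ?case
      proof (rule tendstoI)
        fix e :: real assume "e > 0"
        then obtain m where m: "1 / real (Suc m) < e" using nat_approx_posE by blast
        show "\<forall>\<^sub>F n in sequentially. dist (?Y n \<omega> - expectation (?Y n)) 0 < e"
          using elim[rule_format, of m] by eventually_elim (use m in auto)
      qed
    qed
  qed
  show ?thesis using *[OF disjI1[OF refl]] *[OF disjI2[OF refl]]
  proof eventually_elim
    case (elim \<omega>)
    show ?case
      unfolding tendsto_complex_iff using elim integrable_stieltjes_W[OF z]
      by (simp add: integral_Re integral_Im)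
  qed
qed

lemma expectation_offdiag:
  fixes \<phi> :: "complex \<Rightarrow> 'b::{banach, second_countable_topology}"
  assumes "\<phi> \<in> borel_measurable borel" "r \<in> R" "i < j"
  shows "expectation (\<lambda>\<omega>. \<phi> (X r i j \<omega>)) = expectation (\<lambda>\<omega>. \<phi> (X r 0 1 \<omega>))"
    and "integrable M (\<lambda>\<omega>. \<phi> (X r i j \<omega>)) \<longleftrightarrow> integrable M (\<lambda>\<omega>. \<phi> (X r 0 1 \<omega>))"
  using integral_distr[OF random_variable_X assms(1)] integrable_distr_eq[OF random_variable_X assms(1)]
    distr_offdiag[OF assms(2,3)] assms(2) by metis+

lemma expectation_diag:
  fixes \<phi> :: "complex \<Rightarrow> 'b::{banach, second_countable_topology}"
  assumes "\<phi> \<in> borel_measurable borel" "r \<in> R"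
  shows "expectation (\<lambda>\<omega>. \<phi> (X r i i \<omega>)) = expectation (\<lambda>\<omega>. \<phi> (X r 0 0 \<omega>))"
  using integral_distr[OF random_variable_X assms(1)] distr_diag[OF assms(2)] assms(2) by metis

section \<open>Removing the diagonal and a single random variable\<close>

definition W0 :: "nat \<Rightarrow> 'a \<Rightarrow> nat \<Rightarrow> nat \<Rightarrow> complex" where
  "W0 n \<omega> = wigner_comb R c n (\<lambda>(r, i, j). if i = j then 0 else X r i j \<omega>)"

text \<open>Only the contribution of array \<open>r\<close> at \<open>(a, b)\<close> is deleted;
  other arrays still contribute there. What is split off is thus a single coordinate of the
  independent family.\<close>

definition W0_del :: "'r \<Rightarrow> nat \<Rightarrow> nat \<Rightarrow> nat \<Rightarrow> 'a \<Rightarrow> nat \<Rightarrow> nat \<Rightarrow> complex" where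
  "W0_del r a b n \<omega> = wigner_comb R c n (\<lambda>(r', i, j). if i = j \<or> (r', i, j) = (r, a, b) then 0 else X r' i j \<omega>)"

lemma hermitian_W0: "hermitian_on m (W0 n \<omega>)"
  unfolding W0_def by (rule hermitian_wigner_comb)

lemma hermitian_W0_del: "hermitian_on m (W0_del r a b n \<omega>)"
  unfolding W0_del_def by (rule hermitian_wigner_comb)

lemma W0_eq: "W0 n \<omega> i j = (if i = j then 0 else W n \<omega> i j)"
  unfolding W0_def W_def wigner_comb_def entries_def by simp

lemma borel_measurable_W0: "i < n \<Longrightarrow> j < n \<Longrightarrow> (\<lambda>\<omega>. W0 n \<omega> i j) \<in> borel_measurable M"
  unfolding W0_def by (rule borel_measurable_wigner_comb) (auto intro!: borel_measurable_if_const random_variable_X)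

lemma borel_measurable_W0_del:
  "i < n \<Longrightarrow> j < n \<Longrightarrow> (\<lambda>\<omega>. W0_del r a b n \<omega> i j) \<in> borel_measurable M"
  unfolding W0_del_def by (rule borel_measurable_wigner_comb) (auto intro!: borel_measurable_if_const random_variable_X)

lemma W0_W0_del:
  assumes r: "r \<in> R" and ab: "a < b"
  shows "W0 n \<omega> i j = W0_del r a b n \<omega> i j
    + (if i = a \<and> j = b then of_real (c r / sqrt n) * X r a b \<omega>
       else if i = b \<and> j = a then cnj (of_real (c r / sqrt n) * X r a b \<omega>) else 0)"
proof -
  have sum: "(\<Sum>r'\<in>R. of_real (c r') * (if r' = r then 0 else X r' a b \<omega>)) + of_real (c r) * X r a b \<omega>
      = (\<Sum>r'\<in>R. of_real (c r') * X r' a b \<omega>)"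
    using r finite_R
    by (subst (1 2) sum.remove[of R r]) (auto intro!: sum.cong)
  show ?thesis
  proof (cases "(i = a \<and> j = b) \<or> (i = b \<and> j = a)")
    case True
    then show ?thesis
    proof
      assume "i = a \<and> j = b"
      then show ?thesis using ab
        by (simp add: W0_def W0_del_def wigner_comb_def sum[symmetric] add_divide_distrib)
    next
      assume "i = b \<and> j = a"
      then show ?thesis using ab arg_cong[OF sum, of cnj]
        by (simp add: W0_def W0_del_def wigner_comb_def add_divide_distrib[symmetric] del: cnj_sum)
    qed
  next
    case False
    then show ?thesis using ab
      by (auto simp: W0_def W0_del_def wigner_comb_def intro!: sum.cong)
  qed
qed

text \<open>\<open>W0_del r a b n\<close> is a function of the coordinates other than
  \<open>(r, a, b)\<close>, so \<open>\<Psi>\<close> of it is independent of \<open>X r a b\<close>.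
  Measurability of \<open>\<Psi>\<close> is expressed along measurable families of matrices, which
  spares a measurable structure on matrix functions.\<close>

lemma expectation_mult_W0_del:
  fixes \<phi> :: "complex \<Rightarrow> complex" and \<Psi> :: "(nat \<Rightarrow> nat \<Rightarrow> complex) \<Rightarrow> complex"
  assumes r: "r \<in> R" and ab: "a < b" and \<phi>: "\<phi> \<in> borel_measurable borel"
    and int: "integrable M (\<lambda>\<omega>. \<phi> (X r a b \<omega>))"
    and \<Psi>: "\<And>F :: ('r \<times> nat \<times> nat \<Rightarrow> complex) \<Rightarrow> nat \<Rightarrow> nat \<Rightarrow> complex. \<And>N.
      (\<And>i j. i < n \<Longrightarrow> j < n \<Longrightarrow> (\<lambda>\<rho>. F \<rho> i j) \<in> borel_measurable N) \<Longrightarrow> (\<lambda>\<rho>. \<Psi> (F \<rho>)) \<in> borel_measurable N"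
    and \<Psi>_cong: "\<And>A B. (\<And>i j. i < n \<Longrightarrow> j < n \<Longrightarrow> A i j = B i j) \<Longrightarrow> \<Psi> A = \<Psi> B"
    and int\<Psi>: "integrable M (\<lambda>\<omega>. \<Psi> (W0_del r a b n \<omega>))"
  shows "expectation (\<lambda>\<omega>. \<phi> (X r a b \<omega>) * \<Psi> (W0_del r a b n \<omega>)) =
    expectation (\<lambda>\<omega>. \<phi> (X r a b \<omega>)) * expectation (\<lambda>\<omega>. \<Psi> (W0_del r a b n \<omega>))"
proof -
  let ?I = "{(r, i, j). r \<in> R \<and> i \<le> j}"
  let ?k = "(r, a, b)"
  let ?N = "Pi\<^sub>M (?I - {?k}) (\<lambda>_. borel :: complex measure)"
  let ?F = "\<lambda>\<rho>. wigner_comb R c n (\<lambda>(r', i, j). if i = j \<or> (r', i, j) = (r, a, b) then 0 else \<rho> (r', i, j))"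
  have comp: "(\<lambda>\<rho>. \<rho> (r', i, j)) \<in> borel_measurable ?N" if "r' \<in> R" "i \<le> j" "(r', i, j) \<noteq> ?k" for r' i j
    using that by (intro measurable_component_singleton) auto
  have "(\<lambda>\<rho>. \<Psi> (?F \<rho>)) \<in> borel_measurable ?N"
  proof (rule \<Psi>)
    fix i j assume ij: "i < n" "j < n"
    show "(\<lambda>\<rho>. ?F \<rho> i j) \<in> borel_measurable ?N"
    proof (rule borel_measurable_wigner_comb[OF _ ij])
      fix r' a' b' assume *: "r' \<in> R" "a' \<le> b'" "b' < n"
      show "(\<lambda>\<rho>. case (r', a', b') of (r', i, j) \<Rightarrow> if i = j \<or> (r', i, j) = (r, a, b) then 0 else \<rho> (r', i, j))
        \<in> borel_measurable ?N"
        unfolding prod.case by (intro borel_measurable_if_const comp *) auto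
    qed
  qed
  moreover have "(\<lambda>\<rho>. \<phi> (\<rho> ?k)) \<in> borel_measurable (Pi\<^sub>M {?k} (\<lambda>_. borel))"
    by (rule measurable_compose[OF _ \<phi>], rule measurable_component_singleton) simp
  moreover have "indep_var (Pi\<^sub>M {?k} (\<lambda>_. borel)) (\<lambda>\<omega>. \<lambda>k\<in>{?k}. (case k of (r, i, j) \<Rightarrow> X r i j) \<omega>)
      ?N (\<lambda>\<omega>. \<lambda>k\<in>?I - {?k}. (case k of (r, i, j) \<Rightarrow> X r i j) \<omega>)"
    by (rule indep_var_restrict[OF indep]) (use r ab in auto)
  ultimately have iv: "indep_var borel ((\<lambda>\<rho>. \<phi> (\<rho> ?k)) \<circ> (\<lambda>\<omega>. \<lambda>k\<in>{?k}. (case k of (r, i, j) \<Rightarrow> X r i j) \<omega>))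
      borel ((\<lambda>\<rho>. \<Psi> (?F \<rho>)) \<circ> (\<lambda>\<omega>. \<lambda>k\<in>?I - {?k}. (case k of (r, i, j) \<Rightarrow> X r i j) \<omega>))"
    by (intro indep_var_compose)
  have 1: "(\<lambda>\<rho>. \<phi> (\<rho> ?k)) \<circ> (\<lambda>\<omega>. \<lambda>k\<in>{?k}. (case k of (r, i, j) \<Rightarrow> X r i j) \<omega>) = (\<lambda>\<omega>. \<phi> (X r a b \<omega>))"
    by (simp add: comp_def)
  have 2: "(\<lambda>\<rho>. \<Psi> (?F \<rho>)) \<circ> (\<lambda>\<omega>. \<lambda>k\<in>?I - {?k}. (case k of (r, i, j) \<Rightarrow> X r i j) \<omega>) = (\<lambda>\<omega>. \<Psi> (W0_del r a b n \<omega>))"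
    unfolding comp_def W0_del_def
    by (intro ext \<Psi>_cong wigner_comb_cong) auto
  show ?thesis
    using indep_var_lebesgue_integral[OF iv[unfolded 1 2] int int\<Psi>] .
qed

lemma integrable_offdiag:
  assumes "r \<in> R" "i < j"
  shows "integrable M (X r i j)" and "integrable M (\<lambda>\<omega>. (cmod (X r i j \<omega>))\<^sup>2)"
    and "expectation (X r i j) = 0" and "expectation (\<lambda>\<omega>. (cmod (X r i j \<omega>))\<^sup>2) = 1"
    and "expectation (\<lambda>\<omega>. cmod (X r i j \<omega>)) \<le> 1"
proof -
  show int: "integrable M (X r i j)"
    using expectation_offdiag(2)[of "\<lambda>x. x", OF _ assms] integrable_X01[OF assms(1)] by simp
  show int2: "integrable M (\<lambda>\<omega>. (cmod (X r i j \<omega>))\<^sup>2)"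
    using expectation_offdiag(2)[of "\<lambda>x. (cmod x)\<^sup>2", OF _ assms] integrable_X01_sq[OF assms(1)] by simp
  show "expectation (X r i j) = 0"
    using expectation_offdiag(1)[of "\<lambda>x. x", OF _ assms] mean_X01[OF assms(1)] by simp
  show v: "expectation (\<lambda>\<omega>. (cmod (X r i j \<omega>))\<^sup>2) = 1"
    using expectation_offdiag(1)[of "\<lambda>x. (cmod x)\<^sup>2", OF _ assms] variance_X01[OF assms(1)] by simp
  have "expectation (\<lambda>\<omega>. cmod (X r i j \<omega>)) \<le> expectation (\<lambda>\<omega>. (1 + (cmod (X r i j \<omega>))\<^sup>2) / 2)"
  proof (rule integral_mono)
    fix \<omega>
    show "cmod (X r i j \<omega>) \<le> (1 + (cmod (X r i j \<omega>))\<^sup>2) / 2"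
      using sum_squares_bound[of 1 "cmod (X r i j \<omega>)"] by simp
  qed (use int int2 in auto)
  also have "\<dots> = 1" using int2 v by (simp add: prob_space)
  finally show "expectation (\<lambda>\<omega>. cmod (X r i j \<omega>)) \<le> 1" .
qed

text \<open>Second order expansion in a single entry \<open>h\<close>, which is independent of the resolvent \<open>H\<close> of the matrix
  with this entry removed. Bounding the remainder by \<open>\<bar>h\<bar>\<^sup>2 min 1 \<bar>h\<bar>\<close> makes truncation unnecessary.\<close>

lemma entry_expansion:
  fixes z :: complex and n a b :: nat
  assumes z: "Im z > 0" and r: "r \<in> R" and ab: "a < b" "b < n"
  defines "C \<equiv> 2 / Im z + 2 / (Im z)\<^sup>2"
    and "h \<equiv> \<lambda>\<omega>. of_real (c r / sqrt n) * X r a b \<omega>"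
    and "G \<equiv> \<lambda>\<omega>. resolvent n (W0 n \<omega>) z"
  shows "cmod (expectation (\<lambda>\<omega>. h \<omega> * G \<omega> b a + cnj (h \<omega>) * G \<omega> a b)
      + 2 * of_real ((c r)\<^sup>2 / n) * expectation (\<lambda>\<omega>. G \<omega> a a * G \<omega> b b))
    \<le> 4 / Im z * C * expectation (\<lambda>\<omega>. (cmod (h \<omega>))\<^sup>2 * min 1 (cmod (h \<omega>)))
      + (c r)\<^sup>2 / n * (expectation (\<lambda>\<omega>. (cmod (G \<omega> b a))\<^sup>2) + expectation (\<lambda>\<omega>. (cmod (G \<omega> a b))\<^sup>2)
          + 8 * C / Im z * (\<bar>c r\<bar> / sqrt n))"
proof -
  define H where "H = (\<lambda>\<omega>. resolvent n (W0_del r a b n \<omega>) z)"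
  have an: "a < n" using ab by simp
  have n: "real n > 0" using ab by simp
  note rv = random_variable_X[OF r, of a b]
  note [measurable] = rv
  note X = integrable_offdiag[OF r ab(1)]
  have C0: "0 \<le> C" using z by (simp add: C_def)
  have Gm [measurable]: "(\<lambda>\<omega>. G \<omega> i j) \<in> borel_measurable M" if "i < n" "j < n" for i j
    unfolding G_def using that by (intro borel_measurable_resolvent borel_measurable_W0)
  have Hm [measurable]: "(\<lambda>\<omega>. H \<omega> i j) \<in> borel_measurable M" if "i < n" "j < n" for i j
    unfolding H_def using that by (intro borel_measurable_resolvent borel_measurable_W0_del)
  have Gb: "cmod (G \<omega> i j) \<le> 1 / Im z" if "i < n" "j < n" for i j \<omega>
    unfolding G_def using that by (intro cmod_resolvent_le hermitian_W0 z)
  have Hb: "cmod (H \<omega> i j) \<le> 1 / Im z" if "i < n" "j < n" for i j \<omega>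
    unfolding H_def using that by (intro cmod_resolvent_le hermitian_W0_del z)
  have GGb: "cmod (G \<omega> i j * G \<omega> k l) \<le> 1 / Im z * (1 / Im z)" if "i < n" "j < n" "k < n" "l < n" for i j k l \<omega>
    unfolding norm_mult using z by (intro mult_mono Gb that) auto
  have HHb: "cmod (H \<omega> i j * H \<omega> k l) \<le> 1 / Im z * (1 / Im z)" if "i < n" "j < n" "k < n" "l < n" for i j k l \<omega>
    unfolding norm_mult using z by (intro mult_mono Hb that) auto
  have GGi: "integrable M (\<lambda>\<omega>. G \<omega> i j * G \<omega> k l)" if "i < n" "j < n" "k < n" "l < n" for i j k l
    using that by (intro integrable_const_bound[where B = "1 / Im z * (1 / Im z)"] AE_I2 GGb borel_measurable_times Gm)
  have HHi: "integrable M (\<lambda>\<omega>. H \<omega> i j * H \<omega> k l)" if "i < n" "j < n" "k < n" "l < n" for i j k l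
    using that by (intro integrable_const_bound[where B = "1 / Im z * (1 / Im z)"] AE_I2 HHb borel_measurable_times Hm)
  have Hi: "integrable M (\<lambda>\<omega>. H \<omega> i j)" if "i < n" "j < n" for i j
    using that by (intro integrable_const_bound[where B = "1 / Im z"] AE_I2 Hb Hm)
  have hm [measurable]: "h \<in> borel_measurable M" unfolding h_def by measurable
  have hi: "integrable M h" unfolding h_def using X(1) by simp
  have chi: "integrable M (\<lambda>\<omega>. cnj (h \<omega>))" using hi by simp
  have h2: "(cmod (h \<omega>))\<^sup>2 = (c r)\<^sup>2 / n * (cmod (X r a b \<omega>))\<^sup>2" for \<omega>
    unfolding h_def norm_mult norm_of_real using n by (simp add: power_mult_distrib power_divide abs_divide)
  have h2i: "integrable M (\<lambda>\<omega>. (cmod (h \<omega>))\<^sup>2)" unfolding h2 using X(2) by simp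
  have Eh2: "expectation (\<lambda>\<omega>. (cmod (h \<omega>))\<^sup>2) = (c r)\<^sup>2 / n"
    unfolding h2 using X(2,4) by simp
  have h2ci: "integrable M (\<lambda>\<omega>. complex_of_real ((cmod (h \<omega>))\<^sup>2))" using h2i by (rule integrable_of_real)
  have hsqi: "integrable M (\<lambda>\<omega>. (h \<omega>)\<^sup>2)"
    by (rule Bochner_Integration.integrable_bound[OF h2i]) (auto simp: norm_power)
  have chsqi: "integrable M (\<lambda>\<omega>. (cnj (h \<omega>))\<^sup>2)"
    using integrable_cnj[OF hsqi] by simp
  have Eh: "expectation (\<lambda>\<omega>. cmod (h \<omega>)) \<le> \<bar>c r\<bar> / sqrt n"
  proof -
    have "expectation (\<lambda>\<omega>. cmod (h \<omega>)) = \<bar>c r\<bar> / sqrt n * expectation (\<lambda>\<omega>. cmod (X r a b \<omega>))"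
      unfolding h_def norm_mult norm_of_real by (simp add: abs_divide)
    also have "\<dots> \<le> \<bar>c r\<bar> / sqrt n * 1" using X(5) by (intro mult_left_mono) auto
    finally show ?thesis by simp
  qed
  have chg: "cmod (G \<omega> i j - H \<omega> i j) \<le> C * min 1 (cmod (h \<omega>))" if "i < n" "j < n" for i j \<omega>
    unfolding G_def H_def C_def h_def
    by (rule cmod_resolvent_entry_change[OF hermitian_W0 hermitian_W0_del z an ab(2) _ W0_W0_del[OF r ab(1)]])
       (use ab that in auto)
  have chg': "cmod (G \<omega> i j - H \<omega> i j) \<le> C * cmod (h \<omega>)" if "i < n" "j < n" for i j \<omega>
    using chg[OF that] mult_left_mono[OF min.cobounded2[of 1 "cmod (h \<omega>)"] C0] by (rule order_trans)
  have prod_chg: "cmod (G \<omega> i j * G \<omega> k l - H \<omega> i j * H \<omega> k l) \<le> 2 * C / Im z * cmod (h \<omega>)"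
    if "i < n" "j < n" "k < n" "l < n" for i j k l \<omega>
  proof -
    have "G \<omega> i j * G \<omega> k l - H \<omega> i j * H \<omega> k l = G \<omega> i j * (G \<omega> k l - H \<omega> k l) + (G \<omega> i j - H \<omega> i j) * H \<omega> k l"
      by (simp add: algebra_simps)
    also have "cmod \<dots> \<le> 1 / Im z * (C * cmod (h \<omega>)) + (C * cmod (h \<omega>)) * (1 / Im z)"
      using z C0 that by (intro norm_triangle_mono) (auto simp: norm_mult simp del: times_divide_eq_left times_divide_eq_right intro!: mult_mono chg' Gb Hb)
    finally show ?thesis by (simp add: mult_ac)
  qed

  \<comment> \<open>\<open>T - T' + S + U\<close> is the quantity bounded by
    \<open>resolvent_second_order\<close>. By independence \<open>T'\<close> has mean zero;
    \<open>U\<close> carries the main term; \<open>S\<close> contains \<open>E h^2\<close>, which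
    may be nonzero.\<close>
  define T where "T = (\<lambda>\<omega>. h \<omega> * G \<omega> b a + cnj (h \<omega>) * G \<omega> a b)"
  define T' where "T' = (\<lambda>\<omega>. h \<omega> * H \<omega> b a + cnj (h \<omega>) * H \<omega> a b)"
  define S where "S = (\<lambda>\<omega>. (h \<omega>)\<^sup>2 * (H \<omega> b a * H \<omega> b a) + (cnj (h \<omega>))\<^sup>2 * (H \<omega> a b * H \<omega> a b))"
  define U where "U = (\<lambda>\<omega>. 2 * (complex_of_real ((cmod (h \<omega>))\<^sup>2) * (H \<omega> a a * H \<omega> b b)))"
  have Ti: "integrable M T" unfolding T_def
    by (intro Bochner_Integration.integrable_add integrable_mult_bounded[OF hi Gm Gb] integrable_mult_bounded[OF chi Gm Gb] an ab)
  have T'i: "integrable M T'" unfolding T'_def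
    by (intro Bochner_Integration.integrable_add integrable_mult_bounded[OF hi Hm Hb] integrable_mult_bounded[OF chi Hm Hb] an ab)
  have Si1: "integrable M (\<lambda>\<omega>. (h \<omega>)\<^sup>2 * (H \<omega> b a * H \<omega> b a))"
    and Si2: "integrable M (\<lambda>\<omega>. (cnj (h \<omega>))\<^sup>2 * (H \<omega> a b * H \<omega> a b))"
    by (rule integrable_mult_bounded[OF hsqi borel_measurable_times[OF Hm Hm] HHb]
        integrable_mult_bounded[OF chsqi borel_measurable_times[OF Hm Hm] HHb]; use an ab in simp)+
  then have Si: "integrable M S" unfolding S_def by (rule Bochner_Integration.integrable_add)
  have Ui: "integrable M U" unfolding U_def
    by (intro integrable_mult_right integrable_mult_bounded[OF h2ci borel_measurable_times[OF Hm Hm] HHb] an ab)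
  have indep1: "expectation (\<lambda>\<omega>. \<phi> (X r a b \<omega>) * H \<omega> i j) = expectation (\<lambda>\<omega>. \<phi> (X r a b \<omega>)) * expectation (\<lambda>\<omega>. H \<omega> i j)"
    if "\<phi> \<in> borel_measurable borel" "integrable M (\<lambda>\<omega>. \<phi> (X r a b \<omega>))" "i < n" "j < n" for \<phi> i j
    unfolding H_def
    by (rule expectation_mult_W0_del[OF r ab(1) that(1,2), where \<Psi> = "\<lambda>A. resolvent n A z i j"])
       (use that in \<open>auto intro!: borel_measurable_resolvent Hi[unfolded H_def] cong: resolvent_cong\<close>)
  have indep2: "expectation (\<lambda>\<omega>. \<phi> (X r a b \<omega>) * (H \<omega> i j * H \<omega> k l)) =
      expectation (\<lambda>\<omega>. \<phi> (X r a b \<omega>)) * expectation (\<lambda>\<omega>. H \<omega> i j * H \<omega> k l)"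
    if "\<phi> \<in> borel_measurable borel" "integrable M (\<lambda>\<omega>. \<phi> (X r a b \<omega>))" "i < n" "j < n" "k < n" "l < n" for \<phi> i j k l
    unfolding H_def
    by (rule expectation_mult_W0_del[OF r ab(1) that(1,2), where \<Psi> = "\<lambda>A. resolvent n A z i j * resolvent n A z k l"])
       (use that in \<open>auto intro!: borel_measurable_times borel_measurable_resolvent HHi[unfolded H_def] cong: resolvent_cong\<close>)
  have cnj_m: "cnj \<in> borel_measurable borel"
    by (intro borel_measurable_continuous_onI continuous_intros)
  note [measurable] = cnj_m
  have ET': "expectation T' = 0"
  proof -
    have 1: "expectation (\<lambda>\<omega>. h \<omega> * H \<omega> b a) = expectation h * expectation (\<lambda>\<omega>. H \<omega> b a)"
      unfolding h_def by (rule indep1) (use hi ab in \<open>auto simp: h_def\<close>)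
    have 2: "expectation (\<lambda>\<omega>. cnj (h \<omega>) * H \<omega> a b) = expectation (\<lambda>\<omega>. cnj (h \<omega>)) * expectation (\<lambda>\<omega>. H \<omega> a b)"
      unfolding h_def by (rule indep1[of "\<lambda>x. cnj (of_real (c r / sqrt n) * x)"]) (use chi ab in \<open>auto simp: h_def\<close>)
    have "expectation h = 0" unfolding h_def using X(1,3) by simp
    moreover from this have "expectation (\<lambda>\<omega>. cnj (h \<omega>)) = 0" by simp
    ultimately have "expectation (\<lambda>\<omega>. h \<omega> * H \<omega> b a) = 0" "expectation (\<lambda>\<omega>. cnj (h \<omega>) * H \<omega> a b) = 0"
      unfolding 1 2 by simp_all
    then show ?thesis unfolding T'_def
      by (subst Bochner_Integration.integral_add)
         (auto intro!: integrable_mult_bounded[OF hi Hm Hb] integrable_mult_bounded[OF chi Hm Hb] an ab)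
  qed
  have norm_sq: "cmod (expectation (\<lambda>\<omega>. g \<omega>)) \<le> (c r)\<^sup>2 / n" if "\<And>\<omega>. cmod (g \<omega>) = (cmod (h \<omega>))\<^sup>2" for g
    using integral_norm_bound[of M g] Eh2 by (simp add: that)
  \<comment> \<open>\<open>E (H i j)^2\<close> is traded for \<open>E |G i j|^2\<close>, because
    only the resolvent \<open>G\<close> of the full matrix is common to all entries and can be
    summed by the Ward identity.\<close>
  have EHH: "cmod (expectation (\<lambda>\<omega>. H \<omega> i j * H \<omega> i j)) \<le>
      expectation (\<lambda>\<omega>. (cmod (G \<omega> i j))\<^sup>2) + 2 * C / Im z * (\<bar>c r\<bar> / sqrt n)" if ij: "i < n" "j < n" for i j
  proof -
    have "cmod (expectation (\<lambda>\<omega>. H \<omega> i j * H \<omega> i j)) \<le> expectation (\<lambda>\<omega>. cmod (H \<omega> i j * H \<omega> i j))"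
      by (rule integral_norm_bound)
    also have "\<dots> \<le> expectation (\<lambda>\<omega>. cmod (G \<omega> i j * G \<omega> i j) + 2 * C / Im z * cmod (h \<omega>))"
    proof (rule integral_mono)
      fix \<omega>
      show "cmod (H \<omega> i j * H \<omega> i j) \<le> cmod (G \<omega> i j * G \<omega> i j) + 2 * C / Im z * cmod (h \<omega>)"
        using prod_chg[OF ij ij, of \<omega>] norm_triangle_ineq2[of "H \<omega> i j * H \<omega> i j" "G \<omega> i j * G \<omega> i j"]
        by (simp add: norm_minus_commute)
    qed (use GGi[OF ij ij] HHi[OF ij ij] hi in auto)
    also have "\<dots> = expectation (\<lambda>\<omega>. cmod (G \<omega> i j * G \<omega> i j)) + 2 * C / Im z * expectation (\<lambda>\<omega>. cmod (h \<omega>))"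
      using GGi[OF ij ij] hi by simp
    also have "\<dots> \<le> expectation (\<lambda>\<omega>. cmod (G \<omega> i j * G \<omega> i j)) + 2 * C / Im z * (\<bar>c r\<bar> / sqrt n)"
      using Eh C0 z by (intro add_left_mono mult_left_mono) auto
    finally show ?thesis by (simp add: norm_mult power2_eq_square)
  qed
  have ES: "cmod (expectation S) \<le> (c r)\<^sup>2 / n * (expectation (\<lambda>\<omega>. (cmod (G \<omega> b a))\<^sup>2)
      + expectation (\<lambda>\<omega>. (cmod (G \<omega> a b))\<^sup>2) + 4 * C / Im z * (\<bar>c r\<bar> / sqrt n))"
  proof -
    have 1: "expectation (\<lambda>\<omega>. (h \<omega>)\<^sup>2 * (H \<omega> b a * H \<omega> b a)) = expectation (\<lambda>\<omega>. (h \<omega>)\<^sup>2) * expectation (\<lambda>\<omega>. H \<omega> b a * H \<omega> b a)"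
      unfolding h_def
      by (rule indep2[of "\<lambda>x. (of_real (c r / sqrt n) * x)\<^sup>2"]) (use hsqi ab in \<open>auto simp: h_def\<close>)
    have 2: "expectation (\<lambda>\<omega>. (cnj (h \<omega>))\<^sup>2 * (H \<omega> a b * H \<omega> a b)) = expectation (\<lambda>\<omega>. (cnj (h \<omega>))\<^sup>2) * expectation (\<lambda>\<omega>. H \<omega> a b * H \<omega> a b)"
      unfolding h_def
      by (rule indep2[of "\<lambda>x. (cnj (of_real (c r / sqrt n) * x))\<^sup>2"]) (use chsqi ab in \<open>auto simp: h_def\<close>)
    have "cmod (expectation S) = cmod (expectation (\<lambda>\<omega>. (h \<omega>)\<^sup>2) * expectation (\<lambda>\<omega>. H \<omega> b a * H \<omega> b a)
        + expectation (\<lambda>\<omega>. (cnj (h \<omega>))\<^sup>2) * expectation (\<lambda>\<omega>. H \<omega> a b * H \<omega> a b))"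
      unfolding S_def 1[symmetric] 2[symmetric] by (subst Bochner_Integration.integral_add[OF Si1 Si2]) simp
    also have "\<dots> \<le> (c r)\<^sup>2 / n * (expectation (\<lambda>\<omega>. (cmod (G \<omega> b a))\<^sup>2) + 2 * C / Im z * (\<bar>c r\<bar> / sqrt n))
        + (c r)\<^sup>2 / n * (expectation (\<lambda>\<omega>. (cmod (G \<omega> a b))\<^sup>2) + 2 * C / Im z * (\<bar>c r\<bar> / sqrt n))"
      unfolding norm_mult[symmetric]
      by (intro norm_triangle_mono; unfold norm_mult; intro mult_mono norm_sq EHH an ab)
         (auto simp: norm_power)
    finally show ?thesis by (simp add: algebra_simps)
  qed
  have EU: "expectation U = 2 * of_real ((c r)\<^sup>2 / n) * expectation (\<lambda>\<omega>. H \<omega> a a * H \<omega> b b)"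
  proof -
    have "expectation (\<lambda>\<omega>. complex_of_real ((cmod (h \<omega>))\<^sup>2) * (H \<omega> a a * H \<omega> b b)) =
        expectation (\<lambda>\<omega>. complex_of_real ((cmod (h \<omega>))\<^sup>2)) * expectation (\<lambda>\<omega>. H \<omega> a a * H \<omega> b b)"
      unfolding h_def
      by (rule indep2[of "\<lambda>x. complex_of_real ((cmod (of_real (c r / sqrt n) * x))\<^sup>2)"]) (use h2ci ab in \<open>auto simp: h_def\<close>)
    moreover have "expectation (\<lambda>\<omega>. complex_of_real ((cmod (h \<omega>))\<^sup>2)) = of_real ((c r)\<^sup>2 / n)"
      unfolding Eh2[symmetric] by (rule integral_complex_of_real)
    ultimately show ?thesis unfolding U_def by simp
  qed
  have EHG: "cmod (expectation (\<lambda>\<omega>. G \<omega> a a * G \<omega> b b) - expectation (\<lambda>\<omega>. H \<omega> a a * H \<omega> b b)) \<le> 2 * C / Im z * (\<bar>c r\<bar> / sqrt n)"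
  proof -
    have "cmod (expectation (\<lambda>\<omega>. G \<omega> a a * G \<omega> b b) - expectation (\<lambda>\<omega>. H \<omega> a a * H \<omega> b b)) =
        cmod (expectation (\<lambda>\<omega>. G \<omega> a a * G \<omega> b b - H \<omega> a a * H \<omega> b b))"
      using GGi HHi an ab by simp
    also have "\<dots> \<le> expectation (\<lambda>\<omega>. cmod (G \<omega> a a * G \<omega> b b - H \<omega> a a * H \<omega> b b))"
      by (rule integral_norm_bound)
    also have "\<dots> \<le> expectation (\<lambda>\<omega>. 2 * C / Im z * cmod (h \<omega>))"
      by (intro integral_mono prod_chg integrable_norm Bochner_Integration.integrable_diff GGi HHi integrable_mult_right hi an ab)
    also have "\<dots> = 2 * C / Im z * expectation (\<lambda>\<omega>. cmod (h \<omega>))" by simp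
    also have "\<dots> \<le> 2 * C / Im z * (\<bar>c r\<bar> / sqrt n)" using Eh C0 z by (intro mult_left_mono) auto
    finally show ?thesis .
  qed
  have ETTSU: "cmod (expectation (\<lambda>\<omega>. T \<omega> - T' \<omega> + (S \<omega> + U \<omega>))) \<le> 4 / Im z * C * expectation (\<lambda>\<omega>. (cmod (h \<omega>))\<^sup>2 * min 1 (cmod (h \<omega>)))"
  proof -
    have "cmod (expectation (\<lambda>\<omega>. T \<omega> - T' \<omega> + (S \<omega> + U \<omega>))) \<le> expectation (\<lambda>\<omega>. cmod (T \<omega> - T' \<omega> + (S \<omega> + U \<omega>)))"
      by (rule integral_norm_bound)
    also have "\<dots> \<le> expectation (\<lambda>\<omega>. 4 / Im z * C * ((cmod (h \<omega>))\<^sup>2 * min 1 (cmod (h \<omega>))))"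
    proof (rule integral_mono)
      show "integrable M (\<lambda>\<omega>. cmod (T \<omega> - T' \<omega> + (S \<omega> + U \<omega>)))"
        using Ti T'i Si Ui by auto
      have "integrable M (\<lambda>\<omega>. (cmod (h \<omega>))\<^sup>2 * min 1 (cmod (h \<omega>)))"
        by (rule Bochner_Integration.integrable_bound[OF h2i]) (auto simp: abs_mult intro!: mult_left_le)
      then show "integrable M (\<lambda>\<omega>. 4 / Im z * C * ((cmod (h \<omega>))\<^sup>2 * min 1 (cmod (h \<omega>))))"
        by (rule integrable_mult_right)
      fix \<omega>
      show "cmod (T \<omega> - T' \<omega> + (S \<omega> + U \<omega>)) \<le> 4 / Im z * C * ((cmod (h \<omega>))\<^sup>2 * min 1 (cmod (h \<omega>)))"
        using resolvent_second_order[OF hermitian_W0 hermitian_W0_del z an ab(2) _ W0_W0_del[OF r ab(1), of n \<omega>]] ab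
        unfolding T_def T'_def S_def U_def G_def H_def C_def h_def power2_eq_square[of "resolvent _ _ _ _ _"]
        by blast
    qed
    finally show ?thesis by simp
  qed
  have "expectation (\<lambda>\<omega>. T \<omega> - T' \<omega> + (S \<omega> + U \<omega>)) = expectation T - expectation T' + (expectation S + expectation U)"
    using Ti T'i Si Ui by simp
  then have "expectation T + 2 * of_real ((c r)\<^sup>2 / n) * expectation (\<lambda>\<omega>. G \<omega> a a * G \<omega> b b) =
      expectation (\<lambda>\<omega>. T \<omega> - T' \<omega> + (S \<omega> + U \<omega>)) + (- expectation S
      + 2 * of_real ((c r)\<^sup>2 / n) * (expectation (\<lambda>\<omega>. G \<omega> a a * G \<omega> b b) - expectation (\<lambda>\<omega>. H \<omega> a a * H \<omega> b b)))"
    unfolding ET' EU by (simp add: algebra_simps)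
  \<comment> \<open>The constant \<open>8\<close> of the conclusion is \<open>4\<close> from
    \<open>S\<close> plus \<open>2 * 2\<close> from replacing \<open>H\<close> by \<open>G\<close>
    in the main term.\<close>
  also have "cmod \<dots> \<le> 4 / Im z * C * expectation (\<lambda>\<omega>. (cmod (h \<omega>))\<^sup>2 * min 1 (cmod (h \<omega>)))
      + ((c r)\<^sup>2 / n * (expectation (\<lambda>\<omega>. (cmod (G \<omega> b a))\<^sup>2)
        + expectation (\<lambda>\<omega>. (cmod (G \<omega> a b))\<^sup>2) + 4 * C / Im z * (\<bar>c r\<bar> / sqrt n))
      + 2 * ((c r)\<^sup>2 / n) * (2 * C / Im z * (\<bar>c r\<bar> / sqrt n)))"
  proof (intro norm_triangle_mono ETTSU)
    show "cmod (- expectation S) \<le> (c r)\<^sup>2 / n * (expectation (\<lambda>\<omega>. (cmod (G \<omega> b a))\<^sup>2)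
        + expectation (\<lambda>\<omega>. (cmod (G \<omega> a b))\<^sup>2) + 4 * C / Im z * (\<bar>c r\<bar> / sqrt n))"
      using ES by simp
    have "cmod (2 * of_real ((c r)\<^sup>2 / n)) = 2 * ((c r)\<^sup>2 / n)"
      by (simp add: norm_mult norm_divide norm_power)
    then show "cmod (2 * of_real ((c r)\<^sup>2 / n) * (expectation (\<lambda>\<omega>. G \<omega> a a * G \<omega> b b) - expectation (\<lambda>\<omega>. H \<omega> a a * H \<omega> b b)))
        \<le> 2 * ((c r)\<^sup>2 / n) * (2 * C / Im z * (\<bar>c r\<bar> / sqrt n))"
      unfolding norm_mult[of "2 * of_real ((c r)\<^sup>2 / n)"] using EHG by (simp only:) (intro mult_left_mono, auto)
  qed
  finally show ?thesis unfolding T_def by (simp add: algebra_simps)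
qed

text \<open>The trace of \<open>(A - z) G = 1\<close> expresses \<open>n (1 + z s)\<close> through
  the entries of \<open>A\<close> and \<open>G\<close>. By \<open>entry_expansion\<close> each
  independent variable contributes \<open>- 2 (c r)^2 / n\<close> times
  \<open>E (G a a * G b b)\<close>, and these add up to the quadratic term except for its diagonal
  \<open>a = b\<close>. In \<open>2 / (Im z)^2 / n\<close> one half pays for that diagonal, the
  other for the squares \<open>|G a b|^2\<close>.\<close>

lemma self_consistent_bound:
  fixes z :: complex
  assumes z: "Im z > 0" and n: "n > 0"
  defines "C \<equiv> 2 / Im z + 2 / (Im z)\<^sup>2"
    and "s \<equiv> \<lambda>\<omega>. stieltjes n (W0 n \<omega>) z"
    and "\<beta> \<equiv> \<lambda>r. expectation (\<lambda>\<omega>. (cmod (X r 0 1 \<omega>))\<^sup>2 * min 1 (\<bar>c r\<bar> / sqrt n * cmod (X r 0 1 \<omega>)))"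
  shows "cmod (expectation (\<lambda>\<omega>. 1 + z * s \<omega> + of_real (\<Sum>r\<in>R. (c r)\<^sup>2) * (s \<omega>)\<^sup>2))
    \<le> (\<Sum>r\<in>R. (c r)\<^sup>2 * (4 / Im z * C * \<beta> r + 8 * C / Im z * (\<bar>c r\<bar> / sqrt n) + 2 / (Im z)\<^sup>2 / n))"
proof -
  define G where "G = (\<lambda>\<omega>. resolvent n (W0 n \<omega>) z)"
  define h where "h = (\<lambda>r a b \<omega>. complex_of_real (c r / sqrt n) * X r a b \<omega>)"
  have z0: "Im z \<noteq> 0" using z by simp
  have C0: "0 \<le> C" using z by (simp add: C_def)
  have Gm [measurable]: "(\<lambda>\<omega>. G \<omega> i j) \<in> borel_measurable M" if "i < n" "j < n" for i j
    unfolding G_def using that by (intro borel_measurable_resolvent borel_measurable_W0)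
  have Gb: "cmod (G \<omega> i j) \<le> 1 / Im z" if "i < n" "j < n" for i j \<omega>
    unfolding G_def using that by (intro cmod_resolvent_le hermitian_W0 z)
  have GGb: "cmod (G \<omega> i j * G \<omega> k l) \<le> 1 / Im z * (1 / Im z)" if "i < n" "j < n" "k < n" "l < n" for i j k l \<omega>
    unfolding norm_mult using z by (intro mult_mono Gb that) auto
  have GGi: "integrable M (\<lambda>\<omega>. G \<omega> i j * G \<omega> k l)" if "i < n" "j < n" "k < n" "l < n" for i j k l
    using that by (intro integrable_const_bound[where B = "1 / Im z * (1 / Im z)"] AE_I2 GGb borel_measurable_times Gm)
  have G2i: "integrable M (\<lambda>\<omega>. (cmod (G \<omega> i j))\<^sup>2)" if "i < n" "j < n" for i j
    using integrable_norm[OF GGi[OF that that]] by (simp add: norm_mult power2_eq_square)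
  have hi: "integrable M (h r a b)" and chi: "integrable M (\<lambda>\<omega>. cnj (h r a b \<omega>))" if "r \<in> R" "a < b" for r a b
    unfolding h_def using integrable_offdiag(1)[OF that] by simp_all
  define T where "T = (\<lambda>r a b \<omega>. h r a b \<omega> * G \<omega> b a + cnj (h r a b \<omega>) * G \<omega> a b)"
  have Ti: "integrable M (T r a b)" if "r \<in> R" "a < b" "b < n" for r a b
    unfolding T_def using that
    by (intro Bochner_Integration.integrable_add integrable_mult_bounded[OF hi Gm Gb] integrable_mult_bounded[OF chi Gm Gb]) auto
  define w where "w = (\<lambda>r. complex_of_real ((c r)\<^sup>2 / n))"
  have W0ab: "W0 n \<omega> a b = (\<Sum>r\<in>R. h r a b \<omega>)" if "a < b" for a b \<omega>
    using that by (simp add: W0_def wigner_comb_def h_def sum_divide_distrib)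
  have W0ba: "W0 n \<omega> b a = (\<Sum>r\<in>R. cnj (h r a b \<omega>))" if "a < b" for a b \<omega>
    using that by (simp add: W0_def wigner_comb_def h_def sum_divide_distrib)
  have W0aa: "W0 n \<omega> a a = 0" for a \<omega> by (simp add: W0_eq)
  have s: "of_nat n * s \<omega> = (\<Sum>i<n. G \<omega> i i)" for \<omega>
    using n by (simp add: s_def stieltjes_def G_def)
  \<comment> \<open>The trace of \<open>A G\<close>, with the two orderings of each pair collected;
    the diagonal of \<open>W0\<close> is zero.\<close>
  have lin: "of_nat n * (1 + z * s \<omega>) = (\<Sum>b<n. \<Sum>a<b. \<Sum>r\<in>R. T r a b \<omega>)" for \<omega>
  proof -
    have "of_nat n * (1 + z * s \<omega>) = (\<Sum>i<n. z * G \<omega> i i + 1)"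
      using s[of \<omega>] by (simp add: algebra_simps sum.distrib sum_distrib_left[symmetric])
    also have "\<dots> = (\<Sum>i<n. \<Sum>k<n. W0 n \<omega> i k * G \<omega> k i)"
      unfolding G_def by (intro sum.cong refl) (simp add: resolvent_right[OF hermitian_W0 z0])
    also have "\<dots> = (\<Sum>b<n. \<Sum>a<b. W0 n \<omega> a b * G \<omega> b a + W0 n \<omega> b a * G \<omega> a b)"
      unfolding sum_square_split by (simp add: W0aa)
    also have "\<dots> = (\<Sum>b<n. \<Sum>a<b. \<Sum>r\<in>R. T r a b \<omega>)"
      unfolding T_def sum.distrib
      by (intro arg_cong2[where f = "(+)"] sum.cong refl) (simp_all add: W0ab W0ba sum_distrib_right)
    finally show ?thesis .
  qed
  have quad: "of_nat n * (of_real (\<Sum>r\<in>R. (c r)\<^sup>2) * (s \<omega>)\<^sup>2) =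
      (\<Sum>b<n. \<Sum>a<b. \<Sum>r\<in>R. 2 * w r * (G \<omega> a a * G \<omega> b b)) + (\<Sum>i<n. \<Sum>r\<in>R. w r * (G \<omega> i i * G \<omega> i i))" for \<omega>
  proof -
    have "of_nat n * (of_real (\<Sum>r\<in>R. (c r)\<^sup>2) * (s \<omega>)\<^sup>2) = (\<Sum>r\<in>R. w r) * ((of_nat n * s \<omega>) * (of_nat n * s \<omega>))"
      using n by (simp add: w_def power2_eq_square sum_divide_distrib[symmetric] field_simps)
    also have "(of_nat n * s \<omega>) * (of_nat n * s \<omega>) = (\<Sum>i<n. \<Sum>j<n. G \<omega> i i * G \<omega> j j)"
      unfolding s by (rule sum_product)
    also have "\<dots> = (\<Sum>i<n. G \<omega> i i * G \<omega> i i) + (\<Sum>b<n. \<Sum>a<b. 2 * (G \<omega> a a * G \<omega> b b))"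
      unfolding sum_square_split by (simp add: mult.commute)
    also have "(\<Sum>r\<in>R. w r) * \<dots> = (\<Sum>b<n. \<Sum>a<b. \<Sum>r\<in>R. 2 * w r * (G \<omega> a a * G \<omega> b b)) + (\<Sum>i<n. \<Sum>r\<in>R. w r * (G \<omega> i i * G \<omega> i i))"
      by (simp add: distrib_left sum_distrib_left sum_distrib_right mult_ac)
    finally show ?thesis .
  qed
  have total: "of_nat n * (1 + z * s \<omega> + of_real (\<Sum>r\<in>R. (c r)\<^sup>2) * (s \<omega>)\<^sup>2) =
      (\<Sum>b<n. \<Sum>a<b. \<Sum>r\<in>R. T r a b \<omega> + 2 * w r * (G \<omega> a a * G \<omega> b b)) + (\<Sum>i<n. \<Sum>r\<in>R. w r * (G \<omega> i i * G \<omega> i i))" for \<omega>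
    unfolding distrib_left[of "of_nat n" "1 + z * s \<omega>"] lin quad by (simp add: sum.distrib)
  let ?E = "expectation (\<lambda>\<omega>. 1 + z * s \<omega> + of_real (\<Sum>r\<in>R. (c r)\<^sup>2) * (s \<omega>)\<^sup>2)"
  have ETw: "expectation (\<lambda>\<omega>. T r a b \<omega> + 2 * w r * (G \<omega> a a * G \<omega> b b)) =
      expectation (T r a b) + 2 * w r * expectation (\<lambda>\<omega>. G \<omega> a a * G \<omega> b b)" if "r \<in> R" "a < b" "b < n" for r a b
    using Ti[OF that] GGi[of a a b b] that by simp
  have "of_nat n * ?E = expectation (\<lambda>\<omega>. of_nat n * (1 + z * s \<omega> + of_real (\<Sum>r\<in>R. (c r)\<^sup>2) * (s \<omega>)\<^sup>2))"
    by simp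
  also have "\<dots> = (\<Sum>b<n. \<Sum>a<b. \<Sum>r\<in>R. expectation (\<lambda>\<omega>. T r a b \<omega> + 2 * w r * (G \<omega> a a * G \<omega> b b)))
      + (\<Sum>i<n. \<Sum>r\<in>R. w r * expectation (\<lambda>\<omega>. G \<omega> i i * G \<omega> i i))"
  proof -
    let ?F = "\<lambda>r a b \<omega>. T r a b \<omega> + 2 * w r * (G \<omega> a a * G \<omega> b b)"
    let ?K = "\<lambda>i r \<omega>. w r * (G \<omega> i i * G \<omega> i i)"
    have F: "integrable M (?F r a b)" if "r \<in> R" "a < b" "b < n" for r a b
      using that by (intro Bochner_Integration.integrable_add integrable_mult_right Ti GGi) auto
    have K: "integrable M (?K i r)" if "i < n" for i r
      using that by (intro integrable_mult_right GGi) auto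
    have "expectation (\<lambda>\<omega>. \<Sum>b<n. \<Sum>a<b. \<Sum>r\<in>R. ?F r a b \<omega>) = (\<Sum>b<n. expectation (\<lambda>\<omega>. \<Sum>a<b. \<Sum>r\<in>R. ?F r a b \<omega>))"
      by (intro Bochner_Integration.integral_sum Bochner_Integration.integrable_sum F) auto
    also have "\<dots> = (\<Sum>b<n. \<Sum>a<b. expectation (\<lambda>\<omega>. \<Sum>r\<in>R. ?F r a b \<omega>))"
      by (intro sum.cong refl Bochner_Integration.integral_sum Bochner_Integration.integrable_sum F) auto
    also have "\<dots> = (\<Sum>b<n. \<Sum>a<b. \<Sum>r\<in>R. expectation (?F r a b))"
      by (intro sum.cong refl Bochner_Integration.integral_sum F) auto
    finally have 1: "expectation (\<lambda>\<omega>. \<Sum>b<n. \<Sum>a<b. \<Sum>r\<in>R. ?F r a b \<omega>) = \<dots>" .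
    have "expectation (\<lambda>\<omega>. \<Sum>i<n. \<Sum>r\<in>R. ?K i r \<omega>) = (\<Sum>i<n. expectation (\<lambda>\<omega>. \<Sum>r\<in>R. ?K i r \<omega>))"
      by (intro Bochner_Integration.integral_sum Bochner_Integration.integrable_sum K) auto
    also have "\<dots> = (\<Sum>i<n. \<Sum>r\<in>R. expectation (?K i r))"
      by (intro sum.cong refl Bochner_Integration.integral_sum K) auto
    finally have 2: "expectation (\<lambda>\<omega>. \<Sum>i<n. \<Sum>r\<in>R. ?K i r \<omega>) = (\<Sum>i<n. \<Sum>r\<in>R. w r * expectation (\<lambda>\<omega>. G \<omega> i i * G \<omega> i i))"
      by simp
    show ?thesis unfolding total 1[symmetric] 2[symmetric]
      by (rule Bochner_Integration.integral_add) (intro Bochner_Integration.integrable_sum F K; simp)+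
  qed
  finally have nE: "of_nat n * ?E = (\<Sum>b<n. \<Sum>a<b. \<Sum>r\<in>R. expectation (\<lambda>\<omega>. T r a b \<omega> + 2 * w r * (G \<omega> a a * G \<omega> b b)))
      + (\<Sum>i<n. \<Sum>r\<in>R. w r * expectation (\<lambda>\<omega>. G \<omega> i i * G \<omega> i i))" .
  have Eh: "expectation (\<lambda>\<omega>. (cmod (h r a b \<omega>))\<^sup>2 * min 1 (cmod (h r a b \<omega>))) = (c r)\<^sup>2 / n * \<beta> r" if "r \<in> R" "a < b" for r a b
  proof -
    let ?\<phi> = "\<lambda>x. (cmod x)\<^sup>2 * min 1 (\<bar>c r\<bar> / sqrt n * cmod x)"
    have "(cmod (h r a b \<omega>))\<^sup>2 * min 1 (cmod (h r a b \<omega>)) = (c r)\<^sup>2 / n * ?\<phi> (X r a b \<omega>)" for \<omega>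
      unfolding h_def norm_mult norm_of_real by (simp add: power_mult_distrib power_divide abs_divide)
    then have "expectation (\<lambda>\<omega>. (cmod (h r a b \<omega>))\<^sup>2 * min 1 (cmod (h r a b \<omega>))) = (c r)\<^sup>2 / n * expectation (\<lambda>\<omega>. ?\<phi> (X r a b \<omega>))"
      by simp
    also have "expectation (\<lambda>\<omega>. ?\<phi> (X r a b \<omega>)) = \<beta> r"
      unfolding \<beta>_def by (rule expectation_offdiag(1)[OF _ that]) measurable
    finally show ?thesis .
  qed
  let ?g = "\<lambda>i j. expectation (\<lambda>\<omega>. (cmod (G \<omega> i j))\<^sup>2)"
  have b1: "cmod (expectation (\<lambda>\<omega>. T r a b \<omega> + 2 * w r * (G \<omega> a a * G \<omega> b b))) \<le>
      (c r)\<^sup>2 / n * (4 / Im z * C * \<beta> r + 8 * C / Im z * (\<bar>c r\<bar> / sqrt n)) + (c r)\<^sup>2 / n * (?g a b + ?g b a)"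
    if "r \<in> R" "a < b" "b < n" for r a b
  proof -
    have "cmod (expectation (\<lambda>\<omega>. T r a b \<omega> + 2 * w r * (G \<omega> a a * G \<omega> b b))) \<le>
       4 / Im z * C * ((c r)\<^sup>2 / n * \<beta> r) + (c r)\<^sup>2 / n * (?g b a + ?g a b + 8 * C / Im z * (\<bar>c r\<bar> / sqrt n))"
      unfolding ETw[OF that] Eh[OF that(1,2), symmetric]
      using entry_expansion[OF z that] unfolding T_def h_def G_def C_def w_def by simp
    then show ?thesis by (simp add: algebra_simps)
  qed
  have \<beta>0: "0 \<le> \<beta> r" for r unfolding \<beta>_def by (intro integral_nonneg_AE AE_I2) auto
  have g0: "0 \<le> ?g i j" for i j by (intro integral_nonneg_AE AE_I2) auto
  \<comment> \<open>The Ward bound holds for every row pointwise, so the total is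
    \<open>n / (Im z)^2\<close> although there are about \<open>n^2\<close> pairs.\<close>
  have sum_g: "(\<Sum>b<n. \<Sum>a<b. ?g a b + ?g b a) \<le> n / (Im z)\<^sup>2"
  proof -
    have "(\<Sum>b<n. \<Sum>a<b. ?g a b + ?g b a) \<le> (\<Sum>i<n. \<Sum>j<n. ?g i j)"
      unfolding sum_square_split by (simp add: sum_nonneg g0)
    also have "\<dots> = (\<Sum>i<n. expectation (\<lambda>\<omega>. \<Sum>j<n. (cmod (G \<omega> i j))\<^sup>2))"
      by (intro sum.cong refl Bochner_Integration.integral_sum[symmetric] G2i) auto
    also have "\<dots> \<le> (\<Sum>i<n. expectation (\<lambda>\<omega>. 1 / (Im z)\<^sup>2))"
    proof (intro sum_mono integral_mono)
      fix i \<omega> assume "i \<in> {..<n}"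
      then show "(\<Sum>j<n. (cmod (G \<omega> i j))\<^sup>2) \<le> 1 / (Im z)\<^sup>2"
        unfolding G_def by (intro sum_resolvent_row_le[OF hermitian_W0 z]) auto
    qed (auto intro!: Bochner_Integration.integrable_sum G2i)
    also have "\<dots> = n / (Im z)\<^sup>2" by (simp add: prob_space)
    finally show ?thesis .
  qed
  let ?D = "\<lambda>r. 4 / Im z * C * \<beta> r + 8 * C / Im z * (\<bar>c r\<bar> / sqrt n)"
  have D0: "0 \<le> ?D r" for r using z C0 \<beta>0 by (intro add_nonneg_nonneg mult_nonneg_nonneg divide_nonneg_nonneg) auto
  have "cmod (\<Sum>b<n. \<Sum>a<b. \<Sum>r\<in>R. expectation (\<lambda>\<omega>. T r a b \<omega> + 2 * w r * (G \<omega> a a * G \<omega> b b)))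
      \<le> (\<Sum>b<n. \<Sum>a<b. \<Sum>r\<in>R. (c r)\<^sup>2 / n * ?D r + (c r)\<^sup>2 / n * (?g a b + ?g b a))"
    by (intro order_trans[OF norm_sum] sum_mono b1) auto
  also have "\<dots> = (\<Sum>r\<in>R. (\<Sum>b<n. \<Sum>a<b. (c r)\<^sup>2 / n * ?D r) + (c r)\<^sup>2 / n * (\<Sum>b<n. \<Sum>a<b. ?g a b + ?g b a))"
    unfolding sum_distrib_left sum.distrib[symmetric]
    by (subst sum.swap[of _ _ R], intro sum.cong refl sum.swap)
  also have "\<dots> \<le> (\<Sum>r\<in>R. n * (n * ((c r)\<^sup>2 / n * ?D r)) + (c r)\<^sup>2 / n * (n / (Im z)\<^sup>2))"
  proof (intro sum_mono add_mono mult_left_mono sum_g)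
    fix r
    \<comment> \<open>The number of pairs is bounded by \<open>n^2\<close>; the weight
      \<open>1 / n\<close> and the final division by \<open>n\<close> compensate this.\<close>
    have "(\<Sum>b<n. \<Sum>a<b. (c r)\<^sup>2 / n * ?D r) \<le> (\<Sum>b<n. \<Sum>a<n. (c r)\<^sup>2 / n * ?D r)"
      using D0[of r] by (intro sum_mono sum_mono2 mult_nonneg_nonneg) auto
    then show "(\<Sum>b<n. \<Sum>a<b. (c r)\<^sup>2 / n * ?D r) \<le> n * (n * ((c r)\<^sup>2 / n * ?D r))" by simp
  qed auto
  finally have B1: "cmod (\<Sum>b<n. \<Sum>a<b. \<Sum>r\<in>R. expectation (\<lambda>\<omega>. T r a b \<omega> + 2 * w r * (G \<omega> a a * G \<omega> b b)))
      \<le> (\<Sum>r\<in>R. n * (n * ((c r)\<^sup>2 / n * ?D r)) + (c r)\<^sup>2 / n * (n / (Im z)\<^sup>2))" .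
  have "cmod (\<Sum>i<n. \<Sum>r\<in>R. w r * expectation (\<lambda>\<omega>. G \<omega> i i * G \<omega> i i)) \<le> (\<Sum>i<n. \<Sum>r\<in>R. (c r)\<^sup>2 / n * (1 / Im z * (1 / Im z)))"
  proof (intro order_trans[OF norm_sum] sum_mono)
    fix i r assume i: "i \<in> {..<n}"
    have "cmod (expectation (\<lambda>\<omega>. G \<omega> i i * G \<omega> i i)) \<le> expectation (\<lambda>\<omega>. cmod (G \<omega> i i * G \<omega> i i))"
      by (rule integral_norm_bound)
    also have "\<dots> \<le> expectation (\<lambda>\<omega>. 1 / Im z * (1 / Im z))"
      using i GGi[of i i i i] by (intro integral_mono GGb) auto
    also have "\<dots> = 1 / Im z * (1 / Im z)" by (simp add: prob_space)
    finally have "cmod (expectation (\<lambda>\<omega>. G \<omega> i i * G \<omega> i i)) \<le> 1 / Im z * (1 / Im z)" .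
    moreover have "cmod (w r) = (c r)\<^sup>2 / n" by (simp add: w_def norm_divide norm_power)
    ultimately show "cmod (w r * expectation (\<lambda>\<omega>. G \<omega> i i * G \<omega> i i)) \<le> (c r)\<^sup>2 / n * (1 / Im z * (1 / Im z))"
      unfolding norm_mult by (simp only:) (intro mult_left_mono, auto)
  qed
  also have "\<dots> = (\<Sum>r\<in>R. (c r)\<^sup>2 / n * (n / (Im z)\<^sup>2))"
    using n by (simp add: power2_eq_square sum_distrib_left)
  finally have B2: "cmod (\<Sum>i<n. \<Sum>r\<in>R. w r * expectation (\<lambda>\<omega>. G \<omega> i i * G \<omega> i i)) \<le> (\<Sum>r\<in>R. (c r)\<^sup>2 / n * (n / (Im z)\<^sup>2))" .
  have "n * cmod ?E = cmod (of_nat n * ?E)" by (simp add: norm_mult)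
  also have "\<dots> \<le> (\<Sum>r\<in>R. n * (n * ((c r)\<^sup>2 / n * ?D r)) + (c r)\<^sup>2 / n * (n / (Im z)\<^sup>2)) + (\<Sum>r\<in>R. (c r)\<^sup>2 / n * (n / (Im z)\<^sup>2))"
    unfolding nE by (intro norm_triangle_mono B1 B2)
  also have "\<dots> = n * (\<Sum>r\<in>R. (c r)\<^sup>2 * (?D r + 2 / (Im z)\<^sup>2 / n))"
    unfolding sum.distrib[symmetric] sum_distrib_left using n z by (intro sum.cong refl) (simp add: field_simps)
  finally show ?thesis using n by simp
qed

lemma tendsto_const_div_sqrt: "(\<lambda>n. C / sqrt (real n)) \<longlonglongrightarrow> 0"
  by real_asymp

text \<open>Dominated convergence with majorant \<open>|X|^2\<close>: the factor
  \<open>min 1\<close> tends to zero pointwise. This takes the place of a Lindeberg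
  condition.\<close>

lemma tendsto_truncated_second_moment:
  assumes r: "r \<in> R"
  shows "(\<lambda>n. expectation (\<lambda>\<omega>. (cmod (X r 0 1 \<omega>))\<^sup>2 * min 1 (\<bar>c r\<bar> / sqrt (real n) * cmod (X r 0 1 \<omega>)))) \<longlonglongrightarrow> 0"
proof -
  note [measurable] = random_variable_X[OF r]
  have "(\<lambda>n. expectation (\<lambda>\<omega>. (cmod (X r 0 1 \<omega>))\<^sup>2 * min 1 (\<bar>c r\<bar> / sqrt (real n) * cmod (X r 0 1 \<omega>))))
      \<longlonglongrightarrow> expectation (\<lambda>\<omega>. 0)"
  proof (rule integral_dominated_convergence[where w = "\<lambda>\<omega>. (cmod (X r 0 1 \<omega>))\<^sup>2"])
    show "AE \<omega> in M. (\<lambda>n. (cmod (X r 0 1 \<omega>))\<^sup>2 * min 1 (\<bar>c r\<bar> / sqrt (real n) * cmod (X r 0 1 \<omega>))) \<longlonglongrightarrow> 0"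
    proof (rule AE_I2)
      fix \<omega>
      have "(\<lambda>n. (cmod (X r 0 1 \<omega>))\<^sup>2 * min 1 (\<bar>c r\<bar> / sqrt (real n) * cmod (X r 0 1 \<omega>)))
          \<longlonglongrightarrow> (cmod (X r 0 1 \<omega>))\<^sup>2 * min 1 (0 * cmod (X r 0 1 \<omega>))"
        by (intro tendsto_intros tendsto_min tendsto_const_div_sqrt)
      then show "(\<lambda>n. (cmod (X r 0 1 \<omega>))\<^sup>2 * min 1 (\<bar>c r\<bar> / sqrt (real n) * cmod (X r 0 1 \<omega>))) \<longlonglongrightarrow> 0"
        by simp
    qed
    show "AE \<omega> in M. norm ((cmod (X r 0 1 \<omega>))\<^sup>2 * min 1 (\<bar>c r\<bar> / sqrt (real n) * cmod (X r 0 1 \<omega>))) \<le> (cmod (X r 0 1 \<omega>))\<^sup>2" for n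
      by (intro AE_I2) (auto simp: abs_mult intro!: mult_left_le)
  qed (use integrable_X01_sq[OF r] in auto)
  then show ?thesis by simp
qed

lemma self_consistent_limit:
  assumes z: "Im z > 0"
  defines "s \<equiv> \<lambda>n \<omega>. stieltjes n (W0 n \<omega>) z"
  shows "(\<lambda>n. expectation (\<lambda>\<omega>. 1 + z * s n \<omega> + of_real (\<Sum>r\<in>R. (c r)\<^sup>2) * (s n \<omega>)\<^sup>2)) \<longlonglongrightarrow> 0"
proof (rule Lim_null_comparison)
  define C where "C = 2 / Im z + 2 / (Im z)\<^sup>2"
  define \<beta> where "\<beta> r n = expectation (\<lambda>\<omega>. (cmod (X r 0 1 \<omega>))\<^sup>2 * min 1 (\<bar>c r\<bar> / sqrt (real n) * cmod (X r 0 1 \<omega>)))" for r n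
  let ?B = "\<lambda>n. \<Sum>r\<in>R. (c r)\<^sup>2 * (4 / Im z * C * \<beta> r n + 8 * C / Im z * (\<bar>c r\<bar> / sqrt n) + 2 / (Im z)\<^sup>2 / real n)"
  show "\<forall>\<^sub>F n in sequentially. norm (expectation (\<lambda>\<omega>. 1 + z * s n \<omega> + of_real (\<Sum>r\<in>R. (c r)\<^sup>2) * (s n \<omega>)\<^sup>2)) \<le> ?B n"
    using eventually_gt_at_top[of 0]
    by eventually_elim (unfold s_def \<beta>_def C_def, rule self_consistent_bound[OF z])
  have "?B \<longlonglongrightarrow> (\<Sum>r\<in>R. (c r)\<^sup>2 * (4 / Im z * C * 0 + 8 * C / Im z * 0 + 0))"
    unfolding \<beta>_def
    by (intro tendsto_sum tendsto_mult tendsto_add tendsto_const tendsto_const_div_sqrt tendsto_truncated_second_moment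
        tendsto_divide_0[OF tendsto_const] filterlim_at_top_imp_at_infinity filterlim_real_sequentially)
  then show "?B \<longlonglongrightarrow> 0" by simp
qed

text \<open>Diagonal entries are identically distributed, so the mean over \<open>i\<close> of the
  \<open>min 1\<close> terms reduces to one expectation per array. It tends to zero by dominated
  convergence with the majorant \<open>1\<close>.\<close>

lemma tendsto_diagonal_removal:
  assumes z: "Im z > 0"
  shows "(\<lambda>n. expectation (\<lambda>\<omega>. cmod (stieltjes n (W n \<omega>) z - stieltjes n (W0 n \<omega>) z))) \<longlonglongrightarrow> 0"
proof (rule Lim_null_comparison)
  define C where "C = 1 / Im z + 1 / (Im z)\<^sup>2"
  define \<delta> where "\<delta> r n = expectation (\<lambda>\<omega>. min 1 (\<bar>c r\<bar> / sqrt (real n) * cmod (X r 0 0 \<omega>)))" for r n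
  have C0: "0 \<le> C" using z by (simp add: C_def)
  show "\<forall>\<^sub>F n in sequentially. norm (expectation (\<lambda>\<omega>. cmod (stieltjes n (W n \<omega>) z - stieltjes n (W0 n \<omega>) z)))
      \<le> C * (\<Sum>r\<in>R. \<delta> r n)"
    using eventually_gt_at_top[of 0]
  proof eventually_elim
    case (elim n)
    let ?\<phi> = "\<lambda>r x. min 1 (\<bar>c r\<bar> / sqrt (real n) * cmod x)"
    have int: "integrable M (\<lambda>\<omega>. ?\<phi> r (X r i i \<omega>))" if "r \<in> R" for r i
    proof (rule integrable_const_bound[where B = 1])
      show "(\<lambda>\<omega>. ?\<phi> r (X r i i \<omega>)) \<in> borel_measurable M"
        using random_variable_X[OF that] by measurable
    qed auto
    have W0: "W0 n \<omega> = (\<lambda>i j. if i = j then 0 else W n \<omega> i j)" for \<omega>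
      by (intro ext) (rule W0_eq)
    have "cmod (stieltjes n (W n \<omega>) z - stieltjes n (W0 n \<omega>) z) \<le> C * (\<Sum>i<n. \<Sum>r\<in>R. ?\<phi> r (X r i i \<omega>)) / n" for \<omega>
    proof -
      have "min 1 (cmod (W n \<omega> i i)) \<le> (\<Sum>r\<in>R. ?\<phi> r (X r i i \<omega>))" for i
      proof -
        have "cmod (W n \<omega> i i) \<le> cmod (\<Sum>r\<in>R. of_real (c r) * X r i i \<omega>) / sqrt n"
          unfolding W_def wigner_comb_def entries_def
          by (simp add: norm_divide divide_right_mono abs_Re_le_cmod del: Re_sum)
        also have "\<dots> \<le> (\<Sum>r\<in>R. \<bar>c r\<bar> * cmod (X r i i \<omega>)) / sqrt n"
          by (intro divide_right_mono order_trans[OF norm_sum]) (auto simp: norm_mult)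
        also have "\<dots> = (\<Sum>r\<in>R. \<bar>c r\<bar> / sqrt n * cmod (X r i i \<omega>))"
          by (simp add: sum_divide_distrib)
        finally have "min 1 (cmod (W n \<omega> i i)) \<le> min 1 (\<Sum>r\<in>R. \<bar>c r\<bar> / sqrt n * cmod (X r i i \<omega>))"
          by (intro min.mono) auto
        also have "\<dots> \<le> (\<Sum>r\<in>R. ?\<phi> r (X r i i \<omega>))"
          by (rule min_1_sum_le[OF finite_R]) auto
        finally show ?thesis .
      qed
      then have "C * (\<Sum>i<n. min 1 (cmod (W n \<omega> i i))) / n \<le> C * (\<Sum>i<n. \<Sum>r\<in>R. ?\<phi> r (X r i i \<omega>)) / n"
        by (intro divide_right_mono mult_left_mono sum_mono C0) auto
      moreover have "cmod (stieltjes n (W n \<omega>) z - stieltjes n (W0 n \<omega>) z) \<le> C * (\<Sum>i<n. min 1 (cmod (W n \<omega> i i))) / n"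
        unfolding W0 C_def by (rule stieltjes_diagonal_removal[OF hermitian_W z])
      ultimately show ?thesis by linarith
    qed
    then have "expectation (\<lambda>\<omega>. cmod (stieltjes n (W n \<omega>) z - stieltjes n (W0 n \<omega>) z)) \<le>
        expectation (\<lambda>\<omega>. C * (\<Sum>i<n. \<Sum>r\<in>R. ?\<phi> r (X r i i \<omega>)) / n)"
      by (intro integral_mono_AE' AE_I2 integrable_divide integrable_mult_right Bochner_Integration.integrable_sum int)
         (auto intro!: divide_nonneg_nonneg mult_nonneg_nonneg sum_nonneg C0)
    also have "\<dots> = C * (\<Sum>i<n. \<Sum>r\<in>R. expectation (\<lambda>\<omega>. ?\<phi> r (X r i i \<omega>))) / n"
    proof -
      have "expectation (\<lambda>\<omega>. \<Sum>i<n. \<Sum>r\<in>R. ?\<phi> r (X r i i \<omega>)) = (\<Sum>i<n. expectation (\<lambda>\<omega>. \<Sum>r\<in>R. ?\<phi> r (X r i i \<omega>)))"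
        by (intro Bochner_Integration.integral_sum Bochner_Integration.integrable_sum int)
      also have "\<dots> = (\<Sum>i<n. \<Sum>r\<in>R. expectation (\<lambda>\<omega>. ?\<phi> r (X r i i \<omega>)))"
        by (intro sum.cong refl Bochner_Integration.integral_sum int)
      finally show ?thesis by simp
    qed
    also have "(\<Sum>i<n. \<Sum>r\<in>R. expectation (\<lambda>\<omega>. ?\<phi> r (X r i i \<omega>))) = (\<Sum>i<n. \<Sum>r\<in>R. \<delta> r n)"
      unfolding \<delta>_def by (intro sum.cong refl expectation_diag) measurable
    also have "C * \<dots> / n = C * (\<Sum>r\<in>R. \<delta> r n)" using elim by simp
    finally show ?case by simp
  qed
  have "(\<lambda>n. \<delta> r n) \<longlonglongrightarrow> 0" if r: "r \<in> R" for r
  proof -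
    note [measurable] = random_variable_X[OF r]
    have "(\<lambda>n. \<delta> r n) \<longlonglongrightarrow> expectation (\<lambda>\<omega>. 0)"
      unfolding \<delta>_def
    proof (rule integral_dominated_convergence[where w = "\<lambda>\<omega>. 1"])
      show "AE \<omega> in M. (\<lambda>n. min 1 (\<bar>c r\<bar> / sqrt (real n) * cmod (X r 0 0 \<omega>))) \<longlonglongrightarrow> 0"
      proof (rule AE_I2)
        fix \<omega>
        have "(\<lambda>n. min 1 (\<bar>c r\<bar> / sqrt (real n) * cmod (X r 0 0 \<omega>))) \<longlonglongrightarrow> min 1 (0 * cmod (X r 0 0 \<omega>))"
          by (intro tendsto_intros tendsto_min tendsto_const_div_sqrt)
        then show "(\<lambda>n. min 1 (\<bar>c r\<bar> / sqrt (real n) * cmod (X r 0 0 \<omega>))) \<longlonglongrightarrow> 0" by simp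
      qed
    qed auto
    then show ?thesis by simp
  qed
  then have "(\<lambda>n. C * (\<Sum>r\<in>R. \<delta> r n)) \<longlonglongrightarrow> C * (\<Sum>r\<in>R. 0)"
    by (intro tendsto_intros)
  then show "(\<lambda>n. C * (\<Sum>r\<in>R. \<delta> r n)) \<longlonglongrightarrow> 0" by simp
qed

text \<open>Two corrections separate this from \<open>self_consistent_limit\<close>: restoring the
  diagonal, at a cost controlled by the mean of \<open>|s - s0|\<close>, and replacing
  \<open>E s^2\<close> by \<open>(E s)^2\<close>, which is the concentration statement.\<close>

lemma expectation_stieltjes_quadratic:
  assumes z: "Im z > 0"
  defines "m \<equiv> \<lambda>n. expectation (\<lambda>\<omega>. stieltjes n (W n \<omega>) z)"
  shows "(\<lambda>n. 1 + z * m n + of_real (\<Sum>r\<in>R. (c r)\<^sup>2) * (m n)\<^sup>2) \<longlonglongrightarrow> 0"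
proof -
  define v where "v = complex_of_real (\<Sum>r\<in>R. (c r)\<^sup>2)"
  define s where "s = (\<lambda>n \<omega>. stieltjes n (W n \<omega>) z)"
  define s0 where "s0 = (\<lambda>n \<omega>. stieltjes n (W0 n \<omega>) z)"
  have sb: "cmod (s n \<omega>) \<le> 1 / Im z" and s0b: "cmod (s0 n \<omega>) \<le> 1 / Im z" for n \<omega>
    unfolding s_def s0_def by (intro cmod_stieltjes_le hermitian_W hermitian_W0 z)+
  have sm [measurable]: "s n \<in> borel_measurable M" and s0m [measurable]: "s0 n \<in> borel_measurable M" for n
    unfolding s_def s0_def by (intro borel_measurable_stieltjes borel_measurable_W borel_measurable_W0; assumption)+
  have si: "integrable M (s n)" and s0i: "integrable M (s0 n)" for n
    by (rule integrable_const_bound[where B = "1 / Im z"]; use sb s0b in auto)+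
  have s2i: "integrable M (\<lambda>\<omega>. (s n \<omega>)\<^sup>2)" and s02i: "integrable M (\<lambda>\<omega>. (s0 n \<omega>)\<^sup>2)" for n
    unfolding power2_eq_square by (rule integrable_mult_bounded[OF si sm sb] integrable_mult_bounded[OF s0i s0m s0b])+
  have mb: "cmod (m n) \<le> 1 / Im z" for n
  proof -
    have "cmod (m n) \<le> expectation (\<lambda>\<omega>. cmod (s n \<omega>))" unfolding m_def s_def by (rule integral_norm_bound)
    also have "\<dots> \<le> expectation (\<lambda>\<omega>. 1 / Im z)" using si by (intro integral_mono sb) auto
    finally show ?thesis by (simp add: prob_space)
  qed
  have Es: "expectation (s n) = m n" for n by (simp add: m_def s_def)
  have lim0: "(\<lambda>n. expectation (\<lambda>\<omega>. 1 + z * s0 n \<omega> + v * (s0 n \<omega>)\<^sup>2)) \<longlonglongrightarrow> 0"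
    unfolding v_def s0_def by (rule self_consistent_limit[OF z])
  have diff: "(\<lambda>n. expectation (\<lambda>\<omega>. z * (s n \<omega> - s0 n \<omega>) + v * ((s n \<omega>)\<^sup>2 - (s0 n \<omega>)\<^sup>2))) \<longlonglongrightarrow> 0"
  proof (rule Lim_null_comparison)
    let ?K = "cmod z + cmod v * (2 / Im z)"
    show "\<forall>\<^sub>F n in sequentially. norm (expectation (\<lambda>\<omega>. z * (s n \<omega> - s0 n \<omega>) + v * ((s n \<omega>)\<^sup>2 - (s0 n \<omega>)\<^sup>2)))
      \<le> ?K * expectation (\<lambda>\<omega>. cmod (s n \<omega> - s0 n \<omega>))"
    proof (intro always_eventually allI)
      fix n
      have "norm (expectation (\<lambda>\<omega>. z * (s n \<omega> - s0 n \<omega>) + v * ((s n \<omega>)\<^sup>2 - (s0 n \<omega>)\<^sup>2)))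
        \<le> expectation (\<lambda>\<omega>. norm (z * (s n \<omega> - s0 n \<omega>) + v * ((s n \<omega>)\<^sup>2 - (s0 n \<omega>)\<^sup>2)))"
        by (rule integral_norm_bound)
      also have "\<dots> \<le> expectation (\<lambda>\<omega>. ?K * cmod (s n \<omega> - s0 n \<omega>))"
      proof (rule integral_mono)
        fix \<omega>
        have "z * (s n \<omega> - s0 n \<omega>) + v * ((s n \<omega>)\<^sup>2 - (s0 n \<omega>)\<^sup>2) = (z + v * (s n \<omega> + s0 n \<omega>)) * (s n \<omega> - s0 n \<omega>)"
          by (simp add: algebra_simps power2_eq_square)
        moreover have "cmod (z + v * (s n \<omega> + s0 n \<omega>)) \<le> ?K"
        proof (rule norm_triangle_mono)
          have "cmod (s n \<omega> + s0 n \<omega>) \<le> 1 / Im z + 1 / Im z" by (intro norm_triangle_mono sb s0b)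
          then show "cmod (v * (s n \<omega> + s0 n \<omega>)) \<le> cmod v * (2 / Im z)"
            unfolding norm_mult by (intro mult_left_mono) auto
        qed simp
        ultimately show "norm (z * (s n \<omega> - s0 n \<omega>) + v * ((s n \<omega>)\<^sup>2 - (s0 n \<omega>)\<^sup>2)) \<le> ?K * cmod (s n \<omega> - s0 n \<omega>)"
          by (simp only: norm_mult) (intro mult_right_mono, auto)
      qed (use si s0i s2i s02i in auto)
      finally show "norm (expectation (\<lambda>\<omega>. z * (s n \<omega> - s0 n \<omega>) + v * ((s n \<omega>)\<^sup>2 - (s0 n \<omega>)\<^sup>2)))
        \<le> ?K * expectation (\<lambda>\<omega>. cmod (s n \<omega> - s0 n \<omega>))" by simp
    qed
    show "(\<lambda>n. ?K * expectation (\<lambda>\<omega>. cmod (s n \<omega> - s0 n \<omega>))) \<longlonglongrightarrow> 0"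
      using tendsto_mult_right_zero[OF tendsto_diagonal_removal[OF z], of ?K] by (simp add: s_def s0_def)
  qed
  \<comment> \<open>Almost sure concentration and the bound \<open>2 / Im z\<close> give convergence
    of this mean. No modulus is taken, so it equals \<open>E s^2 - m^2\<close> exactly.\<close>
  have var: "(\<lambda>n. expectation (\<lambda>\<omega>. (s n \<omega> - m n)\<^sup>2)) \<longlonglongrightarrow> 0"
  proof -
    have "(\<lambda>n. expectation (\<lambda>\<omega>. (s n \<omega> - m n)\<^sup>2)) \<longlonglongrightarrow> expectation (\<lambda>\<omega>. 0)"
    proof (rule integral_dominated_convergence[where w = "\<lambda>_. (2 / Im z)\<^sup>2"])
      show "AE \<omega> in M. (\<lambda>n. (s n \<omega> - m n)\<^sup>2) \<longlonglongrightarrow> 0"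
        using AE_stieltjes_minus_expectation[OF z]
      proof eventually_elim
        case (elim \<omega>)
        then show ?case using tendsto_power[of "\<lambda>n. s n \<omega> - m n" 0 sequentially 2] by (simp add: s_def m_def)
      qed
      show "AE \<omega> in M. norm ((s n \<omega> - m n)\<^sup>2) \<le> (2 / Im z)\<^sup>2" for n
      proof (rule AE_I2)
        fix \<omega>
        have "cmod (s n \<omega> - m n) \<le> 1 / Im z + 1 / Im z"
          by (rule order_trans[OF norm_triangle_ineq4]) (intro add_mono sb mb)
        then show "norm ((s n \<omega> - m n)\<^sup>2) \<le> (2 / Im z)\<^sup>2"
          unfolding norm_power by (intro power_mono) auto
      qed
    qed auto
    then show ?thesis by simp
  qed
  have "1 + z * m n + v * (m n)\<^sup>2 = expectation (\<lambda>\<omega>. 1 + z * s0 n \<omega> + v * (s0 n \<omega>)\<^sup>2)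
      + expectation (\<lambda>\<omega>. z * (s n \<omega> - s0 n \<omega>) + v * ((s n \<omega>)\<^sup>2 - (s0 n \<omega>)\<^sup>2)) - v * expectation (\<lambda>\<omega>. (s n \<omega> - m n)\<^sup>2)" for n
  proof -
    have "expectation (\<lambda>\<omega>. (s n \<omega> - m n)\<^sup>2) = expectation (\<lambda>\<omega>. (s n \<omega>)\<^sup>2 - 2 * m n * s n \<omega> + (m n)\<^sup>2)"
      by (intro Bochner_Integration.integral_cong refl) (simp add: power2_eq_square algebra_simps)
    also have "\<dots> = expectation (\<lambda>\<omega>. (s n \<omega>)\<^sup>2) - (m n)\<^sup>2"
      using s2i[of n] si[of n] Es[of n] by (simp add: prob_space power2_eq_square)
    finally have var: "expectation (\<lambda>\<omega>. (s n \<omega> - m n)\<^sup>2) = expectation (\<lambda>\<omega>. (s n \<omega>)\<^sup>2) - (m n)\<^sup>2" .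
    show ?thesis unfolding var
      using s2i[of n] si[of n] s02i[of n] s0i[of n] Es[of n] by (simp add: prob_space algebra_simps)
  qed
  moreover have "(\<lambda>n. expectation (\<lambda>\<omega>. 1 + z * s0 n \<omega> + v * (s0 n \<omega>)\<^sup>2)
      + expectation (\<lambda>\<omega>. z * (s n \<omega> - s0 n \<omega>) + v * ((s n \<omega>)\<^sup>2 - (s0 n \<omega>)\<^sup>2)) - v * expectation (\<lambda>\<omega>. (s n \<omega> - m n)\<^sup>2))
      \<longlonglongrightarrow> 0 + 0 - v * 0"
    by (intro tendsto_intros lim0 diff var)
  ultimately show ?thesis by (simp add: v_def)
qed

theorem AE_tendsto_stieltjes:
  assumes z: "Im z > 0" and v: "(\<Sum>r\<in>R. (c r)\<^sup>2) > 0"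
  shows "AE \<omega> in M. (\<lambda>n. stieltjes n (W n \<omega>) z) \<longlonglongrightarrow> semicircle_stieltjes (\<Sum>r\<in>R. (c r)\<^sup>2) z"
proof -
  let ?v = "\<Sum>r\<in>R. (c r)\<^sup>2"
  let ?m = "\<lambda>n. expectation (\<lambda>\<omega>. stieltjes n (W n \<omega>) z)"
  have "Im (?m n) \<ge> 0" for n
  proof -
    have "Im (stieltjes n (W n \<omega>) z) \<ge> 0" for \<omega>
      using Im_stieltjes_pos[OF hermitian_W z, of n n \<omega>] by (cases "n = 0") (auto simp: stieltjes_def[of 0])
    then have "0 \<le> expectation (\<lambda>\<omega>. Im (stieltjes n (W n \<omega>) z))" by (intro integral_nonneg_AE) auto
    then show ?thesis using integral_Im[OF integrable_stieltjes_W[OF z, of n]] by simp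
  qed
  then have lim: "?m \<longlonglongrightarrow> semicircle_stieltjes ?v z"
    by (rule tendsto_semicircle_of_quadratic[OF v z _ expectation_stieltjes_quadratic[OF z]])
  show ?thesis using AE_stieltjes_minus_expectation[OF z]
  proof eventually_elim
    case (elim \<omega>)
    from tendsto_add[OF this lim] show ?case by simp
  qed
qed

end

section \<open>Stieltjes inversion\<close>

lemma arctan_le_self:
  fixes x :: real
  assumes "0 \<le> x"
  shows "arctan x \<le> x"
proof -
  have "0 - arctan 0 \<le> x - arctan x"
  proof (rule DERIV_nonneg_imp_nondecreasing[OF assms])
    fix y :: real
    have "((\<lambda>y. y - arctan y) has_real_derivative (1 - inverse (1 + y\<^sup>2))) (at y)"
      by (auto intro!: derivative_eq_intros)
    moreover have "0 \<le> 1 - inverse (1 + y\<^sup>2)" by (simp add: inverse_le_1_iff)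
    ultimately show "\<exists>d. ((\<lambda>y. y - arctan y) has_real_derivative d) (at y) \<and> 0 \<le> d" by blast
  qed
  then show ?thesis by simp
qed

lemma Im_inverse_shift: "Im (1 / (of_real l - Complex x e)) = e / ((l - x)\<^sup>2 + e\<^sup>2)"
  by (simp add: Im_divide)

text \<open>The imaginary part of \<open>1 / (l - z)\<close> is the Poisson kernel, with the
  arctangent as primitive.\<close>

lemma has_bochner_integral_poisson:
  fixes e l p q :: real
  assumes e: "e > 0" and pq: "p \<le> q"
  shows "has_bochner_integral lborel (\<lambda>x. Im (1 / (of_real l - Complex x e)) * indicator {p..q} x)
    (arctan ((q - l) / e) - arctan ((p - l) / e))"
  unfolding Im_inverse_shift
proof (rule has_bochner_integral_FTC_Icc_nonneg)
  fix x
  have pos: "(l - x)\<^sup>2 + e\<^sup>2 > 0" using e by (simp add: add_nonneg_pos)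
  have "((\<lambda>x. arctan ((x - l) / e)) has_real_derivative (1 / e * inverse (1 + ((x - l) / e)\<^sup>2))) (at x)"
    using e by (auto intro!: derivative_eq_intros)
  moreover have "1 / e * inverse (1 + ((x - l) / e)\<^sup>2) = e / ((l - x)\<^sup>2 + e\<^sup>2)"
    using e pos by (simp add: field_simps power2_eq_square)
  ultimately show "((\<lambda>x. arctan ((x - l) / e)) has_real_derivative e / ((l - x)\<^sup>2 + e\<^sup>2)) (at x)"
    by simp
  show "0 \<le> e / ((l - x)\<^sup>2 + e\<^sup>2)" using e by (intro divide_nonneg_nonneg) auto
qed (use pq in auto)

text \<open>A point outside \<open>{a<..b}\<close> is at distance at least \<open>d\<close> from the
  shrunken interval, where the Poisson kernel has mass at most
  \<open>pi / 2 - arctan (d / e) = arctan (e / d)\<close>. A point inside contributes at most the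
  total mass \<open>pi\<close>.\<close>

lemma poisson_interval_bound:
  fixes e d l a b :: real
  assumes e: "e > 0" and d: "d > 0" and ab: "a + d \<le> b - d"
  shows "arctan ((b - d - l) / e) - arctan ((a + d - l) / e) \<le> pi * (indicator {a<..b} l + e / d)"
proof -
  have tail: "pi / 2 - arctan (d / e) \<le> pi * (e / d)"
  proof -
    have "pi / 2 - arctan (d / e) = arctan (e / d)"
      using arctan_inverse[of "d / e"] e d by simp
    also have "\<dots> \<le> 1 * (e / d)" using e d by (simp add: arctan_le_self)
    also have "\<dots> \<le> pi * (e / d)" using e d pi_ge_two by (intro mult_right_mono) auto
    finally show ?thesis .
  qed
  consider "l \<le> a" | "l > b" | "a < l" "l \<le> b" by linarith
  then show ?thesis
  proof cases
    case 1
    have "arctan (d / e) \<le> arctan ((a + d - l) / e)"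
      unfolding arctan_le_iff using e 1 by (intro divide_right_mono) auto
    then show ?thesis using 1 tail arctan_ubound[of "(b - d - l) / e"] by simp
  next
    case 2
    have "arctan ((b - d - l) / e) \<le> arctan (- (d / e))"
      unfolding arctan_le_iff using e 2 by (simp add: field_simps)
    then show ?thesis using 2 tail arctan_lbound[of "(a + d - l) / e"] by (simp add: arctan_minus)
  next
    case 3
    have "arctan ((b - d - l) / e) - arctan ((a + d - l) / e) \<le> pi"
      using arctan_ubound[of "(b - d - l) / e"] arctan_lbound[of "(a + d - l) / e"] by linarith
    moreover have "0 \<le> pi * (e / d)" using e d by simp
    ultimately show ?thesis using 3 by (simp add: distrib_left)
  qed
qed

text \<open>For probability measures lower bounds suffice: \<open>{a<..x}\<close> with
  \<open>a\<close> far to the left bounds the distribution function at \<open>x\<close> from below,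
  and \<open>{x<..b}\<close> with \<open>b\<close> far to the right bounds it from above through the
  complement.\<close>

lemma weak_conv_of_interval_liminf:
  assumes \<mu>: "\<And>n. real_distribution (\<mu> n)" and \<nu>: "real_distribution \<nu>"
    and low: "\<And>a b \<epsilon>. a < b \<Longrightarrow> \<epsilon> > 0 \<Longrightarrow> \<forall>\<^sub>F n in sequentially. measure (\<mu> n) {a<..b} \<ge> measure \<nu> {a<..b} - \<epsilon>"
  shows "weak_conv_m \<mu> \<nu>"
  unfolding weak_conv_m_def weak_conv_def
proof (intro allI impI)
  fix x
  interpret \<nu>: real_distribution \<nu> by (rule \<nu>)
  show "(\<lambda>n. cdf (\<mu> n) x) \<longlonglongrightarrow> cdf \<nu> x"
  proof (rule tendstoI)
    fix \<epsilon> :: real assume "\<epsilon> > 0"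
    then have e: "\<epsilon> / 3 > 0" by simp
    have lt: "1 - \<epsilon> / 3 < 1" using e by simp
    have "\<forall>\<^sub>F a in at_bot. cdf \<nu> a < \<epsilon> / 3 \<and> a < x"
      using order_tendstoD(2)[OF \<nu>.cdf_lim_at_bot e] eventually_gt_at_bot[of x] by eventually_elim auto
    then obtain a where a: "cdf \<nu> a < \<epsilon> / 3" "a < x" by (auto simp: eventually_at_bot_linorder)
    have "\<forall>\<^sub>F b in at_top. cdf \<nu> b > 1 - \<epsilon> / 3 \<and> x < b"
      using order_tendstoD(1)[OF \<nu>.cdf_lim_at_top_prob lt] eventually_gt_at_top[of x] by eventually_elim auto
    then obtain b where b: "cdf \<nu> b > 1 - \<epsilon> / 3" "x < b" by (auto simp: eventually_at_top_linorder)
    show "\<forall>\<^sub>F n in sequentially. dist (cdf (\<mu> n) x) (cdf \<nu> x) < \<epsilon>"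
      using low[OF a(2) e] low[OF b(2) e]
    proof eventually_elim
      case (elim n)
      interpret \<mu>: real_distribution "\<mu> n" by (rule \<mu>)
      have "cdf \<nu> x - cdf \<nu> a - \<epsilon> / 3 \<le> cdf (\<mu> n) x - cdf (\<mu> n) a"
        using elim(1) by (simp add: \<nu>.cdf_diff_eq[OF a(2)] \<mu>.cdf_diff_eq[OF a(2)])
      moreover have "cdf \<nu> b - cdf \<nu> x - \<epsilon> / 3 \<le> cdf (\<mu> n) b - cdf (\<mu> n) x"
        using elim(2) by (simp add: \<nu>.cdf_diff_eq[OF b(2)] \<mu>.cdf_diff_eq[OF b(2)])
      moreover have "0 \<le> cdf (\<mu> n) a" "cdf (\<mu> n) b \<le> 1"
        by (auto simp: \<mu>.cdf_nonneg \<mu>.cdf_bounded_prob)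
      ultimately show ?case using a b by (simp add: dist_real_def abs_less_iff)
    qed
  qed
qed

text \<open>The Poisson integral over a shrunken interval bounds the mass of \<open>{a<..b}\<close>
  from below. Choose first the shrinkage \<open>d\<close>, then the height \<open>e\<close>, then
  \<open>n\<close>. The error \<open>\<epsilon>\<close> has four equal parts: mass lost by
  shrinking, passing from \<open>S\<close> at height \<open>e\<close> to \<open>\<rho>\<close>,
  convergence in \<open>n\<close>, and the kernel tail \<open>e / d\<close>.\<close>

theorem stieltjes_inversion_weak_conv:
  fixes \<mu> :: "nat \<Rightarrow> real measure" and \<nu> :: "real measure" and l :: "nat \<Rightarrow> nat \<Rightarrow> real"
    and N :: "nat \<Rightarrow> nat" and S :: "complex \<Rightarrow> complex" and \<rho> :: "real \<Rightarrow> real" and B :: real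
  assumes \<mu>: "\<And>n. real_distribution (\<mu> n)" and \<nu>: "real_distribution \<nu>"
    and N: "\<And>n. N n > 0"
    and \<mu>_interval: "\<And>n a b. measure (\<mu> n) {a<..b} = (\<Sum>i<N n. indicator {a<..b} (l n i)) / N n"
    and \<nu>_interval: "\<And>a b. a < b \<Longrightarrow> measure \<nu> {a<..b} = (\<integral>x. \<rho> x * indicator {a..b} x \<partial>lborel)"
    and \<rho>: "\<rho> \<in> borel_measurable borel"
    and conv: "\<And>x e. e > 0 \<Longrightarrow> (\<lambda>n. (\<Sum>i<N n. 1 / (of_real (l n i) - Complex x e)) / of_nat (N n)) \<longlonglongrightarrow> S (Complex x e)"
    and S_meas: "\<And>e. e > 0 \<Longrightarrow> (\<lambda>x. S (Complex x e)) \<in> borel_measurable borel"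
    and S_bound: "\<And>x e. e > 0 \<Longrightarrow> \<bar>Im (S (Complex x e))\<bar> \<le> B"
    and S_lim: "\<And>x. ((\<lambda>e. Im (S (Complex x e))) \<longlongrightarrow> pi * \<rho> x) (at_right 0)"
  shows "weak_conv_m \<mu> \<nu>"
proof (rule weak_conv_of_interval_liminf[OF \<mu> \<nu>])
  fix a b \<epsilon> :: real assume ab: "a < b" and \<epsilon>: "\<epsilon> > 0"
  note [measurable] = \<rho>
  have "B \<ge> 0" using S_bound[of 1 0] by linarith
  have seq: "filterlim (\<lambda>j. 1 / real (Suc j)) (at_right 0) sequentially"
    by real_asymp
  have S_seq: "(\<lambda>j. Im (S (Complex x (1 / real (Suc j))))) \<longlonglongrightarrow> pi * \<rho> x" for x
    using filterlim_compose[OF S_lim seq] .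
  have \<rho>_bound: "\<bar>\<rho> x\<bar> \<le> B / pi" for x
  proof -
    have "\<bar>pi * \<rho> x\<bar> \<le> B"
      by (rule tendsto_upperbound[OF tendsto_rabs[OF S_seq[of x]]]) (auto intro!: S_bound always_eventually)
    then show ?thesis by (simp add: abs_mult field_simps)
  qed
  have ind: "integrable lborel (indicator {p..q} :: real \<Rightarrow> real)" for p q :: real
    by (rule integrable_real_indicator) (auto simp: emeasure_lborel_Icc_eq)
  have int_ind: "integrable lborel (\<lambda>x. f x * indicator {p..q} x)"
    if "f \<in> borel_measurable borel" "\<And>x. \<bar>f x\<bar> \<le> K" for f :: "real \<Rightarrow> real" and p q K
  proof (rule Bochner_Integration.integrable_bound)
    show "integrable lborel (\<lambda>x. K * indicator {p..q} x :: real)" using ind by simp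
    show "(\<lambda>x. f x * indicator {p..q} x) \<in> borel_measurable lborel" using that(1) by measurable
    show "AE x in lborel. norm (f x * indicator {p..q} x) \<le> norm (K * indicator {p..q} x)"
      using that(2) by (auto simp: abs_mult intro!: order_trans[OF that(2)] split: split_indicator)
  qed
  \<comment> \<open>The two strips of width \<open>d\<close> lose at most \<open>2 d B / pi\<close>,
    since \<open>\<rho>\<close> is bounded by \<open>B / pi\<close>. The summand \<open>1\<close> in
    \<open>B + 1\<close> excludes division by zero.\<close>
  define d where "d = min ((b - a) / 2) (pi * \<epsilon> / (8 * (B + 1)))"
  have d: "d > 0" "2 * d \<le> b - a" and dB: "2 * d * (B / pi) \<le> \<epsilon> / 4"
  proof -
    show "d > 0" using ab \<epsilon> \<open>B \<ge> 0\<close> by (simp add: d_def)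
    have "d \<le> (b - a) / 2" unfolding d_def by (rule min.cobounded1)
    then show "2 * d \<le> b - a" by simp
    have "d \<le> pi * \<epsilon> / (8 * (B + 1))" by (simp add: d_def)
    then have "2 * d * (B / pi) \<le> 2 * (pi * \<epsilon> / (8 * (B + 1))) * (B / pi)"
      using \<open>B \<ge> 0\<close> by (intro mult_right_mono mult_left_mono) auto
    also have "\<dots> = \<epsilon> / 4 * (B / (B + 1))" using \<open>B \<ge> 0\<close> by (simp add: field_simps)
    also have "\<dots> \<le> \<epsilon> / 4 * 1" using \<open>B \<ge> 0\<close> \<epsilon> by (intro mult_left_mono) auto
    finally show "2 * d * (B / pi) \<le> \<epsilon> / 4" by simp
  qed
  have pe: "pi * (\<epsilon> / 4) > 0" using \<epsilon> by simp
  define p q where "p = a + d" and "q = b - d"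
  have pq: "p \<le> q" using d by (simp add: p_def q_def)
  have \<nu>pq: "measure \<nu> {a<..b} \<le> (\<integral>x. \<rho> x * indicator {p..q} x \<partial>lborel) + \<epsilon> / 4"
  proof -
    have "measure \<nu> {a<..b} \<le> (\<integral>x. \<rho> x * indicator {p..q} x + (B / pi * indicator {a..p} x + B / pi * indicator {q..b} x) \<partial>lborel)"
      unfolding \<nu>_interval[OF ab]
    proof (rule integral_mono)
      fix x
      have "\<rho> x \<le> B / pi" using \<rho>_bound[of x] by linarith
      moreover have "0 \<le> B / pi" using \<open>B \<ge> 0\<close> by simp
      ultimately show "\<rho> x * indicator {a..b} x \<le> \<rho> x * indicator {p..q} x + (B / pi * indicator {a..p} x + B / pi * indicator {q..b} x)"
        using d by (auto simp: p_def q_def split: split_indicator)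
    qed (intro Bochner_Integration.integrable_add int_ind[OF \<rho> \<rho>_bound] integrable_mult_right ind)+
    also have "\<dots> = (\<integral>x. \<rho> x * indicator {p..q} x \<partial>lborel) + (B / pi * d + B / pi * d)"
      using d int_ind[OF \<rho> \<rho>_bound, of p q] by (simp add: p_def q_def)
    also have "B / pi * d + B / pi * d \<le> \<epsilon> / 4" using dB by (simp add: field_simps)
    finally show ?thesis by simp
  qed
  have "(\<lambda>j. \<integral>x. Im (S (Complex x (1 / real (Suc j)))) * indicator {p..q} x \<partial>lborel) \<longlonglongrightarrow> (\<integral>x. pi * \<rho> x * indicator {p..q} x \<partial>lborel)"
  proof (rule integral_dominated_convergence[where w = "\<lambda>x. B * indicator {p..q} x"])
    show "(\<lambda>x. Im (S (Complex x (1 / real (Suc j)))) * indicator {p..q} x) \<in> borel_measurable lborel" for j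
      using S_meas[of "1 / real (Suc j)"] by measurable
    show "AE x in lborel. (\<lambda>j. Im (S (Complex x (1 / real (Suc j)))) * indicator {p..q} x) \<longlonglongrightarrow> pi * \<rho> x * indicator {p..q} x"
      by (intro AE_I2 tendsto_mult S_seq tendsto_const)
    show "AE x in lborel. norm (Im (S (Complex x (1 / real (Suc j)))) * indicator {p..q} x) \<le> B * indicator {p..q} x" for j
      by (auto intro!: AE_I2 S_bound simp: abs_mult split: split_indicator)
  qed (use ind in auto)
  from tendstoD[OF this pe] have "\<forall>\<^sub>F j in sequentially. \<bar>(\<integral>x. Im (S (Complex x (1 / real (Suc j)))) * indicator {p..q} x \<partial>lborel) - (\<integral>x. pi * \<rho> x * indicator {p..q} x \<partial>lborel)\<bar> < pi * (\<epsilon> / 4)"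
    unfolding dist_real_def .
  moreover have "\<forall>\<^sub>F j in sequentially. 1 / real (Suc j) < \<epsilon> / 4 * d"
    using order_tendstoD(2)[OF lim_1_over_n[THEN LIMSEQ_Suc], of "\<epsilon> / 4 * d"] \<epsilon> d by simp
  ultimately have "\<forall>\<^sub>F j in sequentially. \<bar>(\<integral>x. Im (S (Complex x (1 / real (Suc j)))) * indicator {p..q} x \<partial>lborel) - (\<integral>x. pi * \<rho> x * indicator {p..q} x \<partial>lborel)\<bar> < pi * (\<epsilon> / 4)
      \<and> 1 / real (Suc j) < \<epsilon> / 4 * d" by eventually_elim auto
  then obtain j where j: "\<bar>(\<integral>x. Im (S (Complex x (1 / real (Suc j)))) * indicator {p..q} x \<partial>lborel) - (\<integral>x. pi * \<rho> x * indicator {p..q} x \<partial>lborel)\<bar> < pi * (\<epsilon> / 4)"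
      "1 / real (Suc j) < \<epsilon> / 4 * d"
    by (auto simp: eventually_sequentially)
  define e where "e = 1 / real (Suc j)"
  have e: "e > 0" "e / d < \<epsilon> / 4"
    using j(2) unfolding e_def[symmetric] pos_divide_less_eq[OF d(1)] by (simp_all add: e_def)
  let ?s = "\<lambda>n z. (\<Sum>i<N n. 1 / (of_real (l n i) - z)) / of_nat (N n)"
  have int_s: "has_bochner_integral lborel (\<lambda>x. Im (?s n (Complex x e)) * indicator {p..q} x)
      ((\<Sum>i<N n. arctan ((q - l n i) / e) - arctan ((p - l n i) / e)) / N n)" for n
  proof -
    have "has_bochner_integral lborel (\<lambda>x. (\<Sum>i<N n. Im (1 / (of_real (l n i) - Complex x e)) * indicator {p..q} x) / N n)
      ((\<Sum>i<N n. arctan ((q - l n i) / e) - arctan ((p - l n i) / e)) / N n)"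
      by (intro has_bochner_integral_divide_zero has_bochner_integral_sum has_bochner_integral_poisson e pq)
    then show ?thesis by (simp add: sum_distrib_right)
  qed
  have "(\<lambda>n. \<integral>x. Im (?s n (Complex x e)) * indicator {p..q} x \<partial>lborel) \<longlonglongrightarrow> (\<integral>x. Im (S (Complex x e)) * indicator {p..q} x \<partial>lborel)"
  proof (rule integral_dominated_convergence[where w = "\<lambda>x. 1 / e * indicator {p..q} x"])
    show "(\<lambda>x. Im (S (Complex x e)) * indicator {p..q} x) \<in> borel_measurable lborel"
      using S_meas[OF e(1)] by measurable
    show "(\<lambda>x. Im (?s n (Complex x e)) * indicator {p..q} x) \<in> borel_measurable lborel" for n
      using int_s[of n] by (rule borel_measurable_has_bochner_integral)
    show "AE x in lborel. (\<lambda>n. Im (?s n (Complex x e)) * indicator {p..q} x) \<longlonglongrightarrow> Im (S (Complex x e)) * indicator {p..q} x"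
      by (intro AE_I2 tendsto_mult tendsto_Im conv e tendsto_const)
    show "AE x in lborel. norm (Im (?s n (Complex x e)) * indicator {p..q} x) \<le> 1 / e * indicator {p..q} x" for n
    proof (rule AE_I2)
      fix x
      have "\<bar>\<Sum>i<N n. e / ((l n i - x)\<^sup>2 + e\<^sup>2)\<bar> \<le> (\<Sum>i<N n. 1 / e)"
      proof (rule order_trans[OF sum_abs], rule sum_mono)
        fix i
        have "e / ((l n i - x)\<^sup>2 + e\<^sup>2) \<le> e / e\<^sup>2" using e by (intro divide_left_mono mult_pos_pos add_nonneg_pos) auto
        moreover have "0 \<le> e / ((l n i - x)\<^sup>2 + e\<^sup>2)" using e by (intro divide_nonneg_nonneg) auto
        ultimately show "\<bar>e / ((l n i - x)\<^sup>2 + e\<^sup>2)\<bar> \<le> 1 / e" using e by (simp add: power2_eq_square)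
      qed
      then have "\<bar>Im (?s n (Complex x e))\<bar> \<le> 1 / e"
        using N[of n] by (simp add: Im_inverse_shift field_simps del: one_divide_eq_0_iff)
      then show "norm (Im (?s n (Complex x e)) * indicator {p..q} x) \<le> 1 / e * indicator {p..q} x"
        by (auto simp: abs_mult simp del: Im_sum split: split_indicator)
    qed
  qed (use ind in auto)
  from tendstoD[OF this pe] have "\<forall>\<^sub>F n in sequentially. \<bar>(\<integral>x. Im (?s n (Complex x e)) * indicator {p..q} x \<partial>lborel) - (\<integral>x. Im (S (Complex x e)) * indicator {p..q} x \<partial>lborel)\<bar> < pi * (\<epsilon> / 4)"
    unfolding dist_real_def .
  then show "\<forall>\<^sub>F n in sequentially. measure (\<mu> n) {a<..b} \<ge> measure \<nu> {a<..b} - \<epsilon>"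
  proof eventually_elim
    case (elim n)
    have "(\<integral>x. Im (?s n (Complex x e)) * indicator {p..q} x \<partial>lborel) = (\<Sum>i<N n. arctan ((q - l n i) / e) - arctan ((p - l n i) / e)) / N n"
      using int_s[of n] by (rule has_bochner_integral_integral_eq)
    also have "\<dots> \<le> (\<Sum>i<N n. pi * (indicator {a<..b} (l n i) + e / d)) / N n"
      unfolding p_def q_def using pq by (intro divide_right_mono sum_mono poisson_interval_bound e d) (auto simp: p_def q_def)
    also have "\<dots> = pi * (measure (\<mu> n) {a<..b} + e / d)"
      unfolding \<mu>_interval using N[of n] by (simp add: sum.distrib sum_distrib_left[symmetric] field_simps)
    finally have 1: "(\<integral>x. Im (?s n (Complex x e)) * indicator {p..q} x \<partial>lborel) \<le> pi * (measure (\<mu> n) {a<..b} + e / d)" .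
    have "pi * (\<integral>x. \<rho> x * indicator {p..q} x \<partial>lborel) = (\<integral>x. pi * \<rho> x * indicator {p..q} x \<partial>lborel)"
      by (simp add: mult.assoc)
    also have "\<dots> < pi * (measure (\<mu> n) {a<..b} + e / d) + pi * (\<epsilon> / 4) + pi * (\<epsilon> / 4)"
      using 1 elim j(1) unfolding e_def[symmetric] by linarith
    also have "\<dots> = pi * (measure (\<mu> n) {a<..b} + e / d + \<epsilon> / 4 + \<epsilon> / 4)" by (simp add: distrib_left)
    finally have "(\<integral>x. \<rho> x * indicator {p..q} x \<partial>lborel) < measure (\<mu> n) {a<..b} + e / d + \<epsilon> / 4 + \<epsilon> / 4"
      by (simp only: mult_less_cancel_left_pos[OF pi_gt_zero])
    with \<nu>pq e(2) show ?case by linarith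
  qed
qed

section \<open>Semicircle laws and spectral measures\<close>

definition semicircle_density :: "real \<Rightarrow> real \<Rightarrow> real" where
  "semicircle_density v x = 1 / (2 * pi * v) * sqrt (4 * v - x\<^sup>2) * indicator {- 2 * sqrt v..2 * sqrt v} x"

lemma borel_measurable_semicircle_density [measurable]: "semicircle_density v \<in> borel_measurable borel"
  unfolding semicircle_density_def[abs_def] by measurable

lemma semicircle_eq_density: "semicircle 0 v = density lborel (\<lambda>x. ennreal (semicircle_density v x))"
  by (simp add: semicircle_def semicircle_density_def)

lemma abs_le_2_sqrt_iff: "v > 0 \<Longrightarrow> \<bar>x\<bar> \<le> 2 * sqrt v \<longleftrightarrow> x\<^sup>2 \<le> 4 * v"
  using abs_le_square_iff[of x "2 * sqrt v"] by (simp add: power_mult_distrib)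

lemma semicircle_density_nonneg:
  assumes v: "v > 0"
  shows "0 \<le> semicircle_density v x"
  using abs_le_2_sqrt_iff[OF v, of x] v
  by (auto simp: semicircle_density_def abs_le_iff split: split_indicator)

lemma semicircle_density_le:
  assumes v: "v > 0"
  shows "semicircle_density v x \<le> 1 / (2 * pi * v) * sqrt (4 * v)"
proof -
  have "sqrt (4 * v - x\<^sup>2) * indicator {- 2 * sqrt v..2 * sqrt v} x \<le> sqrt (4 * v)"
    using v by (auto split: split_indicator)
  then show ?thesis unfolding semicircle_density_def mult.assoc[of _ "sqrt _"] using v by (intro mult_left_mono) auto
qed

lemma integrable_semicircle_density:
  assumes v: "v > 0"
  shows "integrable lborel (semicircle_density v)"
proof (rule Bochner_Integration.integrable_bound)
  show "integrable lborel (\<lambda>x. 1 / (2 * pi * v) * sqrt (4 * v) * indicator {- 2 * sqrt v..2 * sqrt v} x :: real)"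
    by (intro integrable_mult_right integrable_real_indicator) (auto simp: emeasure_lborel_Icc_eq)
  show "AE x in lborel. norm (semicircle_density v x) \<le> norm (1 / (2 * pi * v) * sqrt (4 * v) * indicator {- 2 * sqrt v..2 * sqrt v} x :: real)"
  proof (rule AE_I2)
    fix x
    have "semicircle_density v x = semicircle_density v x * indicator {- 2 * sqrt v..2 * sqrt v} x"
      by (auto simp: semicircle_density_def split: split_indicator)
    also have "\<dots> \<le> 1 / (2 * pi * v) * sqrt (4 * v) * indicator {- 2 * sqrt v..2 * sqrt v} x"
      by (intro mult_right_mono semicircle_density_le v) auto
    finally show "norm (semicircle_density v x) \<le> norm (1 / (2 * pi * v) * sqrt (4 * v) * indicator {- 2 * sqrt v..2 * sqrt v} x :: real)"
      using semicircle_density_nonneg[OF v, of x] unfolding real_norm_def by linarith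
  qed
qed simp

text \<open>The antiderivative contains a square root and an arcsine that are not differentiable at
  the endpoints, so the fundamental theorem is used with continuity on the closed and derivatives on
  the open interval.\<close>

lemma integral_semicircle_density:
  assumes v: "v > 0"
  shows "integral\<^sup>L lborel (semicircle_density v) = 1"
proof -
  define a where "a = 2 * sqrt v"
  have a: "a > 0" "a\<^sup>2 = 4 * v" using v by (simp_all add: a_def power_mult_distrib)
  define F where "F x = 1 / (2 * pi * v) * (x * sqrt (4 * v - x\<^sup>2) / 2 + 2 * v * arcsin (x / a))" for x
  have "((\<lambda>x. 1 / (2 * pi * v) * sqrt (4 * v - x\<^sup>2)) has_integral (F a - F (- a))) {- a..a}"
  proof (rule fundamental_theorem_of_calculus_interior)
    show "- a \<le> a" using a by simp
    show "continuous_on {- a..a} F"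
      unfolding F_def using a by (intro continuous_intros) (auto simp: field_simps)
    fix x assume x: "x \<in> {- a<..<a}"
    have "\<bar>x\<bar> < \<bar>a\<bar>" using x a by auto
    then have x2: "x\<^sup>2 < 4 * v" unfolding a(2)[symmetric] by (rule power2_strict_mono)
    define s where "s = sqrt (4 * v - x\<^sup>2)"
    have s: "s > 0" "s\<^sup>2 = 4 * v - x\<^sup>2" using x2 by (simp_all add: s_def)
    have sq: "sqrt (1 - (x / a)\<^sup>2) = s / a"
    proof -
      have "1 - (x / a)\<^sup>2 = (4 * v - x\<^sup>2) / a\<^sup>2" using a v by (simp add: field_simps)
      then show ?thesis by (simp only: real_sqrt_divide s_def real_sqrt_abs abs_of_pos[OF a(1)])
    qed
    have "((\<lambda>x. x * sqrt (4 * v - x\<^sup>2) / 2 + 2 * v * arcsin (x / a)) has_real_derivative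
      (s + x * ((- (2 * x)) * (inverse s / 2))) / 2 + 2 * v * (inverse (sqrt (1 - (x / a)\<^sup>2)) * (1 / a))) (at x)"
      using x a x2 s unfolding s_def
      by (auto intro!: derivative_eq_intros simp: field_simps)
    also have "(s + x * ((- (2 * x)) * (inverse s / 2))) / 2 + 2 * v * (inverse (sqrt (1 - (x / a)\<^sup>2)) * (1 / a)) = s"
    proof -
      have "(s + x * ((- (2 * x)) * (inverse s / 2))) / 2 + 2 * v * (inverse (s / a) * (1 / a)) = (s\<^sup>2 - x\<^sup>2 + 4 * v) / (2 * s)"
        using s a by (simp add: field_simps power2_eq_square)
      also have "\<dots> = (2 * s\<^sup>2) / (2 * s)" using s by simp
      also have "\<dots> = s" using s(1) by (simp add: power2_eq_square)
      finally show ?thesis unfolding sq .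
    qed
    finally have "(F has_real_derivative 1 / (2 * pi * v) * s) (at x)"
      unfolding F_def by (rule DERIV_cmult)
    then show "(F has_vector_derivative 1 / (2 * pi * v) * sqrt (4 * v - x\<^sup>2)) (at x)"
      unfolding s_def has_real_derivative_iff_has_vector_derivative .
  qed
  moreover have "F a - F (- a) = 1"
    using a v by (simp add: F_def arcsin_minus field_simps)
  ultimately have "((\<lambda>x. 1 / (2 * pi * v) * sqrt (4 * v - x\<^sup>2)) has_integral 1) {- a..a}" by simp
  then have "((\<lambda>x. if x \<in> {- a..a} then 1 / (2 * pi * v) * sqrt (4 * v - x\<^sup>2) else 0) has_integral 1) UNIV"
    by (simp only: has_integral_restrict_UNIV)
  moreover have "(\<lambda>x. if x \<in> {- a..a} then 1 / (2 * pi * v) * sqrt (4 * v - x\<^sup>2) else 0) = semicircle_density v"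
    by (intro ext) (auto simp: semicircle_density_def a_def split: split_indicator)
  ultimately have "(semicircle_density v has_integral 1) UNIV" by simp
  moreover have "(semicircle_density v has_integral integral\<^sup>L lborel (semicircle_density v)) UNIV"
    by (rule has_integral_integral_lborel[OF integrable_semicircle_density[OF v]])
  ultimately show ?thesis by (rule has_integral_unique[symmetric])
qed

lemma emeasure_semicircle:
  assumes v: "v > 0" and A: "A \<in> sets borel"
  shows "emeasure (semicircle 0 v) A = ennreal (\<integral>x. semicircle_density v x * indicator A x \<partial>lborel)"
proof -
  have "emeasure (semicircle 0 v) A = (\<integral>\<^sup>+x. ennreal (semicircle_density v x * indicator A x) \<partial>lborel)"
    unfolding semicircle_eq_density using A
    by (subst emeasure_density) (auto intro!: nn_integral_cong split: split_indicator)
  also have "\<dots> = ennreal (\<integral>x. semicircle_density v x * indicator A x \<partial>lborel)"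
    using A integrable_real_mult_indicator[of A lborel "semicircle_density v"] integrable_semicircle_density[OF v]
      semicircle_density_nonneg[OF v]
    by (intro nn_integral_eq_integral) (auto simp: mult.commute)
  finally show ?thesis .
qed

section \<open>Mixtures of two semicircle laws\<close>

context
  fixes w1 w2 v1 v2 :: real
  assumes w: "w1 \<ge> 0" "w2 \<ge> 0" "w1 + w2 = 1" and v1: "w1 \<noteq> 0 \<Longrightarrow> v1 > 0" and v2: "v2 > 0"
begin

text \<open>The variance \<open>v1\<close> is required to be positive only for nonzero weight: for
  \<open>k = 1\<close> and \<open>k = 2\<close> the first component has weight and variance
  \<open>0\<close>, and its product with the weight vanishes on both sides.\<close>

lemma emeasure_semicircle_mixture:
  assumes A: "A \<in> sets borel"
  shows "emeasure (weighted_measure_sum [(w1, semicircle 0 v1), (w2, semicircle 0 v2)]) A =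
    ennreal (\<integral>x. (w1 * semicircle_density v1 x + w2 * semicircle_density v2 x) * indicator A x \<partial>lborel)"
proof -
  have nonneg: "0 \<le> (\<integral>x. semicircle_density v x * indicator A x \<partial>lborel)" if "v > 0" for v
    using semicircle_density_nonneg[OF that] by (intro integral_nonneg_AE AE_I2) auto
  have int: "integrable lborel (\<lambda>x. semicircle_density v x * indicator A x)" if "v > 0" for v
    using A integrable_real_mult_indicator[of A lborel "semicircle_density v"] integrable_semicircle_density[OF that]
    by (simp add: mult.commute)
  have *: "ennreal u * emeasure (semicircle 0 v) A = ennreal (u * (\<integral>x. semicircle_density v x * indicator A x \<partial>lborel))"
    and **: "integrable lborel (\<lambda>x. u * (semicircle_density v x * indicator A x))"
    and ***: "0 \<le> u * (\<integral>x. semicircle_density v x * indicator A x \<partial>lborel)"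
    if "u \<ge> 0" "u \<noteq> 0 \<Longrightarrow> v > 0" for u v
    using that nonneg[of v] emeasure_semicircle[of v A] A int[of v]
    by (cases "u = 0"; auto simp: ennreal_mult)+
  have "emeasure (weighted_measure_sum [(w1, semicircle 0 v1), (w2, semicircle 0 v2)]) A =
      ennreal w1 * emeasure (semicircle 0 v1) A + ennreal w2 * emeasure (semicircle 0 v2) A"
    by (subst emeasure_weighted_measure_sum) (use A in \<open>auto simp: semicircle_def\<close>)
  also have "\<dots> = ennreal (w1 * (\<integral>x. semicircle_density v1 x * indicator A x \<partial>lborel) + w2 * (\<integral>x. semicircle_density v2 x * indicator A x \<partial>lborel))"
    using w v1 v2 by (simp add: * *** ennreal_plus)
  also have "w1 * (\<integral>x. semicircle_density v1 x * indicator A x \<partial>lborel) + w2 * (\<integral>x. semicircle_density v2 x * indicator A x \<partial>lborel) =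
     (\<integral>x. w1 * (semicircle_density v1 x * indicator A x) + w2 * (semicircle_density v2 x * indicator A x) \<partial>lborel)"
    by (subst Bochner_Integration.integral_add[OF **[OF w(1) v1] **[OF w(2)]]) (use v2 in auto)
  finally show ?thesis by (simp add: algebra_simps)
qed

lemma real_distribution_semicircle_mixture:
  "real_distribution (weighted_measure_sum [(w1, semicircle 0 v1), (w2, semicircle 0 v2)])"
proof -
  let ?\<mu> = "weighted_measure_sum [(w1, semicircle 0 v1), (w2, semicircle 0 v2)]"
  have sp: "space ?\<mu> = UNIV" using sets_eq_imp_space_eq[OF sets_weighted_measure_sum] by simp
  have *: "integrable lborel (\<lambda>x. u * semicircle_density v x)" "(\<integral>x. u * semicircle_density v x \<partial>lborel) = u"
    if "u \<noteq> 0 \<Longrightarrow> v > 0" for u v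
    using that integrable_semicircle_density[of v] integral_semicircle_density[of v] by (cases "u = 0"; simp)+
  have "(\<integral>x. w1 * semicircle_density v1 x + w2 * semicircle_density v2 x \<partial>lborel) = w1 + w2"
    using *[of w1 v1] *[of w2 v2] v1 v2 by (subst Bochner_Integration.integral_add) auto
  then have "emeasure ?\<mu> (space ?\<mu>) = 1"
    unfolding sp by (subst emeasure_semicircle_mixture) (simp_all add: w)
  then have "prob_space ?\<mu>" by (rule prob_spaceI)
  then show ?thesis by (simp add: real_distribution_def real_distribution_axioms_def)
qed

lemma measure_semicircle_mixture:
  "measure (weighted_measure_sum [(w1, semicircle 0 v1), (w2, semicircle 0 v2)]) {a<..b} =
    (\<integral>x. (w1 * semicircle_density v1 x + w2 * semicircle_density v2 x) * indicator {a..b} x \<partial>lborel)"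
proof -
  have "measure (weighted_measure_sum [(w1, semicircle 0 v1), (w2, semicircle 0 v2)]) {a<..b} =
     (\<integral>x. (w1 * semicircle_density v1 x + w2 * semicircle_density v2 x) * indicator {a<..b} x \<partial>lborel)"
  proof (rule measure_eq_emeasure_eq_ennreal)
    have "0 \<le> w1 * semicircle_density v1 x + w2 * semicircle_density v2 x" for x
      using semicircle_density_nonneg[of v1 x] semicircle_density_nonneg[of v2 x] v1 v2 w
      by (cases "w1 = 0") auto
    then show "0 \<le> (\<integral>x. (w1 * semicircle_density v1 x + w2 * semicircle_density v2 x) * indicator {a<..b} x \<partial>lborel)"
      by (intro integral_nonneg_AE AE_I2) auto
  qed (rule emeasure_semicircle_mixture, simp)
  also have "\<dots> = (\<integral>x. (w1 * semicircle_density v1 x + w2 * semicircle_density v2 x) * indicator {a..b} x \<partial>lborel)"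
  proof (rule integral_cong_AE)
    show "AE x in lborel. (w1 * semicircle_density v1 x + w2 * semicircle_density v2 x) * indicator {a<..b} x =
        (w1 * semicircle_density v1 x + w2 * semicircle_density v2 x) * indicator {a..b} x"
      using AE_lborel_singleton[of a] by eventually_elim (auto split: split_indicator)
  qed auto
  finally show ?thesis .
qed

end

lemma sum_nth_eq_sum_list:
  fixes f :: "'a \<Rightarrow> 'b::comm_monoid_add"
  assumes "length L = N"
  shows "(\<Sum>i<N. f (L ! i)) = sum_list (map f L)"
  using assms by (simp add: sum_list_sum_nth atLeast0LessThan)

text \<open>Supplies what the inversion theorem asks of the approximating measures, for one
  enumeration \<open>l\<close> of the eigenvalues. Taking real parts is harmless because the roots
  are real, and there are \<open>N\<close> of them because the complex polynomial splits.\<close>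

lemma spectral_measure_properties:
  assumes C: "C \<in> carrier_mat N N" "hermitian_on N (\<lambda>i j. C $$ (i, j))" and N: "N > 0"
  defines "l \<equiv> \<lambda>i. hermitian_eigenvalues C ! i"
  shows "real_distribution (spectral_measure C)"
    and "measure (spectral_measure C) {a<..b} = (\<Sum>i<N. indicator {a<..b} (l i)) / N"
    and "Im z \<noteq> 0 \<Longrightarrow> (\<Sum>i<N. 1 / (of_real (l i) - z)) / of_nat N = stieltjes N (\<lambda>i j. C $$ (i, j)) z"
proof -
  let ?L = "hermitian_eigenvalues C"
  have mset: "mset ?L = image_mset Re (proots (char_poly C))"
    by (simp add: hermitian_eigenvalues_def)
  have len: "length ?L = N"
    using arg_cong[OF mset, of size] degree_monic_char_poly[OF C(1)] by (simp add: size_proots_complex)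
  have dim: "dim_row C = N" using C by simp
  have em: "emeasure (spectral_measure C) A = ennreal ((\<Sum>i<N. indicator A (l i)) / N)" if A: "A \<in> sets borel" for A
  proof -
    have "emeasure (spectral_measure C) A = sum_list (map (\<lambda>x. ennreal (1 / N) * emeasure (return borel x) A) ?L)"
      unfolding spectral_measure_def dim using A by (subst emeasure_weighted_measure_sum) (auto simp: comp_def)
    also have "\<dots> = (\<Sum>i<N. ennreal (1 / N) * emeasure (return borel (l i)) A)" unfolding l_def by (rule sum_nth_eq_sum_list[OF len, symmetric])
    also have "\<dots> = (\<Sum>i<N. ennreal (indicator A (l i) / N))"
      using A by (intro sum.cong refl) (auto split: split_indicator)
    also have "\<dots> = ennreal ((\<Sum>i<N. indicator A (l i)) / N)"
      unfolding sum_divide_distrib by (intro sum_ennreal) auto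
    finally show ?thesis .
  qed
  have sp: "space (spectral_measure C) = UNIV"
    using sets_eq_imp_space_eq[OF sets_weighted_measure_sum] by (simp add: spectral_measure_def)
  have "emeasure (spectral_measure C) (space (spectral_measure C)) = 1"
    unfolding sp using N by (subst em) auto
  then have "prob_space (spectral_measure C)" by (rule prob_spaceI)
  then show "real_distribution (spectral_measure C)"
    by (simp add: real_distribution_def real_distribution_axioms_def spectral_measure_def)
  show "measure (spectral_measure C) {a<..b} = (\<Sum>i<N. indicator {a<..b} (l i)) / N"
    by (rule measure_eq_emeasure_eq_ennreal) (auto intro!: sum_nonneg divide_nonneg_nonneg simp: em)
  assume z: "Im z \<noteq> 0"
  have "(\<Sum>i<N. 1 / (of_real (l i) - z)) = (\<Sum>x\<in>#mset ?L. 1 / (of_real x - z))"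
    unfolding l_def by (subst sum_nth_eq_sum_list[OF len]) (simp only: sum_mset_sum_list[symmetric] mset_map)
  also have "\<dots> = (\<Sum>x\<in>#proots (char_poly C). 1 / (of_real (Re x) - z))"
    unfolding mset by (simp add: image_mset.compositionality comp_def)
  also have "\<dots> = (\<Sum>x\<in>#proots (char_poly C). 1 / (x - z))"
  proof (intro arg_cong[where f = sum_mset] image_mset_cong)
    fix x assume "x \<in># proots (char_poly C)"
    then have "Im x = 0" by (rule hermitian_char_poly_roots_real[OF C])
    then have "of_real (Re x) = x" by (simp add: complex_eq_iff)
    then show "1 / (of_real (Re x) - z) = 1 / (x - z)" by simp
  qed
  also have "\<dots> = (\<Sum>i<N. resolvent N (\<lambda>i j. C $$ (i, j)) z i i)"
    by (rule trace_resolvent_eq_sum_roots[OF C z, symmetric])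
  finally show "(\<Sum>i<N. 1 / (of_real (l i) - z)) / of_nat N = stieltjes N (\<lambda>i j. C $$ (i, j)) z"
    by (simp add: stieltjes_def)
qed

section \<open>Joint independence of the arrays\<close>

text \<open>A finite index set is split by group. Within group \<open>a\<close> the constraints form
  one cylinder event \<open>D a\<close>; independence between groups factorises the cylinders, and
  independence inside each group factorises the cylinder itself.\<close>

lemma (in prob_space) indep_vars_UN_nested:
  assumes outer: "indep_vars (\<lambda>a. Pi\<^sub>M (K a) M') (\<lambda>a \<omega>. \<lambda>i\<in>K a. X i \<omega>) A"
    and inner: "\<And>a. a \<in> A \<Longrightarrow> indep_vars M' X (K a)"
    and disj: "disjoint_family_on K A"
  shows "indep_vars M' X (\<Union>a\<in>A. K a)"
  unfolding indep_vars_def2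
proof (intro conjI ballI)
  show rv: "random_variable (M' i) (X i)" if "i \<in> (\<Union>a\<in>A. K a)" for i
    using that inner by (auto simp: indep_vars_def2)
  show "indep_sets (\<lambda>i. {X i -` B \<inter> space M |B. B \<in> sets (M' i)}) (\<Union>a\<in>A. K a)"
  proof (rule indep_setsI)
    fix i assume "i \<in> (\<Union>a\<in>A. K a)"
    from rv[OF this] show "{X i -` B \<inter> space M |B. B \<in> sets (M' i)} \<subseteq> events"
      by (auto intro: measurable_sets)
  next
    fix S J assume J: "J \<noteq> {}" "J \<subseteq> (\<Union>a\<in>A. K a)" "finite J"
      and S: "\<forall>j\<in>J. S j \<in> {X j -` B \<inter> space M |B. B \<in> sets (M' j)}"
    then have "\<forall>j\<in>J. \<exists>B. S j = X j -` B \<inter> space M \<and> B \<in> sets (M' j)" by blast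
    then obtain B where B: "\<And>j. j \<in> J \<Longrightarrow> S j = X j -` B j \<inter> space M" "\<And>j. j \<in> J \<Longrightarrow> B j \<in> sets (M' j)"
      by metis
    have "\<forall>j\<in>J. \<exists>a. a \<in> A \<and> j \<in> K a" using J(2) by blast
    then obtain g where g: "\<And>j. j \<in> J \<Longrightarrow> g j \<in> A" "\<And>j. j \<in> J \<Longrightarrow> j \<in> K (g j)"
      by metis
    define T where "T a = {j \<in> J. g j = a}" for a
    have T: "finite (T a)" "T a \<subseteq> K a" for a using J(3) g(2) by (auto simp: T_def)
    have T_sub: "T a \<subseteq> J" for a by (auto simp: T_def)
    define D where "D a = {f \<in> space (Pi\<^sub>M (K a) M'). \<forall>j\<in>T a. f j \<in> B j}" for a
    have D: "D a \<in> sets (Pi\<^sub>M (K a) M')" for a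
    proof -
      have "{f \<in> space (Pi\<^sub>M (K a) M'). f j \<in> B j} \<in> sets (Pi\<^sub>M (K a) M')" if "j \<in> T a" for j
        using measurable_sets[OF measurable_component_singleton[of j "K a" M'], of "B j"] that T B(2)
        by (auto simp: T_def vimage_def Int_def conj_commute)
      then show ?thesis unfolding D_def using T(1) by (intro sets.sets_Collect_finite_All) auto
    qed
    let ?Y = "\<lambda>a \<omega>. \<lambda>i\<in>K a. X i \<omega>"
    have Y: "?Y a -` D a \<inter> space M = (\<Inter>j\<in>T a. S j) \<inter> space M" if "a \<in> A" for a
    proof -
      have "random_variable (Pi\<^sub>M (K a) M') (?Y a)" using outer that by (auto simp: indep_vars_def2)
      from measurable_space[OF this] show ?thesis
        using T(2)[of a] B(1) by (auto simp: D_def T_def)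
    qed
    have ne: "T a \<noteq> {}" if "a \<in> g ` J" for a using that by (auto simp: T_def)
    have "prob (\<Inter>j\<in>J. S j) = prob (\<Inter>a\<in>g ` J. ?Y a -` D a \<inter> space M)"
    proof (rule arg_cong[where f = prob])
      have "(\<Inter>a\<in>g ` J. ?Y a -` D a \<inter> space M) = (\<Inter>a\<in>g ` J. (\<Inter>j\<in>T a. S j) \<inter> space M)"
        using g(1) Y by (intro INF_cong refl) auto
      also have "\<dots> = (\<Inter>j\<in>J. S j)"
      proof (intro equalityI subsetI)
        fix \<omega> assume \<omega>: "\<omega> \<in> (\<Inter>j\<in>J. S j)"
        obtain j where "j \<in> J" using J(1) by auto
        then have "\<omega> \<in> space M" using \<omega> B(1)[of j] by auto
        then show "\<omega> \<in> (\<Inter>a\<in>g ` J. (\<Inter>j\<in>T a. S j) \<inter> space M)" using \<omega> by (auto simp: T_def)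
      next
        fix \<omega> assume \<omega>: "\<omega> \<in> (\<Inter>a\<in>g ` J. (\<Inter>j\<in>T a. S j) \<inter> space M)"
        show "\<omega> \<in> (\<Inter>j\<in>J. S j)"
        proof
          fix j assume j: "j \<in> J"
          then have "\<omega> \<in> (\<Inter>j\<in>T (g j). S j)" using \<omega> by blast
          with j show "\<omega> \<in> S j" by (auto simp: T_def)
        qed
      qed
      finally show "(\<Inter>j\<in>J. S j) = (\<Inter>a\<in>g ` J. ?Y a -` D a \<inter> space M)" ..
    qed
    also have "\<dots> = (\<Prod>a\<in>g ` J. prob (?Y a -` D a \<inter> space M))"
      using J g(1) D by (intro indep_varsD[OF outer]) auto
    also have "\<dots> = (\<Prod>a\<in>g ` J. \<Prod>j\<in>T a. prob (S j))"
    proof (rule prod.cong[OF refl])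
      fix a assume a: "a \<in> g ` J"
      then have aA: "a \<in> A" using g(1) by auto
      have "?Y a -` D a \<inter> space M = (\<Inter>j\<in>T a. X j -` B j \<inter> space M)"
        unfolding Y[OF aA] using ne[OF a] B(1) by (auto simp: T_def)
      then have "prob (?Y a -` D a \<inter> space M) = (\<Prod>j\<in>T a. prob (X j -` B j \<inter> space M))"
        using indep_varsD[OF inner[OF aA] ne[OF a] T, of B] B(2)[OF T_sub[THEN subsetD]] by metis
      then show "prob (?Y a -` D a \<inter> space M) = (\<Prod>j\<in>T a. prob (S j))"
        using B(1) by (simp add: T_def)
    qed
    also have "\<dots> = (\<Prod>j\<in>J. prob (S j))"
      unfolding T_def using J(3) by (intro prod.group) auto
    finally show "prob (\<Inter>j\<in>J. S j) = (\<Prod>j\<in>J. prob (S j))" .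
  qed
qed

lemma (in prob_space) indep_vars_reindex_image:
  assumes indep: "indep_vars (\<lambda>i. M' (f i)) (\<lambda>i. X (f i)) I" and inj: "inj_on f I"
  shows "indep_vars M' X (f ` I)"
  unfolding indep_vars_def2
proof (intro conjI ballI)
  show rv: "random_variable (M' i) (X i)" if "i \<in> f ` I" for i
    using that indep by (auto simp: indep_vars_def2)
  show "indep_sets (\<lambda>i. {X i -` B \<inter> space M |B. B \<in> sets (M' i)}) (f ` I)"
  proof (rule indep_setsI)
    fix i assume "i \<in> f ` I"
    from rv[OF this] show "{X i -` B \<inter> space M |B. B \<in> sets (M' i)} \<subseteq> events"
      by (auto intro: measurable_sets)
  next
    fix S J assume J: "J \<noteq> {}" "J \<subseteq> f ` I" "finite J"
      and S: "\<forall>j\<in>J. S j \<in> {X j -` B \<inter> space M |B. B \<in> sets (M' j)}"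
    then obtain J' where J': "J' \<subseteq> I" "J = f ` J'" "inj_on f J'"
      by (metis inj inj_on_subset subset_image_iff)
    then have "finite J'" using J(3) finite_imageD by blast
    have "prob (\<Inter>j\<in>J'. S (f j)) = (\<Prod>j\<in>J'. prob (S (f j)))"
      using indep J J' S \<open>finite J'\<close> unfolding indep_vars_def2
      by (intro indep_setsD[of "\<lambda>i. {X (f i) -` B \<inter> space M |B. B \<in> sets (M' (f i))}" I]) auto
    then show "prob (\<Inter>j\<in>J. S j) = (\<Prod>j\<in>J. prob (S j))"
      using J' by (simp add: prod.reindex)
  qed
qed

text \<open>Nested independence with two groups, the off-diagonal and the diagonal positions,
  indexed by the booleans.\<close>

lemma (in prob_space) wigner_array_indep:
  assumes "wigner_array v X"
  shows "indep_vars (\<lambda>_. borel) (\<lambda>(i, j). X i j) {(i, j). i \<le> j}"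
proof -
  let ?off = "{(i, j). i < j} :: (nat \<times> nat) set" and ?diag = "{(i, j). i = j} :: (nat \<times> nat) set"
  let ?X = "\<lambda>(i, j). X i j"
  note w = assms[unfolded wigner_array_def]
  have off: "indep_vars (\<lambda>_. borel) ?X ?off" using w by blast
  have "indep_vars (\<lambda>i. borel) (\<lambda>i. ?X (i, i)) UNIV" using w by simp
  then have "indep_vars (\<lambda>_. borel) ?X (range (\<lambda>i. (i, i)))"
    by (intro indep_vars_reindex_image) (auto simp: inj_on_def)
  also have "range (\<lambda>i. (i, i)) = ?diag" by auto
  finally have diag: "indep_vars (\<lambda>_. borel) ?X ?diag" .
  have eq: "(\<lambda>\<omega>. \<lambda>(i, j)\<in>K. X i j \<omega>) = (\<lambda>\<omega>. \<lambda>k\<in>K. ?X k \<omega>)" for K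
    by (intro ext) (auto simp: restrict_def)
  have "indep_var (Pi\<^sub>M ?off (\<lambda>_. borel)) (\<lambda>\<omega>. \<lambda>(i, j)\<in>?off. X i j \<omega>) (Pi\<^sub>M ?diag (\<lambda>_. borel)) (\<lambda>\<omega>. \<lambda>(i, j)\<in>?diag. X i j \<omega>)"
    using w by blast
  then have "indep_var (Pi\<^sub>M ?off (\<lambda>_. borel)) (\<lambda>\<omega>. \<lambda>k\<in>?off. ?X k \<omega>) (Pi\<^sub>M ?diag (\<lambda>_. borel)) (\<lambda>\<omega>. \<lambda>k\<in>?diag. ?X k \<omega>)"
    unfolding eq .
  then have "indep_vars (\<lambda>b. Pi\<^sub>M (case_bool ?off ?diag b) (\<lambda>_. borel)) (\<lambda>b \<omega>. \<lambda>k\<in>case_bool ?off ?diag b. ?X k \<omega>) UNIV"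
    unfolding indep_var_def by (rule indep_vars_cong[THEN iffD1, rotated -1]) (auto split: bool.split)
  then have "indep_vars (\<lambda>_. borel) ?X (\<Union>b\<in>UNIV. case_bool ?off ?diag b)"
    by (rule indep_vars_UN_nested) (use off diag in \<open>auto simp: disjoint_family_on_def split: bool.split\<close>)
  also have "(\<Union>b\<in>UNIV. case_bool ?off ?diag b) = {(i, j). i \<le> j}"
    by (auto simp: UNIV_bool)
  finally show ?thesis .
qed

lemma (in prob_space) wigner_family_of_arrays:
  assumes R: "finite R" and wig: "\<And>r. r \<in> R \<Longrightarrow> wigner_array 1 (X r)"
    and indep: "indep_vars (\<lambda>_. Pi\<^sub>M UNIV (\<lambda>_. borel)) (\<lambda>r \<omega> (i, j). X r i j \<omega>) R"
  shows "wigner_family M R X"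
proof (rule wigner_family.intro[OF prob_space_axioms wigner_family_axioms.intro])
  show "indep_vars (\<lambda>_. borel) (\<lambda>(r, i, j). X r i j) {(r, i, j). r \<in> R \<and> i \<le> j}"
  proof -
    let ?X = "\<lambda>(r, i, j). X r i j"
    \<comment> \<open>Independence of whole arrays is projected to the upper triangles; the lower
      ones are their conjugates and hence cannot be independent of them in general.\<close>
    define K where "K r = Pair r ` {(i :: nat, j :: nat). i \<le> j}" for r :: 'b
    have "indep_vars (\<lambda>r. Pi\<^sub>M (K r) (\<lambda>_. borel)) (\<lambda>r \<omega>. (\<lambda>k\<in>K r. (\<lambda>(i, j). X r i j \<omega>) (snd k))) R"
    proof (rule indep_vars_compose2[OF indep])
      show "(\<lambda>f. \<lambda>k\<in>K r. f (snd k)) \<in> measurable (Pi\<^sub>M UNIV (\<lambda>_. borel)) (Pi\<^sub>M (K r) (\<lambda>_. borel))" for r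
        by (intro measurable_restrict measurable_component_singleton) auto
    qed
    also have "(\<lambda>r \<omega>. (\<lambda>k\<in>K r. (\<lambda>(i, j). X r i j \<omega>) (snd k))) = (\<lambda>r \<omega>. \<lambda>k\<in>K r. ?X k \<omega>)"
      by (intro ext) (auto simp: restrict_def K_def)
    finally have "indep_vars (\<lambda>_. borel) ?X (\<Union>r\<in>R. K r)"
    proof (rule indep_vars_UN_nested)
      fix r assume r: "r \<in> R"
      then have "indep_vars (\<lambda>_. borel) (\<lambda>p. ?X (Pair r p)) {(i, j). i \<le> j}"
        using wigner_array_indep[OF wig[OF r]] by simp
      then show "indep_vars (\<lambda>_. borel) ?X (K r)"
        unfolding K_def by (rule indep_vars_reindex_image) (auto simp: inj_on_def)
    qed (auto simp: disjoint_family_on_def K_def)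
    also have "(\<Union>r\<in>R. K r) = {(r, i, j). r \<in> R \<and> i \<le> j}" by (auto simp: K_def)
    finally show ?thesis .
  qed
qed (use R wig[unfolded wigner_array_def] in blast)+

section \<open>Block circulant matrices\<close>

definition unit_root :: "nat \<Rightarrow> int \<Rightarrow> complex" where
  "unit_root k d = cis (2 * pi * real_of_int d / real k)"

lemma unit_root_0 [simp]: "unit_root k 0 = 1"
  by (simp add: unit_root_def)

lemma unit_root_add: "unit_root k (d + e) = unit_root k d * unit_root k e"
  by (simp add: unit_root_def cis_mult distrib_left add_divide_distrib)

lemma unit_root_minus: "unit_root k (- d) = cnj (unit_root k d)"
  by (simp add: unit_root_def cis_cnj)

lemma Re_unit_root: "Re (unit_root k d) = cos (2 * pi * real_of_int d / real k)"
  by (simp add: unit_root_def)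

lemma unit_root_eq_1_iff:
  assumes k: "k > 0"
  shows "unit_root k d = 1 \<longleftrightarrow> int k dvd d"
proof
  assume "unit_root k d = 1"
  then have "cos (2 * pi * real_of_int d / real k) = 1" by (simp flip: Re_unit_root)
  then obtain m :: int where "2 * pi * real_of_int d / real k = real_of_int m * 2 * pi"
    unfolding cos_one_2pi_int by blast
  then have "real_of_int d = real_of_int (m * int k)" using k by (simp add: field_simps)
  then have "d = m * int k" by (simp only: of_int_eq_iff)
  then show "int k dvd d" by simp
next
  assume "int k dvd d"
  then obtain m where "d = int k * m" by blast
  then have "2 * pi * real_of_int d / real k = 2 * pi * real_of_int m" using k by simp
  moreover have "cis (2 * pi * real_of_int m) = 1" by (rule cis_multiple_2pi) simp
  ultimately show "unit_root k d = 1" by (simp add: unit_root_def)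
qed

lemma sum_unit_root:
  assumes k: "k > 0"
  shows "(\<Sum>l<k. unit_root k (int l * d)) = (if int k dvd d then of_nat k else 0)"
proof -
  have pow: "unit_root k (int l * d) = unit_root k d ^ l" for l
    by (induction l) (simp_all add: distrib_right unit_root_add)
  show ?thesis
  proof (cases "int k dvd d")
    case True
    then have one: "unit_root k d = 1" using unit_root_eq_1_iff[OF k] by simp
    have "(\<Sum>l<k. unit_root k (int l * d)) = (\<Sum>l<k. 1)"
      by (intro sum.cong refl) (simp add: pow one)
    then show ?thesis using True by simp
  next
    case False
    then have "unit_root k d \<noteq> 1" using unit_root_eq_1_iff[OF k] by simp
    moreover have "unit_root k d ^ k = 1" unfolding pow[symmetric] using unit_root_eq_1_iff[OF k] by simp
    ultimately show ?thesis using False by (simp add: pow geometric_sum)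
  qed
qed

lemma sum_blocks: "(\<Sum>m<n * k. f m) = (\<Sum>p<k. \<Sum>t<n. f (p * n + t))"
  for f :: "nat \<Rightarrow> 'b::comm_monoid_add"
proof -
  have "(\<Sum>m<n * k. f m) = (\<Sum>p<k. sum f {p * n..<p * n + n})"
    by (simp add: sum.nat_group mult.commute)
  also have "\<dots> = (\<Sum>p<k. \<Sum>t<n. f (p * n + t))"
  proof (rule sum.cong[OF refl])
    fix p
    have "sum f {p * n..<p * n + n} = sum f {0 + p * n..<n + p * n}" by (simp add: add.commute)
    also have "\<dots> = (\<Sum>t<n. f (p * n + t))"
      unfolding sum.shift_bounds_nat_ivl by (simp add: atLeast0LessThan add.commute)
    finally show "sum f {p * n..<p * n + n} = (\<Sum>t<n. f (p * n + t))" .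
  qed
  finally show ?thesis .
qed

lemma dvd_diff_less_iff: "i < k \<Longrightarrow> j < k \<Longrightarrow> int k dvd (int i - int j) \<longleftrightarrow> i = j"
  using zdvd_imp_le[of "int k" "int i - int j"] zdvd_imp_le[of "int k" "int j - int i"]
  by (cases i j rule: linorder_cases) (auto simp: dvd_diff_commute)

context
  fixes n k :: nat and B :: "nat \<Rightarrow> nat \<Rightarrow> nat \<Rightarrow> complex" and C :: "nat \<Rightarrow> nat \<Rightarrow> complex"
  assumes n: "n > 0" and k: "k > 0"
    and B: "\<And>l. l < k \<Longrightarrow> hermitian_on n (B l)"
    and C: "\<And>i j. i < n * k \<Longrightarrow> j < n * k \<Longrightarrow>
      C i j = (\<Sum>l<k. unit_root k (int l * (int (i div n) - int (j div n))) * B l (i mod n) (j mod n)) / of_nat k"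
begin

lemma hermitian_block_circulant: "hermitian_on (n * k) C"
  unfolding hermitian_on_def
proof (intro allI impI)
  fix i j assume ij: "i < n * k" "j < n * k"
  have "unit_root k (int l * (int (j div n) - int (i div n))) * B l (j mod n) (i mod n) =
      cnj (unit_root k (int l * (int (i div n) - int (j div n))) * B l (i mod n) (j mod n))" if "l < k" for l
  proof -
    have "int l * (int (j div n) - int (i div n)) = - (int l * (int (i div n) - int (j div n)))"
      by (simp add: algebra_simps)
    moreover have "B l (j mod n) (i mod n) = cnj (B l (i mod n) (j mod n))"
      using n by (intro hermitian_onD[OF B[OF that]]) auto
    ultimately show ?thesis by (simp add: unit_root_minus)
  qed
  then show "C j i = cnj (C i j)" unfolding C[OF ij] C[OF ij(2,1)] by simp
qed

text \<open>The discrete Fourier transform in the block index diagonalises \<open>C\<close>, hence the blocks of its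
  resolvent are the inverse Fourier transform of the resolvents of the \<open>B l\<close>.\<close>

lemma stieltjes_block_circulant:
  assumes z: "Im z \<noteq> 0"
  shows "stieltjes (n * k) C z = (\<Sum>l<k. stieltjes n (B l) z) / of_nat k"
proof -
  let ?G = "\<lambda>l. resolvent n (B l) z"
  define Q where "Q i j = (\<Sum>l<k. unit_root k (int l * (int (i div n) - int (j div n))) * ?G l (i mod n) (j mod n)) / of_nat k" for i j
  have "resolvent (n * k) C z i j = Q i j" if "i < n * k" "j < n * k" for i j
    using hermitian_block_circulant z _ that
  proof (rule resolvent_unique)
    fix i j assume ij: "i < n * k" "j < n * k"
    let ?i = "i mod n" and ?j = "j mod n" and ?I = "i div n" and ?J = "j div n"
    have lt: "?i < n" "?j < n" "?I < k" "?J < k"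
      using n ij by (simp_all add: less_mult_imp_div_less mult.commute)
    have CQ: "C i (p * n + t) * Q (p * n + t) j =
        (\<Sum>l<k. \<Sum>l'<k. unit_root k (int l * int ?I - int l' * int ?J) * unit_root k (int p * (int l' - int l)) * (B l ?i t * ?G l' t ?j)) / (of_nat k * of_nat k)"
      if pt: "p < k" "t < n" for p t
    proof -
      have m: "(p * n + t) div n = p" "(p * n + t) mod n = t" using pt by simp_all
      have "p * n + t < n * k"
      proof -
        have "p * n + t < Suc p * n" using pt by simp
        also have "\<dots> \<le> k * n" using pt by (intro mult_le_mono1) simp
        finally show ?thesis by (simp add: mult.commute)
      qed
      then have "C i (p * n + t) * Q (p * n + t) j =
          ((\<Sum>l<k. unit_root k (int l * (int ?I - int p)) * B l ?i t) * (\<Sum>l<k. unit_root k (int l * (int p - int ?J)) * ?G l t ?j)) / (of_nat k * of_nat k)"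
        using C[OF ij(1), of "p * n + t"] pt by (simp add: Q_def m)
      also have "(\<Sum>l<k. unit_root k (int l * (int ?I - int p)) * B l ?i t) * (\<Sum>l<k. unit_root k (int l * (int p - int ?J)) * ?G l t ?j) =
         (\<Sum>l<k. \<Sum>l'<k. unit_root k (int l * int ?I - int l' * int ?J) * unit_root k (int p * (int l' - int l)) * (B l ?i t * ?G l' t ?j))"
        unfolding sum_product
      proof (intro sum.cong refl)
        fix l l'
        have "unit_root k (int l * (int ?I - int p)) * unit_root k (int l' * (int p - int ?J)) =
            unit_root k (int l * int ?I - int l' * int ?J) * unit_root k (int p * (int l' - int l))"
          unfolding unit_root_add[symmetric] by (simp add: algebra_simps)
        then have "unit_root k (int l * (int ?I - int p)) * unit_root k (int l' * (int p - int ?J)) * (B l ?i t * ?G l' t ?j) =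
            unit_root k (int l * int ?I - int l' * int ?J) * unit_root k (int p * (int l' - int l)) * (B l ?i t * ?G l' t ?j)"
          by (simp only:)
        then show "unit_root k (int l * (int ?I - int p)) * B l ?i t * (unit_root k (int l' * (int p - int ?J)) * ?G l' t ?j) =
            unit_root k (int l * int ?I - int l' * int ?J) * unit_root k (int p * (int l' - int l)) * (B l ?i t * ?G l' t ?j)"
          by (simp only: mult_ac)
      qed
      finally show ?thesis .
    qed
    have "(\<Sum>m<n * k. C i m * Q m j) = (\<Sum>p<k. \<Sum>t<n. C i (p * n + t) * Q (p * n + t) j)"
      by (rule sum_blocks)
    also have "\<dots> = (\<Sum>p<k. \<Sum>t<n. (\<Sum>l<k. \<Sum>l'<k. unit_root k (int l * int ?I - int l' * int ?J) * unit_root k (int p * (int l' - int l)) * (B l ?i t * ?G l' t ?j)) / (of_nat k * of_nat k))"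
      by (intro sum.cong refl CQ) auto
    also have "\<dots> = (\<Sum>p<k. \<Sum>t<n. (\<Sum>l<k. \<Sum>l'<k. unit_root k (int l * int ?I - int l' * int ?J) * unit_root k (int p * (int l' - int l)) * (B l ?i t * ?G l' t ?j))) / (of_nat k * of_nat k)"
      by (simp only: sum_divide_distrib[symmetric])
    also have "(\<Sum>p<k. \<Sum>t<n. (\<Sum>l<k. \<Sum>l'<k. unit_root k (int l * int ?I - int l' * int ?J) * unit_root k (int p * (int l' - int l)) * (B l ?i t * ?G l' t ?j))) =
        (\<Sum>l<k. \<Sum>l'<k. unit_root k (int l * int ?I - int l' * int ?J) * (\<Sum>p<k. unit_root k (int p * (int l' - int l))) * (\<Sum>t<n. B l ?i t * ?G l' t ?j))"
    proof -
      have "(\<Sum>p<k. \<Sum>t<n. (\<Sum>l<k. \<Sum>l'<k. f l l' * g p l l' * h t l l')) = (\<Sum>l<k. \<Sum>l'<k. f l l' * (\<Sum>p<k. g p l l') * (\<Sum>t<n. h t l l'))"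
        for f :: "nat \<Rightarrow> nat \<Rightarrow> complex" and g h
      proof -
        have "(\<Sum>p<k. \<Sum>t<n. (\<Sum>l<k. \<Sum>l'<k. f l l' * g p l l' * h t l l')) = (\<Sum>p<k. \<Sum>l<k. \<Sum>t<n. \<Sum>l'<k. f l l' * g p l l' * h t l l')"
          by (rule sum.cong[OF refl], rule sum.swap)
        also have "\<dots> = (\<Sum>l<k. \<Sum>p<k. \<Sum>t<n. \<Sum>l'<k. f l l' * g p l l' * h t l l')"
          by (rule sum.swap)
        also have "\<dots> = (\<Sum>l<k. \<Sum>p<k. \<Sum>l'<k. \<Sum>t<n. f l l' * g p l l' * h t l l')"
          by (rule sum.cong[OF refl], rule sum.cong[OF refl], rule sum.swap)
        also have "\<dots> = (\<Sum>l<k. \<Sum>l'<k. \<Sum>p<k. \<Sum>t<n. f l l' * g p l l' * h t l l')"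
          by (rule sum.cong[OF refl], rule sum.swap)
        also have "\<dots> = (\<Sum>l<k. \<Sum>l'<k. f l l' * (\<Sum>p<k. g p l l') * (\<Sum>t<n. h t l l'))"
          by (rule sum.cong[OF refl], rule sum.cong[OF refl])
             (simp only: mult.assoc, simp only: sum_product, simp only: sum_distrib_left)
        finally show ?thesis .
      qed
      then show ?thesis .
    qed
    \<comment> \<open>Summation over the block index \<open>p\<close> forces \<open>l' = l\<close>
      by orthogonality of characters; the sum over \<open>t\<close> is then an entry of
      \<open>B l\<close> times its own resolvent.\<close>
    also have "\<dots> = (\<Sum>l<k. \<Sum>l'<k. if l' = l then of_nat k * (unit_root k (int l * (int ?I - int ?J)) * (z * ?G l ?i ?j + (if ?i = ?j then 1 else 0))) else 0)"
    proof (intro sum.cong refl)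
      fix l l' assume l: "l \<in> {..<k}" "l' \<in> {..<k}"
      have "(\<Sum>p<k. unit_root k (int p * (int l' - int l))) = (if l' = l then of_nat k else 0)"
        using l unfolding sum_unit_root[OF k] by (simp add: dvd_diff_less_iff)
      moreover have "(\<Sum>t<n. B l ?i t * ?G l t ?j) = z * ?G l ?i ?j + (if ?i = ?j then 1 else 0)"
        using l lt z by (intro resolvent_right B) auto
      ultimately show "unit_root k (int l * int ?I - int l' * int ?J) * (\<Sum>p<k. unit_root k (int p * (int l' - int l))) * (\<Sum>t<n. B l ?i t * ?G l' t ?j) =
          (if l' = l then of_nat k * (unit_root k (int l * (int ?I - int ?J)) * (z * ?G l ?i ?j + (if ?i = ?j then 1 else 0))) else 0)"
        by (cases "l' = l") (simp_all add: right_diff_distrib)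
    qed
    also have "\<dots> = of_nat k * (\<Sum>l<k. unit_root k (int l * (int ?I - int ?J)) * (z * ?G l ?i ?j + (if ?i = ?j then 1 else 0)))"
      by (simp add: sum_distrib_left)
    also have "\<dots> / (of_nat k * of_nat k) = (\<Sum>l<k. unit_root k (int l * (int ?I - int ?J)) * (z * ?G l ?i ?j + (if ?i = ?j then 1 else 0))) / of_nat k"
      using k by simp
    also have "\<dots> = z * Q i j + (if ?i = ?j then 1 else 0) * ((\<Sum>l<k. unit_root k (int l * (int ?I - int ?J))) / of_nat k)"
      by (simp add: Q_def distrib_left sum.distrib sum_distrib_left sum_distrib_right add_divide_distrib mult_ac)
    also have "(\<Sum>l<k. unit_root k (int l * (int ?I - int ?J))) / of_nat k = (if ?I = ?J then 1 else 0)"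
      unfolding sum_unit_root[OF k] using lt k by (simp add: dvd_diff_less_iff)
    also have "(if ?i = ?j then 1 else 0) * (if ?I = ?J then 1 else 0) = (if i = j then 1 else 0 :: complex)"
    proof -
      have "i = j \<longleftrightarrow> ?i = ?j \<and> ?I = ?J" by (metis div_mult_mod_eq)
      then show ?thesis by auto
    qed
    finally show "(\<Sum>m<n * k. C i m * Q m j) = z * Q i j + (if i = j then 1 else 0)" .
  qed
  then have "(\<Sum>i<n * k. resolvent (n * k) C z i i) = (\<Sum>i<n * k. Q i i)" by simp
  also have "\<dots> = (\<Sum>p<k. \<Sum>t<n. Q (p * n + t) (p * n + t))" by (rule sum_blocks)
  also have "\<dots> = (\<Sum>p<k. \<Sum>t<n. (\<Sum>l<k. ?G l t t) / of_nat k)"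
    by (intro sum.cong refl) (simp add: Q_def)
  also have "\<dots> = (\<Sum>t<n. \<Sum>l<k. ?G l t t)" using k by (simp add: sum_divide_distrib[symmetric])
  also have "\<dots> = (\<Sum>l<k. \<Sum>t<n. ?G l t t)" by (rule sum.swap)
  finally show ?thesis using n k by (simp add: stieltjes_def sum_divide_distrib[symmetric])
qed

end

text \<open>The letter at cyclic offset \<open>q\<close>: offsets count from \<open>0\<close>,
  letters from \<open>1\<close>, so this is \<open>a (q + 1)\<close> after the identification of
  \<open>a j\<close> with \<open>a (k - j + 2)\<close>. Offsets \<open>q\<close> and
  \<open>k - q\<close> therefore agree.\<close>

definition sym_letter :: "nat \<Rightarrow> nat \<Rightarrow> nat" where
  "sym_letter k q = (if q + 1 \<le> k div 2 + 1 then q + 1 else k - (q + 1) + 2)"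

lemma sym_letter_range: "q < k \<Longrightarrow> sym_letter k q \<in> {1..k div 2 + 1}"
  by (auto simp: sym_letter_def)

lemma sym_letter_eq_iff:
  assumes "q < k" "q' < k"
  shows "sym_letter k q = sym_letter k q' \<longleftrightarrow> q' = q \<or> q + q' = k"
  using assms unfolding sym_letter_def by (auto split: if_splits; presburger)

text \<open>Coefficient of the letter \<open>r\<close> in the \<open>l\<close>-th Fourier block of the symmetric circulant.\<close>

definition circ_coeff :: "nat \<Rightarrow> nat \<Rightarrow> nat \<Rightarrow> real" where
  "circ_coeff k l r = (\<Sum>q<k. if sym_letter k q = r then cos (2 * pi * real l * real q / real k) else 0) / sqrt (real k)"

lemma sum_circ_coeff:
  fixes Y :: "nat \<Rightarrow> complex"
  shows "(\<Sum>r\<in>{1..k div 2 + 1}. of_real (circ_coeff k l r) * Y r) =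
    (\<Sum>q<k. of_real (cos (2 * pi * real l * real q / real k)) * Y (sym_letter k q)) / of_real (sqrt (real k))"
proof -
  let ?c = "\<lambda>q. complex_of_real (cos (2 * pi * real l * real q / real k))"
  have "(\<Sum>r\<in>{1..k div 2 + 1}. of_real (circ_coeff k l r) * Y r) =
      (\<Sum>r\<in>{1..k div 2 + 1}. \<Sum>q<k. (if sym_letter k q = r then ?c q * Y r else 0)) / of_real (sqrt (real k))"
    unfolding circ_coeff_def sum_divide_distrib[of _ "{1..k div 2 + 1}"]
    by (intro sum.cong refl)
       (simp add: sum_distrib_right sum_divide_distrib if_distrib[of complex_of_real] if_distrib[of "\<lambda>x. x * _"] cong: if_cong)
  also have "(\<Sum>r\<in>{1..k div 2 + 1}. \<Sum>q<k. (if sym_letter k q = r then ?c q * Y r else 0)) =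
      (\<Sum>q<k. \<Sum>r\<in>{1..k div 2 + 1}. (if sym_letter k q = r then ?c q * Y r else 0))"
    by (rule sum.swap)
  also have "\<dots> = (\<Sum>q<k. ?c q * Y (sym_letter k q))"
  proof (rule sum.cong[OF refl])
    fix q assume "q \<in> {..<k}"
    then have "sym_letter k q \<in> {1..k div 2 + 1}" by (intro sym_letter_range) simp
    then show "(\<Sum>r\<in>{1..k div 2 + 1}. (if sym_letter k q = r then ?c q * Y r else 0)) = ?c q * Y (sym_letter k q)"
      by (subst sum.delta') auto
  qed
  finally show ?thesis .
qed

text \<open>Up to the factor \<open>1 / sqrt k\<close>, a letter shared by \<open>q\<close> and
  \<open>k - q\<close> has coefficient \<open>2 cos\<close>, since the cosine takes the same value
  at both offsets, while an unpaired offset has \<open>cos\<close>. Summing \<open>2 cos^2\<close>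
  over all offsets gives \<open>k\<close>, or \<open>2 k\<close> when the double frequency
  \<open>2 l\<close> is trivial modulo \<open>k\<close>; the unpaired offsets then subtract
  \<open>1\<close> or \<open>2\<close>.\<close>

lemma sum_circ_coeff_squared:
  assumes k: "k > 0"
  shows "(\<Sum>r\<in>{1..k div 2 + 1}. (circ_coeff k l r)\<^sup>2) =
    (real k + (if k dvd 2 * l then real k else 0) - (if odd k then 1 else 2)) / real k"
proof -
  define C where "C q = cos (2 * pi * real l * real q / real k)" for q
  have C_sym: "C q' = C q" if "q + q' = k" for q q'
  proof -
    have "2 * pi * real l * real q' / real k = 2 * pi * real l - 2 * pi * real l * real q / real k"
    proof -
      have q': "real q' = real k - real q" using that by linarith
      show ?thesis unfolding q' using k by (simp add: field_simps)
    qed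
    moreover have "cos (2 * pi * real l - x) = cos x" for x
    proof -
      have "cos (2 * pi * real l) = 1" "sin (2 * pi * real l) = 0"
        using cos_2npi[of l] sin_2npi[of l] by (simp_all add: mult_ac)
      then show ?thesis by (simp add: cos_diff)
    qed
    ultimately show ?thesis by (simp add: C_def)
  qed
  have "complex_of_real (real k * (\<Sum>r\<in>{1..k div 2 + 1}. (circ_coeff k l r)\<^sup>2)) =
      of_nat k * (\<Sum>r\<in>{1..k div 2 + 1}. of_real (circ_coeff k l r) * of_real (circ_coeff k l r))"
    by (simp add: power2_eq_square)
  also have "\<dots> = of_nat k * ((\<Sum>q<k. of_real (C q) * of_real (circ_coeff k l (sym_letter k q))) / of_real (sqrt (real k)))"
    unfolding sum_circ_coeff C_def ..
  also have "\<dots> = of_real (\<Sum>q<k. C q * (sqrt (real k) * circ_coeff k l (sym_letter k q)))"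
  proof -
    have "complex_of_nat k = of_real (sqrt (real k)) * of_real (sqrt (real k))"
      by (simp flip: of_real_mult)
    then have *: "of_nat k * (x / of_real (sqrt (real k))) = of_real (sqrt (real k)) * x" for x :: complex
      using k by simp
    show ?thesis unfolding * by (simp add: sum_distrib_left mult_ac)
  qed
  finally have "real k * (\<Sum>r\<in>{1..k div 2 + 1}. (circ_coeff k l r)\<^sup>2) =
      (\<Sum>q<k. C q * (sqrt (real k) * circ_coeff k l (sym_letter k q)))"
    by (simp only: of_real_eq_iff)
  \<comment> \<open>The corrected offsets are \<open>q = 0\<close>, whose partner \<open>k\<close>
    is out of range, and \<open>2 q = k\<close>, which is its own partner.\<close>
  also have "\<dots> = (\<Sum>q<k. (C q)\<^sup>2 * 2 - (if q = 0 then 1 else 0) - (if 2 * q = k then (C q)\<^sup>2 else 0))"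
  proof (rule sum.cong[OF refl])
    fix q assume q: "q \<in> {..<k}"
    have "sqrt (real k) * circ_coeff k l (sym_letter k q) = (\<Sum>q'<k. if sym_letter k q' = sym_letter k q then C q' else 0)"
      unfolding circ_coeff_def C_def using k by simp
    also have "\<dots> = (\<Sum>q'<k. (if q' = q then C q else 0) + (if q' = k - q then (if q = 0 \<or> 2 * q = k then 0 else C q) else 0))"
    proof (rule sum.cong[OF refl])
      fix q' assume q': "q' \<in> {..<k}"
      have "sym_letter k q' = sym_letter k q \<longleftrightarrow> q' = q \<or> q + q' = k"
        using sym_letter_eq_iff[of q k q'] q q' by auto
      then show "(if sym_letter k q' = sym_letter k q then C q' else 0) =
          (if q' = q then C q else 0) + (if q' = k - q then (if q = 0 \<or> 2 * q = k then 0 else C q) else 0)"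
        using q q' C_sym[of q q'] by auto
    qed
    also have "\<dots> = C q + (if q = 0 \<or> 2 * q = k then 0 else C q)"
      using q by (simp add: sum.distrib)
    finally have s: "sqrt (real k) * circ_coeff k l (sym_letter k q) = \<dots>" .
    have "C 0 = 1" by (simp add: C_def)
    then show "C q * (sqrt (real k) * circ_coeff k l (sym_letter k q)) =
        (C q)\<^sup>2 * 2 - (if q = 0 then 1 else 0) - (if 2 * q = k then (C q)\<^sup>2 else 0)"
      unfolding s using k by (auto simp: power2_eq_square)
  qed
  also have "\<dots> = (\<Sum>q<k. (C q)\<^sup>2 * 2) - 1 - (\<Sum>q<k. if 2 * q = k then (C q)\<^sup>2 else 0)"
    using k by (simp add: sum_subtractf)
  also have "(\<Sum>q<k. (C q)\<^sup>2 * 2) = real k + (if k dvd 2 * l then real k else 0)"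
  proof -
    have "(C q)\<^sup>2 * 2 = 1 + Re (unit_root k (int q * (2 * int l)))" for q
    proof -
      have "cos (2 * pi * real_of_int (int q * (2 * int l)) / real k) = cos (2 * (2 * pi * real l * real q / real k))"
        by (simp add: mult_ac)
      then show ?thesis unfolding Re_unit_root C_def by (simp only: cos_double_cos)
    qed
    then have "(\<Sum>q<k. (C q)\<^sup>2 * 2) = real k + Re (\<Sum>q<k. unit_root k (int q * (2 * int l)))"
      by (simp add: sum.distrib)
    also have "(\<Sum>q<k. unit_root k (int q * (2 * int l))) = (if k dvd 2 * l then of_nat k else 0)"
      unfolding sum_unit_root[OF k] by (metis int_dvd_int_iff of_nat_mult of_nat_numeral)
    finally show ?thesis by simp
  qed
  also have "(\<Sum>q<k. if 2 * q = k then (C q)\<^sup>2 else 0) = (if odd k then 0 else 1)"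
  proof (cases "odd k")
    case False
    then obtain h where h: "k = 2 * h" by auto
    then have "h > 0" "h < k" using k by auto
    have "(\<Sum>q<k. if 2 * q = k then (C q)\<^sup>2 else 0) = (\<Sum>q<k. if q = h then (C h)\<^sup>2 else 0)"
      using h by (intro sum.cong) auto
    also have "\<dots> = (C h)\<^sup>2" using \<open>h < k\<close> by simp
    also have "C h = cos (pi * real l)" using h \<open>h > 0\<close> by (simp add: C_def)
    also have "(cos (pi * real l))\<^sup>2 = 1" by (simp add: mult.commute[of pi] cos_npi flip: power_mult)
    finally show ?thesis using False by simp
  next
    case True
    then have "2 * q \<noteq> k" for q by auto
    with True show ?thesis by simp
  qed
  finally show ?thesis using k by (simp add: field_simps split: if_splits)
qed

lemma sum_indicator_dvd_add:
  fixes Y :: "nat \<Rightarrow> complex"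
  assumes k: "k > 0"
  shows "(\<Sum>q<k. (if int k dvd d + int q then of_nat k else 0) * Y q) = of_nat k * Y (nat ((- d) mod int k))"
proof -
  let ?q = "nat ((- d) mod int k)"
  have q: "?q < k" "int ?q = (- d) mod int k" using k by (auto simp: nat_less_iff)
  have "int k dvd d + int q \<longleftrightarrow> q = ?q" if "q < k" for q
  proof -
    have "int k dvd d + int q \<longleftrightarrow> int q mod int k = (- d) mod int k"
      by (metis add.commute diff_minus_eq_add mod_eq_dvd_iff)
    also have "\<dots> \<longleftrightarrow> int q = int ?q" unfolding q(2) using that by simp
    finally show ?thesis by (simp only: of_nat_eq_iff)
  qed
  then have "(\<Sum>q<k. (if int k dvd d + int q then of_nat k else 0) * Y q) = (\<Sum>q<k. if q = ?q then of_nat k * Y q else 0)"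
    by (intro sum.cong refl) auto
  then show ?thesis using q by simp
qed

text \<open>The cosine is half the sum of two conjugate characters, so orthogonality selects the
  offsets congruent to \<open>- d\<close> and to \<open>d\<close>. Both carry the same letter, hence
  the halves add up.\<close>

lemma fourier_sym_circulant:
  fixes Y :: "nat \<Rightarrow> complex"
  assumes k: "k > 0"
  shows "(\<Sum>l<k. unit_root k (int l * d) * (\<Sum>q<k. of_real (cos (2 * pi * real l * real q / real k)) * Y (sym_letter k q))) =
    of_nat k * Y (sym_letter k (nat ((- d) mod int k)))"
proof -
  let ?Y = "\<lambda>q. Y (sym_letter k q)"
  have cos: "complex_of_real (cos (2 * pi * real l * real q / real k)) = (unit_root k (int l * int q) + unit_root k (int l * - int q)) / 2" for l q
    by (simp add: unit_root_minus complex_add_cnj Re_unit_root mult.assoc)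
  have "(\<Sum>l<k. unit_root k (int l * d) * (\<Sum>q<k. of_real (cos (2 * pi * real l * real q / real k)) * ?Y q)) =
      (\<Sum>l<k. \<Sum>q<k. (unit_root k (int l * (d + int q)) + unit_root k (int l * (d + - int q))) * ?Y q / 2)"
    unfolding sum_distrib_left cos
    by (intro sum.cong refl) (simp only: distrib_left[of "int _"] unit_root_add, simp add: field_simps)
  also have "\<dots> = (\<Sum>q<k. ((\<Sum>l<k. unit_root k (int l * (d + int q))) + (\<Sum>l<k. unit_root k (int l * (d + - int q)))) * ?Y q / 2)"
    by (subst sum.swap, rule sum.cong[OF refl])
       (simp only: sum.distrib[symmetric] sum_distrib_right sum_divide_distrib)
  also have "\<dots> = ((\<Sum>q<k. (if int k dvd d + int q then of_nat k else 0) * ?Y q) + (\<Sum>q<k. (if int k dvd - d + int q then of_nat k else 0) * ?Y q)) / 2"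
  proof -
    have "int k dvd d + - int q \<longleftrightarrow> int k dvd - d + int q" for q
      by (metis add.commute diff_conv_add_uminus dvd_diff_commute)
    then show ?thesis unfolding sum_unit_root[OF k]
      by (simp only: distrib_right sum.distrib add_divide_distrib sum_divide_distrib)
  qed
  also have "\<dots> = (of_nat k * ?Y (nat ((- d) mod int k)) + of_nat k * ?Y (nat ((- (- d)) mod int k))) / 2"
    by (simp only: sum_indicator_dvd_add[OF k])
  also have "sym_letter k (nat ((- (- d)) mod int k)) = sym_letter k (nat ((- d) mod int k))"
  proof -
    let ?a = "d mod int k" and ?b = "(- d) mod int k"
    have a: "0 \<le> ?a" "?a < int k" "0 \<le> ?b" "?b < int k" using k by auto
    have "?b = (if ?a = 0 then 0 else int k - ?a)" by (rule zmod_zminus1_eq_if)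
    then have "nat ?b = nat ?a \<or> nat ?a + nat ?b = k" using a by (auto split: if_splits)
    then show ?thesis using sym_letter_eq_iff[of "nat ?a" k "nat ?b"] a by (auto simp: nat_less_iff)
  qed
  finally show ?thesis by simp
qed

text \<open>Both sides are Lipschitz in \<open>z\<close> on \<open>Im z \<ge> e\<close>, uniformly
  in \<open>n\<close>, so a nearby rational point decides. This is what reduces an uncountable
  family of almost sure statements to a countable one.\<close>

lemma tendsto_stieltjes_of_rat:
  assumes A: "\<And>n. hermitian_on n (A n)" and v: "v > 0"
    and conv: "\<And>p q :: rat. q > 0 \<Longrightarrow>
      (\<lambda>n. stieltjes n (A n) (Complex (of_rat p) (of_rat q))) \<longlonglongrightarrow> semicircle_stieltjes v (Complex (of_rat p) (of_rat q))"
    and z: "Im z > 0"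
  shows "(\<lambda>n. stieltjes n (A n) z) \<longlonglongrightarrow> semicircle_stieltjes v z"
proof (rule tendstoI)
  fix \<epsilon> :: real assume \<epsilon>: "\<epsilon> > 0"
  define e where "e = Im z / 2"
  have e: "e > 0" using z by (simp add: e_def)
  \<comment> \<open>The sum of the two Lipschitz constants. The choice of \<open>\<delta>\<close>
    keeps the rational point above height \<open>e\<close> and makes \<open>K\<close> times its
    distance to \<open>z\<close> at most \<open>\<epsilon> / 2\<close>.\<close>
  define K where "K = 1 / e\<^sup>2 + 1 / (sqrt v * e)"
  have K: "K > 0" using e v by (simp add: K_def add_pos_pos)
  define \<delta> where "\<delta> = min e (\<epsilon> / (2 * K)) / 2"
  have \<delta>: "\<delta> > 0" using e \<epsilon> K by (simp add: \<delta>_def)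
  have \<delta>e: "2 * \<delta> \<le> e" and \<delta>K: "2 * \<delta> \<le> \<epsilon> / (2 * K)" by (simp_all add: \<delta>_def)
  obtain p :: rat where p: "Re z - \<delta> < of_rat p" "of_rat p < Re z + \<delta>"
    using of_rat_dense[of "Re z - \<delta>" "Re z + \<delta>"] \<delta> by auto
  obtain q :: rat where q: "Im z - \<delta> < of_rat q" "of_rat q < Im z + \<delta>"
    using of_rat_dense[of "Im z - \<delta>" "Im z + \<delta>"] \<delta> by auto
  define w where "w = Complex (of_rat p) (of_rat q)"
  have Imw: "Im w \<ge> e" using q \<delta>e \<delta> unfolding w_def e_def by simp
  then have "e \<le> real_of_rat q" by (simp add: w_def)
  then have "0 < real_of_rat q" using e by linarith
  then have q0: "q > 0" by simp
  have "cmod (z - w) \<le> \<bar>Re (z - w)\<bar> + \<bar>Im (z - w)\<bar>" by (rule cmod_le)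
  also have "\<dots> < \<delta> + \<delta>" using p q by (intro add_strict_mono) (auto simp: w_def abs_less_iff)
  finally have zw: "cmod (z - w) < 2 * \<delta>" by simp
  have Imz: "Im z \<ge> e" using z by (simp add: e_def)
  have "\<forall>\<^sub>F n in sequentially. dist (stieltjes n (A n) w) (semicircle_stieltjes v w) < \<epsilon> / 2"
    using tendstoD[OF conv[OF q0, of p], of "\<epsilon> / 2"] \<epsilon> by (simp add: w_def)
  then show "\<forall>\<^sub>F n in sequentially. dist (stieltjes n (A n) z) (semicircle_stieltjes v z) < \<epsilon>"
  proof eventually_elim
    case (elim n)
    have 1: "cmod (stieltjes n (A n) z - stieltjes n (A n) w) \<le> cmod (z - w) / e\<^sup>2"
      by (rule stieltjes_lipschitz[OF A Imz Imw e])
    have "cmod (semicircle_stieltjes v w - semicircle_stieltjes v z) \<le> cmod (w - z) / (sqrt v * Im z)"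
      using semicircle_stieltjes_lipschitz[OF v _ z] Imw e by simp
    also have "\<dots> \<le> cmod (w - z) / (sqrt v * e)"
      using v e Imz by (intro divide_left_mono mult_left_mono mult_pos_pos) auto
    finally have 2: "cmod (semicircle_stieltjes v w - semicircle_stieltjes v z) \<le> cmod (z - w) / (sqrt v * e)"
      by (simp add: norm_minus_commute)
    have "dist (stieltjes n (A n) z) (semicircle_stieltjes v z) \<le>
        cmod (stieltjes n (A n) z - stieltjes n (A n) w) + dist (stieltjes n (A n) w) (semicircle_stieltjes v w)
        + cmod (semicircle_stieltjes v w - semicircle_stieltjes v z)"
      unfolding dist_norm using norm_triangle_ineq[of "stieltjes n (A n) z - stieltjes n (A n) w" "stieltjes n (A n) w - semicircle_stieltjes v w"]
        norm_triangle_ineq[of "stieltjes n (A n) z - semicircle_stieltjes v w" "semicircle_stieltjes v w - semicircle_stieltjes v z"] by simp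
    also have "\<dots> < cmod (z - w) / e\<^sup>2 + \<epsilon> / 2 + cmod (z - w) / (sqrt v * e)"
      using 1 2 elim by linarith
    also have "\<dots> = K * cmod (z - w) + \<epsilon> / 2" by (simp add: K_def field_simps)
    also have "\<dots> \<le> K * (\<epsilon> / (2 * K)) + \<epsilon> / 2" using zw \<delta>K K by (intro add_right_mono mult_left_mono) auto
    also have "\<dots> = \<epsilon>" using K by simp
    finally show ?case .
  qed
qed

text \<open>These frequencies, \<open>0\<close> and for even \<open>k\<close> also
  \<open>k / 2\<close>, are the Fourier blocks of larger variance, so their number is the numerator
  of the second weight in \<open>nu k\<close>.\<close>

lemma card_dvd_double:
  fixes k :: nat
  assumes k: "k > 0"
  shows "card {l. l < k \<and> k dvd 2 * l} = (if odd k then 1 else 2)"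
proof (cases "odd k")
  case True
  then have "{l. l < k \<and> k dvd 2 * l} = {0}"
    using k by (auto simp: coprime_dvd_mult_right_iff dest: dvd_imp_le)
  with True show ?thesis by simp
next
  case False
  then obtain h where h: "k = 2 * h" by auto
  have "l = 0 \<or> l = h" if "l < 2 * h" "h dvd l" for l
  proof -
    obtain c where c: "l = h * c" using \<open>h dvd l\<close> by blast
    then have "c < 2" using \<open>l < 2 * h\<close> by (simp add: mult.commute)
    with c show ?thesis by (auto simp: less_2_cases_iff)
  qed
  then have "{l. l < k \<and> k dvd 2 * l} = {0, h}" using h k by auto
  with False h k show ?thesis by simp
qed

lemma sum_if_dvd_double:
  fixes a b :: complex
  assumes k: "k > 0"
  shows "(\<Sum>l<k. if k dvd 2 * l then a else b) =
    of_nat (if odd k then 1 else 2) * a + of_nat (k - (if odd k then 1 else 2)) * b"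
proof -
  let ?D = "{l. l < k \<and> k dvd 2 * l}"
  have sub: "?D \<subseteq> {..<k}" by auto
  have "(\<Sum>l<k. if k dvd 2 * l then a else b) = (\<Sum>l\<in>?D. a) + (\<Sum>l\<in>{..<k} - ?D. b)"
    by (subst sum.subset_diff[OF sub]) (auto simp: add.commute intro!: arg_cong2[where f = "(+)"] sum.cong)
  also have "\<dots> = of_nat (card ?D) * a + of_nat (k - card ?D) * b"
    using card_Diff_subset[OF finite_subset[OF sub] sub] by simp
  finally show ?thesis unfolding card_dvd_double[OF k] .
qed

text \<open>For an array that is Hermitian at \<open>\<omega>\<close>, the real part and the
  conjugation built into \<open>wigner_comb\<close> change nothing. This links the symmetrised
  matrix of the probabilistic estimates to the actual Wigner matrices.\<close>

lemma wigner_comb_entries: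
  assumes "prob_space M" and wig: "\<And>r. r \<in> R \<Longrightarrow> prob_space.wigner_array M v (X r)" and \<omega>: "\<omega> \<in> space M"
  shows "wigner_comb R c n (\<lambda>(r, i, j). X r i j \<omega>) i j = (\<Sum>r\<in>R. of_real (c r) * (X r i j \<omega> / of_real (sqrt (real n))))"
proof -
  interpret prob_space M by fact
  have herm: "cnj (X r i j \<omega>) = X r j i \<omega>" if "r \<in> R" for r i j
    using wig[OF that] \<omega> unfolding wigner_array_def by metis
  have re: "complex_of_real (Re (\<Sum>r\<in>R. of_real (c r) * X r i i \<omega>)) = (\<Sum>r\<in>R. of_real (c r) * X r i i \<omega>)" for i
  proof -
    have "cnj (\<Sum>r\<in>R. of_real (c r) * X r i i \<omega>) = (\<Sum>r\<in>R. of_real (c r) * X r i i \<omega>)"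
      unfolding cnj_sum by (intro sum.cong refl) (simp add: herm)
    then show ?thesis by (intro of_real_Re) (simp only: Reals_cnj_iff)
  qed
  have cn: "cnj (\<Sum>r\<in>R. of_real (c r) * X r j i \<omega>) = (\<Sum>r\<in>R. of_real (c r) * X r i j \<omega>)" for i j
    unfolding cnj_sum by (intro sum.cong refl) (simp add: herm)
  show ?thesis
    unfolding wigner_comb_def prod.case re cn
    by (cases i j rule: linorder_cases) (simp_all add: sum_divide_distrib)
qed

section \<open>The symmetric circulant as an inverse Fourier transform\<close>

context
  fixes k n :: nat and X :: "nat \<Rightarrow> nat \<Rightarrow> nat \<Rightarrow> 'a \<Rightarrow> complex" and M :: "'a measure" and \<omega> :: 'a
  assumes M: "prob_space M" and k: "k > 0" and n: "n > 0" and \<omega>: "\<omega> \<in> space M"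
    and wig: "\<And>r. r \<in> {1..k div 2 + 1} \<Longrightarrow> prob_space.wigner_array M 1 (X r)"
begin

private definition block :: "nat \<Rightarrow> nat \<Rightarrow> nat \<Rightarrow> complex" where
  "block l = wigner_comb {1..k div 2 + 1} (circ_coeff k l) n (\<lambda>(r, i, j). X r i j \<omega>)"

private definition circ :: "complex mat" where
  "circ = sym_circulant_block k n (\<lambda>r. wigner_matrix n (X r) \<omega>)"

text \<open>Regrouping the coefficients by offset turns each block into a cosine sum, whose Fourier
  inversion returns the letter. With \<open>d\<close> the block row minus the block column, its
  offset is \<open>- d\<close> modulo \<open>k\<close>, as in
  \<open>circulant_block\<close>.\<close>

private lemma circ_fourier:
  assumes ij: "i < n * k" "j < n * k"
  shows "circ $$ (i, j) = (\<Sum>l<k. unit_root k (int l * (int (i div n) - int (j div n))) * block l (i mod n) (j mod n)) / of_nat k"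
proof -
  let ?d = "int (i div n) - int (j div n)"
  define Y where "Y r = X r (i mod n) (j mod n) \<omega> / of_real (sqrt (real n))" for r
  have b: "block l (i mod n) (j mod n) = (\<Sum>q<k. of_real (cos (2 * pi * real l * real q / real k)) * Y (sym_letter k q)) / of_real (sqrt (real k))" for l
  proof -
    have "block l (i mod n) (j mod n) = (\<Sum>r\<in>{1..k div 2 + 1}. of_real (circ_coeff k l r) * Y r)"
      unfolding block_def Y_def by (rule wigner_comb_entries[OF M wig \<omega>])
    then show ?thesis by (simp only: sum_circ_coeff)
  qed
  have "(\<Sum>l<k. unit_root k (int l * ?d) * block l (i mod n) (j mod n)) =
      (\<Sum>l<k. unit_root k (int l * ?d) * (\<Sum>q<k. of_real (cos (2 * pi * real l * real q / real k)) * Y (sym_letter k q))) / of_real (sqrt (real k))"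
    by (simp only: b times_divide_eq_right sum_divide_distrib[symmetric])
  also have "\<dots> = of_nat k * Y (sym_letter k (nat ((- ?d) mod int k))) / of_real (sqrt (real k))"
    by (simp only: fourier_sym_circulant[OF k])
  finally have "(\<Sum>l<k. unit_root k (int l * ?d) * block l (i mod n) (j mod n)) / of_nat k =
      Y (sym_letter k (nat ((- ?d) mod int k))) / of_real (sqrt (real k))"
    using k by simp
  moreover have "circ $$ (i, j) = Y (sym_letter k (nat ((- ?d) mod int k))) / of_real (sqrt (real k))"
    using ij n unfolding circ_def sym_circulant_block_def circulant_block_def
    by (simp add: Y_def wigner_matrix_def sym_letter_def)
  ultimately show ?thesis by simp
qed

lemma sym_circulant_block_carrier:
  "sym_circulant_block k n (\<lambda>r. wigner_matrix n (X r) \<omega>) \<in> carrier_mat (n * k) (n * k)"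
  by (simp add: sym_circulant_block_def circulant_block_def)

lemma hermitian_sym_circulant_block:
  "hermitian_on (n * k) (\<lambda>i j. sym_circulant_block k n (\<lambda>r. wigner_matrix n (X r) \<omega>) $$ (i, j))"
  unfolding circ_def[symmetric]
  by (rule hermitian_block_circulant[OF n k, of block]) (simp_all add: block_def hermitian_wigner_comb circ_fourier)

lemma stieltjes_sym_circulant_block:
  assumes z: "Im z \<noteq> 0"
  shows "stieltjes (n * k) (\<lambda>i j. sym_circulant_block k n (\<lambda>r. wigner_matrix n (X r) \<omega>) $$ (i, j)) z =
    (\<Sum>l<k. stieltjes n (wigner_comb {1..k div 2 + 1} (circ_coeff k l) n (\<lambda>(r, i, j). X r i j \<omega>)) z) / of_nat k"
  unfolding circ_def[symmetric] block_def[symmetric]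
  by (rule stieltjes_block_circulant[OF n k, of block]) (simp_all add: block_def hermitian_wigner_comb circ_fourier z)

end

text \<open>Lets the proof skip \<open>n = 0\<close>, where the matrix is empty and its spectral
  measure is null rather than a probability measure.\<close>

lemma weak_conv_m_Suc: "weak_conv_m (\<lambda>n. \<mu> (Suc n)) \<nu> \<Longrightarrow> weak_conv_m \<mu> \<nu>"
  unfolding weak_conv_m_def weak_conv_def by (auto intro: LIMSEQ_imp_Suc)

lemma borel_measurable_semicircle_stieltjes:
  assumes v: "v > 0" and e: "e > 0"
  shows "(\<lambda>x. semicircle_stieltjes v (Complex x e)) \<in> borel_measurable borel"
proof (rule borel_measurable_continuous_onI)
  have "(1 / (sqrt v * e))-lipschitz_on UNIV (\<lambda>x. semicircle_stieltjes v (Complex x e))"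
  proof (rule lipschitz_onI)
    fix x y :: real
    have "cmod (Complex x e - Complex y e) = \<bar>x - y\<bar>" by (simp add: cmod_def)
    then show "dist (semicircle_stieltjes v (Complex x e)) (semicircle_stieltjes v (Complex y e)) \<le> 1 / (sqrt v * e) * dist x y"
      using semicircle_stieltjes_lipschitz[OF v, of "Complex x e" "Complex y e"] e by (simp add: dist_norm)
  qed (use v e in simp)
  then show "continuous_on UNIV (\<lambda>x. semicircle_stieltjes v (Complex x e))"
    by (rule lipschitz_on_continuous_on)
qed

section \<open>The limiting spectral distribution\<close>

theorem proposition1:
  fixes M :: "'a measure" and k :: nat and X :: "nat \<Rightarrow> nat \<Rightarrow> nat \<Rightarrow> 'a \<Rightarrow> complex"
  assumes "prob_space M"
    and "k \<ge> 1"
    and "\<And>r. r \<in> {1..k div 2 + 1} \<Longrightarrow> prob_space.wigner_array M 1 (X r)"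
    and "prob_space.indep_vars M (\<lambda>_. Pi\<^sub>M UNIV (\<lambda>_. borel)) (\<lambda>r \<omega> (i, j). X r i j \<omega>)
           {1..k div 2 + 1}"
  shows "AE \<omega> in M.
           weak_conv_m
             (\<lambda>n. spectral_measure (sym_circulant_block k n (\<lambda>r. wigner_matrix n (X r) \<omega>)))
             (nu k)"
proof -
  interpret prob_space M by fact
  have k: "k > 0" using assms(2) by simp
  let ?R = "{1..k div 2 + 1}"
  define m where "m = (if odd k then 1 else 2 :: nat)"
  have m: "m \<ge> 1" "m \<le> k" using k by (auto simp: m_def elim!: evenE)
  define w1 w2 v2 where "w1 = (real k - real m) / real k" and "w2 = real m / real k"
    and "v2 = (2 * real k - real m) / real k"
  have w: "w1 \<ge> 0" "w2 \<ge> 0" "w1 + w2 = 1" using k m by (auto simp: w1_def w2_def field_simps)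
  have v2: "v2 > 0" using k m by (simp add: v2_def)
  have v1: "w1 > 0" if "w1 \<noteq> 0" using w that by simp
  \<comment> \<open>\<open>w1\<close> is at once the weight and the variance of the first component;
    for \<open>k = 1\<close> and \<open>k = 2\<close> it is \<open>0\<close>.\<close>
  have nu: "nu k = weighted_measure_sum [(w1, semicircle 0 w1), (w2, semicircle 0 v2)]"
    by (simp add: nu_def w1_def w2_def v2_def m_def)
  define v where "v l = (if k dvd 2 * l then v2 else w1)" for l
  have v_eq: "(\<Sum>r\<in>?R. (circ_coeff k l r)\<^sup>2) = v l" for l
    unfolding sum_circ_coeff_squared[OF k] v_def w1_def v2_def m_def by simp
  have v_pos: "v l > 0" if "l < k" for l
  proof (cases "k dvd 2 * l")
    case False
    \<comment> \<open>An index with \<open>k\<close> not dividing \<open>2 l\<close> leaves fewer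
      than \<open>k\<close> exceptional indices, so \<open>m < k\<close> and
      \<open>w1 > 0\<close>.\<close>
    then have "card {l. l < k \<and> k dvd 2 * l} < card {..<k}"
      using that by (intro psubset_card_mono) auto
    then show ?thesis using False k by (simp add: card_dvd_double v_def w1_def m_def)
  qed (simp add: v_def v2)
  interpret wigner_family M ?R "circ_coeff k l" X for l
    by (rule wigner_family_of_arrays) (use assms in auto)
  \<comment> \<open>The exceptional null set depends on \<open>l\<close>, \<open>p\<close> and
    \<open>q\<close>, which range over countable sets.\<close>
  have "AE \<omega> in M. \<forall>l\<in>{..<k}. \<forall>p q :: rat. q > 0 \<longrightarrow>
      (\<lambda>n. stieltjes n (W l n \<omega>) (Complex (of_rat p) (of_rat q))) \<longlonglongrightarrow> semicircle_stieltjes (v l) (Complex (of_rat p) (of_rat q))"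
  proof (intro AE_finite_allI)
    fix l assume l: "l \<in> {..<k}"
    have "AE \<omega> in M. (\<lambda>n. stieltjes n (W l n \<omega>) (Complex (of_rat p) (of_rat q))) \<longlonglongrightarrow> semicircle_stieltjes (v l) (Complex (of_rat p) (of_rat q))"
      if "q > 0" for p q :: rat
      by (rule AE_tendsto_stieltjes[unfolded v_eq]) (use that l v_pos in auto)
    then show "AE \<omega> in M. \<forall>p q :: rat. q > 0 \<longrightarrow>
      (\<lambda>n. stieltjes n (W l n \<omega>) (Complex (of_rat p) (of_rat q))) \<longlonglongrightarrow> semicircle_stieltjes (v l) (Complex (of_rat p) (of_rat q))"
      by (simp add: AE_all_countable)
  qed simp
  then show ?thesis
    using AE_space
  proof eventually_elim
    case (elim \<omega>)
    let ?C = "\<lambda>n. sym_circulant_block k n (\<lambda>r. wigner_matrix n (X r) \<omega>)"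
    let ?S = "\<lambda>z. of_real w1 * semicircle_stieltjes w1 z + of_real w2 * semicircle_stieltjes v2 z"
    have conv_l: "(\<lambda>n. stieltjes n (W l n \<omega>) z) \<longlonglongrightarrow> semicircle_stieltjes (v l) z" if "l < k" "Im z > 0" for l z
      by (rule tendsto_stieltjes_of_rat[OF hermitian_W v_pos[OF that(1)] _ that(2)]) (use elim(1) that(1) in blast)
    have conv: "(\<lambda>n. stieltjes (Suc n * k) (\<lambda>i j. ?C (Suc n) $$ (i, j)) z) \<longlonglongrightarrow> ?S z" if z: "Im z > 0" for z
    proof -
      have "(\<lambda>n. (\<Sum>l<k. stieltjes (Suc n) (W l (Suc n) \<omega>) z) / of_nat k) \<longlonglongrightarrow> (\<Sum>l<k. semicircle_stieltjes (v l) z) / of_nat k"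
        using k z by (intro tendsto_divide tendsto_sum tendsto_const LIMSEQ_Suc[OF conv_l]) auto
      moreover have "(\<Sum>l<k. semicircle_stieltjes (v l) z) / of_nat k = ?S z"
      proof -
        have "(\<Sum>l<k. semicircle_stieltjes (v l) z) = (\<Sum>l<k. if k dvd 2 * l then semicircle_stieltjes v2 z else semicircle_stieltjes w1 z)"
          by (intro sum.cong) (auto simp: v_def)
        also have "\<dots> = of_nat m * semicircle_stieltjes v2 z + of_nat (k - m) * semicircle_stieltjes w1 z"
          unfolding sum_if_dvd_double[OF k] m_def ..
        finally show ?thesis using k m by (simp add: w1_def w2_def of_nat_diff field_simps)
      qed
      moreover have "stieltjes (Suc n * k) (\<lambda>i j. ?C (Suc n) $$ (i, j)) z = (\<Sum>l<k. stieltjes (Suc n) (W l (Suc n) \<omega>) z) / of_nat k" for n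
        unfolding W_def entries_def
        by (rule stieltjes_sym_circulant_block[OF assms(1) k _ elim(2) assms(3)]) (use z in auto)
      ultimately show ?thesis by simp
    qed
    have C: "?C (Suc n) \<in> carrier_mat (Suc n * k) (Suc n * k)" "hermitian_on (Suc n * k) (\<lambda>i j. ?C (Suc n) $$ (i, j))"
      "Suc n * k > 0" for n
      using sym_circulant_block_carrier[OF assms(1) k _ elim(2) assms(3), of "Suc n"]
        hermitian_sym_circulant_block[OF assms(1) k _ elim(2) assms(3), of "Suc n"] k by auto
    note spec = spectral_measure_properties[OF C]
    have "weak_conv_m (\<lambda>n. spectral_measure (?C (Suc n))) (nu k)"
    proof (rule stieltjes_inversion_weak_conv[where S = ?S and N = "\<lambda>n. Suc n * k"
          and l = "\<lambda>n i. hermitian_eigenvalues (?C (Suc n)) ! i"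
          and \<rho> = "\<lambda>x. w1 * semicircle_density w1 x + w2 * semicircle_density v2 x"
          and B = "w1 * (1 / sqrt w1) + w2 * (1 / sqrt v2)"])
      show "real_distribution (nu k)" unfolding nu by (rule real_distribution_semicircle_mixture[OF w v1 v2])
      show "measure (nu k) {a<..b} = (\<integral>x. (w1 * semicircle_density w1 x + w2 * semicircle_density v2 x) * indicator {a..b} x \<partial>lborel)" for a b
        unfolding nu by (rule measure_semicircle_mixture[OF w v1 v2])
      show "(\<lambda>n. (\<Sum>i<Suc n * k. 1 / (of_real (hermitian_eigenvalues (?C (Suc n)) ! i) - Complex x e)) / of_nat (Suc n * k)) \<longlonglongrightarrow> ?S (Complex x e)"
        if "e > 0" for x e
        using conv[of "Complex x e"] that by (subst spec(3)) auto
      show "(\<lambda>x. ?S (Complex x e)) \<in> borel_measurable borel" if "e > 0" for e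
        using borel_measurable_semicircle_stieltjes[OF v1 that] borel_measurable_semicircle_stieltjes[OF v2 that]
        by (cases "w1 = 0") auto
      \<comment> \<open>Uniform in the height \<open>e\<close>; when \<open>w1 = 0\<close> the first
        summand vanishes through its weight.\<close>
      show "\<bar>Im (?S (Complex x e))\<bar> \<le> w1 * (1 / sqrt w1) + w2 * (1 / sqrt v2)" if "e > 0" for x e
      proof -
        have "\<bar>u * Im (semicircle_stieltjes v (Complex x e))\<bar> \<le> u * (1 / sqrt v)" if "u \<ge> 0" "u \<noteq> 0 \<Longrightarrow> v > 0" for u v
        proof (cases "u = 0")
          case False
          then have "\<bar>Im (semicircle_stieltjes v (Complex x e))\<bar> \<le> 1 / sqrt v"
            by (intro order_trans[OF abs_Im_le_cmod cmod_semicircle_stieltjes_le] that) (use \<open>e > 0\<close> in auto)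
          then show ?thesis using that(1) by (simp only: abs_mult abs_of_nonneg) (intro mult_left_mono)
        qed simp
        from this[of w1 w1] this[of w2 v2] show ?thesis using w v1 v2 by (simp add: abs_le_iff)
      qed
      show "((\<lambda>e. Im (?S (Complex x e))) \<longlongrightarrow> pi * (w1 * semicircle_density w1 x + w2 * semicircle_density v2 x)) (at_right 0)" for x
      proof -
        have "((\<lambda>e. u * Im (semicircle_stieltjes v (Complex x e))) \<longlongrightarrow> u * (pi * semicircle_density v x)) (at_right 0)" if "u \<noteq> 0 \<Longrightarrow> v > 0" for u v
        proof (cases "u = 0")
          case False
          show ?thesis unfolding semicircle_density_def
            by (intro tendsto_mult tendsto_const Im_semicircle_stieltjes_boundary that False)
        qed simp
        from tendsto_add[OF this[of w1 w1] this[of w2 v2]] v1 v2 show ?thesis by (simp add: algebra_simps)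
      qed
    qed (use spec k in auto)
    then show ?case by (rule weak_conv_m_Suc)
  qed
qed

end
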